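(* Let $(A,\nabla_A,\eta_A)$ and $(B,\nabla_B,\eta_B)$ be separable unital associative $k$-algebras, denote by $\Gamma_A:A\to A\otimes A$ and $\Gamma_B:B\to B\otimes B$ the (bimodule) right inverses of the respective multiplications, and let $\tau:B\otimes A\to A\otimes B$ be a twisting map. Then the two identities $$(\Gamma_A\otimes 1)\,\tau=(1\otimes\tau)(\tau\otimes 1)(1\otimes\Gamma_A),\qquad (1\otimes\Gamma_B)\,\tau=(\tau\otimes 1)(1\otimes\tau)(\Gamma_B\otimes 1)$$ of maps $B\otimes A\to A\otimes A\otimes B$ and $B\otimes A\to A\otimes B\otimes B$ hold if and only if $(A\otimes_{\tau} B,\nabla_{A\otimes_{\tau} B},\eta_{A\otimes_{\tau} B})$ is a separable unital associative $k$-algebra for which $\Gamma_{A\otimes_{\tau} B}=(1\otimes \tau^{-1} \otimes 1)(\Gamma_A \otimes\Gamma_B): A\otimes_{\tau} B \to (A\otimes_{\tau} B) \otimes (A\otimes_{\tau} B)$ is a (bimodule) right inverse of its multiplication.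
   Context: $k$ is a field, $\otimes=\otimes_k$, and $1$ denotes identity maps. A $k$-algebra $(A,\nabla,\eta)$ is separable when the $A$-bimodule morphism $\nabla:A\otimes A\to A$ has a right inverse which is an $A$-bimodule morphism, i.e. there is a $k$-linear $\Gamma:A\to A\otimes A$ with $\nabla\Gamma=1$ and $\Gamma\nabla(1\otimes\nabla)=(\nabla\otimes\nabla)(1\otimes\Gamma\otimes 1)$ on $A\otimes A\otimes A$. A twisting map for algebras $A$, $B$ is a bijective $k$-linear map $\tau:B\otimes A\to A\otimes B$ such that $\tau(b\otimes 1_A)=1_A\otimes b$ and $\tau(1_B\otimes a)=a\otimes 1_B$ for all $a\in A$, $b\in B$, and $\tau(\nabla_B\otimes\nabla_A)=(\nabla_A\otimes\nabla_B)(1\otimes\tau\otimes 1)(\tau\otimes\tau)(1\otimes\tau\otimes 1)$. The twisted tensor product $A\otimes_\tau B$ is the vector space $A\otimes B$ with $\nabla_{A\otimes_\tau B}=(\nabla_A\otimes\nabla_B)(1\otimes\tau\otimes 1)$ and $\eta_{A\otimes_\tau B}=\eta_A\otimes\eta_B$ (using $k\cong k\otimes k$). *)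

theory Defs
  imports "HOL.Hull" "HOL-Algebra.AbelCoset" "HOL-Algebra.Module"
begin

text \<open>
  Vector spaces over a field \<open>K\<close> are modules in the sense of \<open>HOL-Algebra\<close>; algebras are records
  of the same type for which the ring operations are meaningful as well.  In plain vector spaces
  the \<open>mult\<close> and \<open>one\<close> fields carry no information.
  Maps are HOL functions that are only relevant on carriers.
\<close>

section \<open>Linear maps and tensor products\<close>

definition linear_map ::
    "('k, 'm) ring_scheme \<Rightarrow> ('k, 'v) module \<Rightarrow> ('k, 'w) module \<Rightarrow> ('v \<Rightarrow> 'w) \<Rightarrow> bool" where
  "linear_map K V W f \<longleftrightarrow>
     f \<in> carrier V \<rightarrow> carrier W \<and>
     (\<forall>x\<in>carrier V. \<forall>y\<in>carrier V. f (x \<oplus>\<^bsub>V\<^esub> y) = f x \<oplus>\<^bsub>W\<^esub> f y) \<and>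
     (\<forall>c\<in>carrier K. \<forall>x\<in>carrier V. f (c \<odot>\<^bsub>V\<^esub> x) = c \<odot>\<^bsub>W\<^esub> f x)"

definition bilinear_map ::
    "('k, 'm) ring_scheme \<Rightarrow> ('k, 'v) module \<Rightarrow> ('k, 'w) module \<Rightarrow> ('k, 'u) module \<Rightarrow>
     ('v \<Rightarrow> 'w \<Rightarrow> 'u) \<Rightarrow> bool" where
  "bilinear_map K V W U \<beta> \<longleftrightarrow>
     (\<forall>v\<in>carrier V. linear_map K W U (\<lambda>w. \<beta> v w)) \<and>
     (\<forall>w\<in>carrier W. linear_map K V U (\<lambda>v. \<beta> v w))"

definition free_module :: "('k, 'm) ring_scheme \<Rightarrow> 's set \<Rightarrow> ('k, 's \<Rightarrow> 'k) module" where
  "free_module K S =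
     \<lparr>carrier = {\<phi>. (\<forall>s. \<phi> s \<in> carrier K) \<and> finite {s. \<phi> s \<noteq> \<zero>\<^bsub>K\<^esub>} \<and> {s. \<phi> s \<noteq> \<zero>\<^bsub>K\<^esub>} \<subseteq> S},
      mult = undefined, one = undefined,
      zero = (\<lambda>s. \<zero>\<^bsub>K\<^esub>), add = (\<lambda>\<phi> \<psi> s. \<phi> s \<oplus>\<^bsub>K\<^esub> \<psi> s),
      smult = (\<lambda>c \<phi> s. c \<otimes>\<^bsub>K\<^esub> \<phi> s)\<rparr>"

definition free_gen :: "('k, 'm) ring_scheme \<Rightarrow> 's \<Rightarrow> 's \<Rightarrow> 'k" where
  "free_gen K s = (\<lambda>t. if t = s then \<one>\<^bsub>K\<^esub> else \<zero>\<^bsub>K\<^esub>)"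

definition quotient_module :: "('k, 'v) module \<Rightarrow> 'v set \<Rightarrow> ('k, 'v set) module" where
  "quotient_module M N =
     \<lparr>carrier = a_rcosets\<^bsub>M\<^esub> N,
      mult = undefined, one = undefined,
      zero = N, add = set_add M,
      smult = (\<lambda>c X. \<Union>x\<in>X. N +>\<^bsub>M\<^esub> (c \<odot>\<^bsub>M\<^esub> x))\<rparr>"

definition tensor_relators ::
    "('k, 'm) ring_scheme \<Rightarrow> ('k, 'v) module \<Rightarrow> ('k, 'w) module \<Rightarrow> ('v \<times> 'w \<Rightarrow> 'k) set" where
  "tensor_relators K V W =
     (let F = free_module K (carrier V \<times> carrier W); \<delta> = (\<lambda>v w. free_gen K (v, w)) in
      {\<delta> (v \<oplus>\<^bsub>V\<^esub> v') w \<ominus>\<^bsub>F\<^esub> (\<delta> v w \<oplus>\<^bsub>F\<^esub> \<delta> v' w) | v v' w.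
         v \<in> carrier V \<and> v' \<in> carrier V \<and> w \<in> carrier W} \<union>
      {\<delta> v (w \<oplus>\<^bsub>W\<^esub> w') \<ominus>\<^bsub>F\<^esub> (\<delta> v w \<oplus>\<^bsub>F\<^esub> \<delta> v w') | v w w'.
         v \<in> carrier V \<and> w \<in> carrier W \<and> w' \<in> carrier W} \<union>
      {\<delta> (c \<odot>\<^bsub>V\<^esub> v) w \<ominus>\<^bsub>F\<^esub> (c \<odot>\<^bsub>F\<^esub> \<delta> v w) | c v w.
         c \<in> carrier K \<and> v \<in> carrier V \<and> w \<in> carrier W} \<union>
      {\<delta> v (c \<odot>\<^bsub>W\<^esub> w) \<ominus>\<^bsub>F\<^esub> (c \<odot>\<^bsub>F\<^esub> \<delta> v w) | c v w.
         c \<in> carrier K \<and> v \<in> carrier V \<and> w \<in> carrier W})"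

definition tensor_kernel ::
    "('k, 'm) ring_scheme \<Rightarrow> ('k, 'v) module \<Rightarrow> ('k, 'w) module \<Rightarrow> ('v \<times> 'w \<Rightarrow> 'k) set" where
  "tensor_kernel K V W =
     (\<lambda>N. submodule N K (free_module K (carrier V \<times> carrier W))) hull tensor_relators K V W"

definition tensor ::
    "('k, 'm) ring_scheme \<Rightarrow> ('k, 'v) module \<Rightarrow> ('k, 'w) module \<Rightarrow>
     ('k, ('v \<times> 'w \<Rightarrow> 'k) set) module"  (infixr \<open>\<boxtimes>\<index>\<close> 75) where
  "V \<boxtimes>\<^bsub>K\<^esub> W =
     quotient_module (free_module K (carrier V \<times> carrier W)) (tensor_kernel K V W)"

definition pure_tensor ::
    "('k, 'm) ring_scheme \<Rightarrow> ('k, 'v) module \<Rightarrow> ('k, 'w) module \<Rightarrow>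
     'v \<Rightarrow> 'w \<Rightarrow> ('v \<times> 'w \<Rightarrow> 'k) set" where
  "pure_tensor K V W v w =
     tensor_kernel K V W +>\<^bsub>free_module K (carrier V \<times> carrier W)\<^esub> free_gen K (v, w)"

text \<open>
  The linear map \<open>V \<otimes> W \<rightarrow> U\<close> induced by a bilinear map \<open>\<beta> : V \<times> W \<rightarrow> U\<close>, computed on an arbitrary
  representative of the coset \<open>X\<close>; see \<open>tensor_lift_props\<close> and \<open>tensor_linear_unique\<close>
  below.  The factors \<open>V\<close> and \<open>W\<close> are not needed as arguments.
\<close>

definition tensor_lift ::
    "('k, 'm) ring_scheme \<Rightarrow> ('k, 'u) module \<Rightarrow> ('v \<Rightarrow> 'w \<Rightarrow> 'u) \<Rightarrow>
     ('v \<times> 'w \<Rightarrow> 'k) set \<Rightarrow> 'u" where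
  "tensor_lift K U \<beta> X =
     (let \<phi> = (SOME \<phi>. \<phi> \<in> X) in
      \<Oplus>\<^bsub>U\<^esub>p\<in>{p. \<phi> p \<noteq> \<zero>\<^bsub>K\<^esub>}. \<phi> p \<odot>\<^bsub>U\<^esub> \<beta> (fst p) (snd p))"

text \<open>\<open>tensor_map K V' W' f g\<close> is \<open>f \<otimes> g : V \<otimes> W \<rightarrow> V' \<otimes> W'\<close>; only the codomains are needed.\<close>

definition tensor_map ::
    "('k, 'm) ring_scheme \<Rightarrow> ('k, 'v2) module \<Rightarrow> ('k, 'w2) module \<Rightarrow>
     ('v \<Rightarrow> 'v2) \<Rightarrow> ('w \<Rightarrow> 'w2) \<Rightarrow> ('v \<times> 'w \<Rightarrow> 'k) set \<Rightarrow> ('v2 \<times> 'w2 \<Rightarrow> 'k) set" where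
  "tensor_map K V' W' f g =
     tensor_lift K (V' \<boxtimes>\<^bsub>K\<^esub> W') (\<lambda>v w. pure_tensor K V' W' (f v) (g w))"

text \<open>The associativity isomorphisms \<open>(U \<otimes> V) \<otimes> W \<rightarrow> U \<otimes> (V \<otimes> W)\<close> and back.\<close>

definition tensor_assoc ::
    "('k, 'm) ring_scheme \<Rightarrow> ('k, 'u) module \<Rightarrow> ('k, 'v) module \<Rightarrow> ('k, 'w) module \<Rightarrow>
     (('u \<times> 'v \<Rightarrow> 'k) set \<times> 'w \<Rightarrow> 'k) set \<Rightarrow> ('u \<times> ('v \<times> 'w \<Rightarrow> 'k) set \<Rightarrow> 'k) set" where
  "tensor_assoc K U V W =
     tensor_lift K (U \<boxtimes>\<^bsub>K\<^esub> (V \<boxtimes>\<^bsub>K\<^esub> W))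
       (\<lambda>x w. tensor_lift K (U \<boxtimes>\<^bsub>K\<^esub> (V \<boxtimes>\<^bsub>K\<^esub> W))
          (\<lambda>u v. pure_tensor K U (V \<boxtimes>\<^bsub>K\<^esub> W) u (pure_tensor K V W v w)) x)"

definition tensor_unassoc ::
    "('k, 'm) ring_scheme \<Rightarrow> ('k, 'u) module \<Rightarrow> ('k, 'v) module \<Rightarrow> ('k, 'w) module \<Rightarrow>
     ('u \<times> ('v \<times> 'w \<Rightarrow> 'k) set \<Rightarrow> 'k) set \<Rightarrow> (('u \<times> 'v \<Rightarrow> 'k) set \<times> 'w \<Rightarrow> 'k) set" where
  "tensor_unassoc K U V W =
     tensor_lift K ((U \<boxtimes>\<^bsub>K\<^esub> V) \<boxtimes>\<^bsub>K\<^esub> W)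
       (\<lambda>u. tensor_lift K ((U \<boxtimes>\<^bsub>K\<^esub> V) \<boxtimes>\<^bsub>K\<^esub> W)
          (\<lambda>v w. pure_tensor K (U \<boxtimes>\<^bsub>K\<^esub> V) W (pure_tensor K U V u v) w))"

text \<open>
  For \<open>f : V \<otimes> W \<rightarrow> V' \<otimes> W'\<close>, the map \<open>tensor_middle K U V W X V' W' f\<close> is
  \<open>1 \<otimes> f \<otimes> 1 : (U \<otimes> V) \<otimes> (W \<otimes> X) \<rightarrow> (U \<otimes> V') \<otimes> (W' \<otimes> X)\<close>.
\<close>

definition tensor_middle ::
    "('k, 'm) ring_scheme \<Rightarrow>
     ('k, 'u) module \<Rightarrow> ('k, 'v) module \<Rightarrow> ('k, 'w) module \<Rightarrow> ('k, 'x) module \<Rightarrow>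
     ('k, 'v2) module \<Rightarrow> ('k, 'w2) module \<Rightarrow>
     (('v \<times> 'w \<Rightarrow> 'k) set \<Rightarrow> ('v2 \<times> 'w2 \<Rightarrow> 'k) set) \<Rightarrow>
     (('u \<times> 'v \<Rightarrow> 'k) set \<times> ('w \<times> 'x \<Rightarrow> 'k) set \<Rightarrow> 'k) set \<Rightarrow>
     (('u \<times> 'v2 \<Rightarrow> 'k) set \<times> ('w2 \<times> 'x \<Rightarrow> 'k) set \<Rightarrow> 'k) set" where
  "tensor_middle K U V W X V' W' f =
     tensor_unassoc K U V' (W' \<boxtimes>\<^bsub>K\<^esub> X) \<circ>
     tensor_map K U (V' \<boxtimes>\<^bsub>K\<^esub> (W' \<boxtimes>\<^bsub>K\<^esub> X)) id
       (tensor_assoc K V' W' X \<circ>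
        tensor_map K (V' \<boxtimes>\<^bsub>K\<^esub> W') X f id \<circ>
        tensor_unassoc K V W X) \<circ>
     tensor_assoc K U V (W \<boxtimes>\<^bsub>K\<^esub> X)"

section \<open>Algebras, separability and twisting maps\<close>

locale assoc_algebra = field K + module K A + A?: ring A
  for K (structure) and A :: "('k, 'a) module" (structure) +
  assumes smult_mult_left:
      "\<lbrakk>c \<in> carrier K; x \<in> carrier A; y \<in> carrier A\<rbrakk> \<Longrightarrow>
       (c \<odot>\<^bsub>A\<^esub> x) \<otimes>\<^bsub>A\<^esub> y = c \<odot>\<^bsub>A\<^esub> (x \<otimes>\<^bsub>A\<^esub> y)"
    and smult_mult_right:
      "\<lbrakk>c \<in> carrier K; x \<in> carrier A; y \<in> carrier A\<rbrakk> \<Longrightarrow>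
       x \<otimes>\<^bsub>A\<^esub> (c \<odot>\<^bsub>A\<^esub> y) = c \<odot>\<^bsub>A\<^esub> (x \<otimes>\<^bsub>A\<^esub> y)"

text \<open>The multiplication as the linear map \<open>\<nabla> : A \<otimes> A \<rightarrow> A\<close>.\<close>

definition mult_map ::
    "('k, 'm) ring_scheme \<Rightarrow> ('k, 'a) module \<Rightarrow> ('a \<times> 'a \<Rightarrow> 'k) set \<Rightarrow> 'a" where
  "mult_map K A = tensor_lift K A (\<lambda>x y. x \<otimes>\<^bsub>A\<^esub> y)"

text \<open>
  The last conjunct is \<open>\<Gamma> \<nabla> (1 \<otimes> \<nabla>) = (\<nabla> \<otimes> \<nabla>) (1 \<otimes> \<Gamma> \<otimes> 1)\<close> on \<open>A \<otimes> (A \<otimes> A)\<close>.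
\<close>

definition bimodule_right_inverse ::
    "('k, 'm) ring_scheme \<Rightarrow> ('k, 'a) module \<Rightarrow> ('a \<Rightarrow> ('a \<times> 'a \<Rightarrow> 'k) set) \<Rightarrow> bool" where
  "bimodule_right_inverse K A \<Gamma> \<longleftrightarrow>
     linear_map K A (A \<boxtimes>\<^bsub>K\<^esub> A) \<Gamma> \<and>
     (\<forall>x\<in>carrier A. mult_map K A (\<Gamma> x) = x) \<and>
     (\<forall>x\<in>carrier (A \<boxtimes>\<^bsub>K\<^esub> (A \<boxtimes>\<^bsub>K\<^esub> A)).
        \<Gamma> (mult_map K A (tensor_map K A A id (mult_map K A) x)) =
        (tensor_map K A A (mult_map K A) (mult_map K A) \<circ>
         tensor_unassoc K A A (A \<boxtimes>\<^bsub>K\<^esub> A) \<circ>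
         tensor_map K A (A \<boxtimes>\<^bsub>K\<^esub> (A \<boxtimes>\<^bsub>K\<^esub> A)) id
           (tensor_assoc K A A A \<circ> tensor_map K (A \<boxtimes>\<^bsub>K\<^esub> A) A \<Gamma> id)) x)"

definition separable_algebra :: "('k, 'm) ring_scheme \<Rightarrow> ('k, 'a) module \<Rightarrow> bool" where
  "separable_algebra K A \<longleftrightarrow>
     assoc_algebra K A \<and> (\<exists>\<Gamma>. bimodule_right_inverse K A \<Gamma>)"

text \<open>
  The last conjunct is
  \<open>\<tau> (\<nabla>\<^sub>B \<otimes> \<nabla>\<^sub>A) = (\<nabla>\<^sub>A \<otimes> \<nabla>\<^sub>B) (1 \<otimes> \<tau> \<otimes> 1) (\<tau> \<otimes> \<tau>) (1 \<otimes> \<tau> \<otimes> 1)\<close> on \<open>(B \<otimes> B) \<otimes> (A \<otimes> A)\<close>.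
\<close>

definition twisting_map ::
    "('k, 'm) ring_scheme \<Rightarrow> ('k, 'a) module \<Rightarrow> ('k, 'b) module \<Rightarrow>
     (('b \<times> 'a \<Rightarrow> 'k) set \<Rightarrow> ('a \<times> 'b \<Rightarrow> 'k) set) \<Rightarrow> bool" where
  "twisting_map K A B \<tau> \<longleftrightarrow>
     linear_map K (B \<boxtimes>\<^bsub>K\<^esub> A) (A \<boxtimes>\<^bsub>K\<^esub> B) \<tau> \<and>
     bij_betw \<tau> (carrier (B \<boxtimes>\<^bsub>K\<^esub> A)) (carrier (A \<boxtimes>\<^bsub>K\<^esub> B)) \<and>
     (\<forall>b\<in>carrier B. \<tau> (pure_tensor K B A b \<one>\<^bsub>A\<^esub>) = pure_tensor K A B \<one>\<^bsub>A\<^esub> b) \<and>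
     (\<forall>a\<in>carrier A. \<tau> (pure_tensor K B A \<one>\<^bsub>B\<^esub> a) = pure_tensor K A B a \<one>\<^bsub>B\<^esub>) \<and>
     (\<forall>x\<in>carrier ((B \<boxtimes>\<^bsub>K\<^esub> B) \<boxtimes>\<^bsub>K\<^esub> (A \<boxtimes>\<^bsub>K\<^esub> A)).
        \<tau> (tensor_map K B A (mult_map K B) (mult_map K A) x) =
        (tensor_map K A B (mult_map K A) (mult_map K B) \<circ>
         tensor_middle K A B A B A B \<tau> \<circ>
         tensor_map K (A \<boxtimes>\<^bsub>K\<^esub> B) (A \<boxtimes>\<^bsub>K\<^esub> B) \<tau> \<tau> \<circ>
         tensor_middle K B B A A A B \<tau>) x)"

text \<open>
  The unit map \<open>\<eta>\<close> of an algebra is determined by the image of \<open>1 \<in> K\<close>, so that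
  \<open>\<eta>\<^sub>A \<otimes> \<eta>\<^sub>B\<close> amounts to the unit \<open>1\<^sub>A \<otimes> 1\<^sub>B\<close>.
\<close>

definition twisted_tensor ::
    "('k, 'm) ring_scheme \<Rightarrow> ('k, 'a) module \<Rightarrow> ('k, 'b) module \<Rightarrow>
     (('b \<times> 'a \<Rightarrow> 'k) set \<Rightarrow> ('a \<times> 'b \<Rightarrow> 'k) set) \<Rightarrow> ('k, ('a \<times> 'b \<Rightarrow> 'k) set) module" where
  "twisted_tensor K A B \<tau> =
     (A \<boxtimes>\<^bsub>K\<^esub> B)
       \<lparr>mult := \<lambda>x y. (tensor_map K A B (mult_map K A) (mult_map K B) \<circ>
                        tensor_middle K A B A B A B \<tau>)
                       (pure_tensor K (A \<boxtimes>\<^bsub>K\<^esub> B) (A \<boxtimes>\<^bsub>K\<^esub> B) x y),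
        one := pure_tensor K A B \<one>\<^bsub>A\<^esub> \<one>\<^bsub>B\<^esub>\<rparr>"

text \<open>\<open>\<Gamma> = (1 \<otimes> \<tau>\<^sup>-\<^sup>1 \<otimes> 1) (\<Gamma>\<^sub>A \<otimes> \<Gamma>\<^sub>B)\<close>\<close>

definition twisted_splitting ::
    "('k, 'm) ring_scheme \<Rightarrow> ('k, 'a) module \<Rightarrow> ('k, 'b) module \<Rightarrow>
     (('b \<times> 'a \<Rightarrow> 'k) set \<Rightarrow> ('a \<times> 'b \<Rightarrow> 'k) set) \<Rightarrow>
     ('a \<Rightarrow> ('a \<times> 'a \<Rightarrow> 'k) set) \<Rightarrow> ('b \<Rightarrow> ('b \<times> 'b \<Rightarrow> 'k) set) \<Rightarrow>
     ('a \<times> 'b \<Rightarrow> 'k) set \<Rightarrow> (('a \<times> 'b \<Rightarrow> 'k) set \<times> ('a \<times> 'b \<Rightarrow> 'k) set \<Rightarrow> 'k) set" where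
  "twisted_splitting K A B \<tau> \<Gamma>A \<Gamma>B =
     tensor_middle K A A B B B A (inv_into (carrier (B \<boxtimes>\<^bsub>K\<^esub> A)) \<tau>) \<circ>
     tensor_map K (A \<boxtimes>\<^bsub>K\<^esub> A) (B \<boxtimes>\<^bsub>K\<^esub> B) \<Gamma>A \<Gamma>B"

section \<open>The universal property of the tensor product\<close>

lemma free_module_module:
  assumes "field K"
  shows "module K (free_module K S)"
proof -
  interpret field K by fact
  have fin: "finite {s. \<phi> s \<oplus>\<^bsub>K\<^esub> \<psi> s \<noteq> \<zero>\<^bsub>K\<^esub>}" "{s. \<phi> s \<oplus>\<^bsub>K\<^esub> \<psi> s \<noteq> \<zero>\<^bsub>K\<^esub>} \<subseteq> S"
    if "\<phi> \<in> carrier (free_module K S)" "\<psi> \<in> carrier (free_module K S)" for \<phi> \<psi>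
  proof -
    have "{s. \<phi> s \<oplus>\<^bsub>K\<^esub> \<psi> s \<noteq> \<zero>\<^bsub>K\<^esub>} \<subseteq> {s. \<phi> s \<noteq> \<zero>\<^bsub>K\<^esub>} \<union> {s. \<psi> s \<noteq> \<zero>\<^bsub>K\<^esub>}" by auto
    then show "finite {s. \<phi> s \<oplus>\<^bsub>K\<^esub> \<psi> s \<noteq> \<zero>\<^bsub>K\<^esub>}" "{s. \<phi> s \<oplus>\<^bsub>K\<^esub> \<psi> s \<noteq> \<zero>\<^bsub>K\<^esub>} \<subseteq> S"
      using that by (auto simp: free_module_def dest: finite_subset)
  qed
  have fin2: "finite {s. c \<otimes>\<^bsub>K\<^esub> \<psi> s \<noteq> \<zero>\<^bsub>K\<^esub>}" "{s. c \<otimes>\<^bsub>K\<^esub> \<psi> s \<noteq> \<zero>\<^bsub>K\<^esub>} \<subseteq> S"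
    if "\<psi> \<in> carrier (free_module K S)" "c \<in> carrier K" for c \<psi>
  proof -
    have "{s. c \<otimes>\<^bsub>K\<^esub> \<psi> s \<noteq> \<zero>\<^bsub>K\<^esub>} \<subseteq> {s. \<psi> s \<noteq> \<zero>\<^bsub>K\<^esub>}" using that by auto
    then show "finite {s. c \<otimes>\<^bsub>K\<^esub> \<psi> s \<noteq> \<zero>\<^bsub>K\<^esub>}" "{s. c \<otimes>\<^bsub>K\<^esub> \<psi> s \<noteq> \<zero>\<^bsub>K\<^esub>} \<subseteq> S"
      using that by (auto simp: free_module_def dest: finite_subset)
  qed
  have add: "\<And>x y. x \<in> carrier (free_module K S) \<Longrightarrow> y \<in> carrier (free_module K S) \<Longrightarrow>
       x \<oplus>\<^bsub>free_module K S\<^esub> y \<in> carrier (free_module K S)"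
    using fin by (simp add: free_module_def)
  have sm: "\<And>c y. c \<in> carrier K \<Longrightarrow> y \<in> carrier (free_module K S) \<Longrightarrow>
       c \<odot>\<^bsub>free_module K S\<^esub> y \<in> carrier (free_module K S)"
    using fin2 by (simp add: free_module_def)
  have neg: "\<exists>y\<in>carrier (free_module K S). y \<oplus>\<^bsub>free_module K S\<^esub> x = \<zero>\<^bsub>free_module K S\<^esub>"
    if x: "x \<in> carrier (free_module K S)" for x
  proof
    show "(\<ominus>\<^bsub>K\<^esub> \<one>\<^bsub>K\<^esub>) \<odot>\<^bsub>free_module K S\<^esub> x \<in> carrier (free_module K S)"
      using x by (intro sm) auto
    show "(\<ominus>\<^bsub>K\<^esub> \<one>\<^bsub>K\<^esub>) \<odot>\<^bsub>free_module K S\<^esub> x \<oplus>\<^bsub>free_module K S\<^esub> x = \<zero>\<^bsub>free_module K S\<^esub>"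
      using x by (auto simp: free_module_def l_minus l_neg)
  qed
  show ?thesis
  proof (rule moduleI)
    show "cring K" by (rule is_cring)
    show "abelian_group (free_module K S)"
      by (rule abelian_groupI) (use add neg in \<open>auto simp: free_module_def a_ac\<close>)
  qed (use sm in \<open>auto simp: free_module_def l_distr r_distr m_assoc\<close>)
qed

lemma free_gen_closed:
  assumes "field K" "s \<in> S"
  shows "free_gen K s \<in> carrier (free_module K S)"
proof -
  interpret field K by fact
  show ?thesis using assms(2) by (auto simp: free_module_def free_gen_def)
qed

locale module_quotient = M: module K M + sub: submodule N K M for K (structure) and M :: "('a,'c) module" (structure) and N
begin
sublocale A: abelian_subgroup N M
  by (rule abelian_subgroupI3) (auto intro: additive_subgroup.intro sub.subgroup_axioms M.abelian_group_axioms)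

lemma coset_eqI: assumes "x \<in> carrier M" "y \<in> carrier M" "x \<ominus>\<^bsub>M\<^esub> y \<in> N"
  shows "N +>\<^bsub>M\<^esub> x = N +>\<^bsub>M\<^esub> y"
proof (rule M.a_coset_add_inv1)
  show "N +>\<^bsub>M\<^esub> (x \<oplus>\<^bsub>M\<^esub> \<ominus>\<^bsub>M\<^esub> y) = N" 
    using assms M.a_coset_join2[of "x \<ominus>\<^bsub>M\<^esub> y" N] A.a_subgroup by (auto simp: a_minus_def)
qed (use assms A.a_subset in auto)

lemma coset_eqD: assumes "x \<in> carrier M" "y \<in> carrier M" "N +>\<^bsub>M\<^esub> x = N +>\<^bsub>M\<^esub> y"
  shows "x \<ominus>\<^bsub>M\<^esub> y \<in> N"
  using M.a_coset_add_inv2[OF assms(3,1,2) A.a_subset] A.a_rcos_self[of "x \<ominus>\<^bsub>M\<^esub> y"] assms(1,2)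
  by (simp add: a_minus_def)

lemma smult_neg: assumes "c \<in> carrier K" "x \<in> carrier M"
  shows "c \<odot>\<^bsub>M\<^esub> (\<ominus>\<^bsub>M\<^esub> x) = \<ominus>\<^bsub>M\<^esub> (c \<odot>\<^bsub>M\<^esub> x)"
proof -
  have "c \<odot>\<^bsub>M\<^esub> (\<ominus>\<^bsub>M\<^esub> x) \<oplus>\<^bsub>M\<^esub> c \<odot>\<^bsub>M\<^esub> x = \<zero>\<^bsub>M\<^esub>"
    using assms by (simp add: M.smult_r_distr[symmetric] M.M.l_neg)
  then show ?thesis using assms by (metis M.M.minus_equality M.M.a_inv_closed M.smult_closed)
qed

lemma smult_coset: assumes "c \<in> carrier K" "x \<in> carrier M"
  shows "c \<odot>\<^bsub>quotient_module M N\<^esub> (N +>\<^bsub>M\<^esub> x) = N +>\<^bsub>M\<^esub> (c \<odot>\<^bsub>M\<^esub> x)"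
proof -
  have "N +>\<^bsub>M\<^esub> (c \<odot>\<^bsub>M\<^esub> y) = N +>\<^bsub>M\<^esub> (c \<odot>\<^bsub>M\<^esub> x)" if "y \<in> N +>\<^bsub>M\<^esub> x" for y
  proof -
    have y: "y \<in> carrier M" using that A.a_subset M.a_r_coset_subset_G assms(2) by blast
    have "N +>\<^bsub>M\<^esub> y = N +>\<^bsub>M\<^esub> x"
      using M.a_repr_independence[OF that assms(2) A.a_subgroup] by simp
    then have "y \<ominus>\<^bsub>M\<^esub> x \<in> N" using coset_eqD y assms by blast
    then have "c \<odot>\<^bsub>M\<^esub> (y \<ominus>\<^bsub>M\<^esub> x) \<in> N" using assms by auto
    then show ?thesis
    proof (intro coset_eqI)
      assume "c \<odot>\<^bsub>M\<^esub> (y \<ominus>\<^bsub>M\<^esub> x) \<in> N"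
      moreover have "c \<odot>\<^bsub>M\<^esub> (y \<ominus>\<^bsub>M\<^esub> x) = (c \<odot>\<^bsub>M\<^esub> y) \<ominus>\<^bsub>M\<^esub> (c \<odot>\<^bsub>M\<^esub> x)"
        using y assms by (simp add: a_minus_def M.smult_r_distr smult_neg)
      ultimately show "(c \<odot>\<^bsub>M\<^esub> y) \<ominus>\<^bsub>M\<^esub> (c \<odot>\<^bsub>M\<^esub> x) \<in> N" by simp
    qed (use y assms in auto)
  qed
  moreover have "x \<in> N +>\<^bsub>M\<^esub> x" using assms A.a_rcos_self by blast
  ultimately have "(\<Union>y\<in>N +>\<^bsub>M\<^esub> x. N +>\<^bsub>M\<^esub> (c \<odot>\<^bsub>M\<^esub> y)) = N +>\<^bsub>M\<^esub> (c \<odot>\<^bsub>M\<^esub> x)"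
    by (metis (no_types, lifting) SUP_eq_const empty_iff)
  then show ?thesis by (simp add: quotient_module_def)
qed

lemma add_coset: assumes "x \<in> carrier M" "y \<in> carrier M"
  shows "(N +>\<^bsub>M\<^esub> x) \<oplus>\<^bsub>quotient_module M N\<^esub> (N +>\<^bsub>M\<^esub> y) = N +>\<^bsub>M\<^esub> (x \<oplus>\<^bsub>M\<^esub> y)"
  using A.a_rcos_sum[OF assms] by (simp add: quotient_module_def)

lemma carrier_quot: "carrier (quotient_module M N) = (\<lambda>x. N +>\<^bsub>M\<^esub> x) ` carrier M"
  by (auto simp: quotient_module_def A_RCOSETS_def' )

lemma zero_quot: "\<zero>\<^bsub>quotient_module M N\<^esub> = N +>\<^bsub>M\<^esub> \<zero>\<^bsub>M\<^esub>"
  by (simp add: quotient_module_def A.a_subset)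

lemma module_quot: "module K (quotient_module M N)"
proof (rule moduleI)
  show "cring K" by (rule M.R.is_cring)
  show "abelian_group (quotient_module M N)"
  proof (rule abelian_groupI)
    fix x assume "x \<in> carrier (quotient_module M N)"
    then obtain a where a: "a \<in> carrier M" "x = N +>\<^bsub>M\<^esub> a" by (auto simp: carrier_quot)
    then show "\<exists>y\<in>carrier (quotient_module M N). y \<oplus>\<^bsub>quotient_module M N\<^esub> x = \<zero>\<^bsub>quotient_module M N\<^esub>"
      by (intro bexI[of _ "N +>\<^bsub>M\<^esub> (\<ominus>\<^bsub>M\<^esub> a)"]) (auto simp: carrier_quot zero_quot add_coset M.M.l_neg)
  qed (auto simp: carrier_quot add_coset zero_quot M.M.a_ac simp del: M.a_coset_add_zero)
qed (auto simp: carrier_quot smult_coset add_coset M.smult_l_distr M.smult_r_distr M.smult_assoc1)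
end

lemma tensor_kernel_submodule:
  assumes "field K" "module K V" "module K W"
  shows "submodule (tensor_kernel K V W) K (free_module K (carrier V \<times> carrier W))"
proof -
  let ?F = "free_module K (carrier V \<times> carrier W)"
  interpret F: module K ?F by (rule free_module_module[OF assms(1)])
  interpret V: module K V by fact
  interpret W: module K W by fact
  have gen: "free_gen K (v,w) \<in> carrier ?F" if "v \<in> carrier V" "w \<in> carrier W" for v w
    using that by (intro free_gen_closed[OF assms(1)]) auto
  have rel: "tensor_relators K V W \<subseteq> carrier ?F"
    unfolding tensor_relators_def Let_def by (auto intro!: F.minus_closed gen F.smult_closed)
  show ?thesis unfolding tensor_kernel_def hull_def
  proof (rule F.submoduleI)
    show "\<Inter>{t. submodule t K ?F \<and> tensor_relators K V W \<subseteq> t} \<subseteq> carrier ?F"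
      using F.carrier_is_submodule rel by auto
    have z: "\<zero>\<^bsub>?F\<^esub> \<in> t" if "submodule t K ?F" for t
      using subgroup.one_closed[OF submodule.axioms(1)[OF that]] by simp
    then show "\<zero>\<^bsub>?F\<^esub> \<in> \<Inter>{t. submodule t K ?F \<and> tensor_relators K V W \<subseteq> t}" by blast
  qed (auto dest: F.submoduleE(3,4,5))
qed

lemma tensor_module:
  assumes "field K" "module K V" "module K W"
  shows "module K (V \<boxtimes>\<^bsub>K\<^esub> W)"
proof -
  interpret module_quotient K "free_module K (carrier V \<times> carrier W)" "tensor_kernel K V W"
    using tensor_kernel_submodule[OF assms] free_module_module[OF assms(1)] by (intro module_quotient.intro)
  show ?thesis unfolding tensor_def by (rule module_quot)
qed


definition free_lift where "free_lift K U \<beta> \<phi> = 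
  (\<Oplus>\<^bsub>U\<^esub>p\<in>{p. \<phi> p \<noteq> \<zero>\<^bsub>K\<^esub>}. \<phi> p \<odot>\<^bsub>U\<^esub> \<beta> (fst p) (snd p))"

locale bilinear_factor = V: module K V + W: module K W + U: module K U + K: field K
  for K :: "('k, 'm) ring_scheme" (structure) and V :: "('k, 'v) module" and W :: "('k, 'w) module" and U :: "('k, 'u) module" +
  fixes \<beta> assumes bil: "bilinear_map K V W U \<beta>"
begin
abbreviation "F \<equiv> free_module K (carrier V \<times> carrier W)"
sublocale Q: module_quotient K F "tensor_kernel K V W"
  using tensor_kernel_submodule V.module_axioms W.module_axioms K.field_axioms free_module_module
  by (intro module_quotient.intro) blast+

lemma b_closed: "v \<in> carrier V \<Longrightarrow> w \<in> carrier W \<Longrightarrow> \<beta> v w \<in> carrier U"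
  using bil by (auto simp: bilinear_map_def linear_map_def)

lemma free_module_D: assumes "\<phi> \<in> carrier F" shows "\<phi> p \<in> carrier K" "finite {s. \<phi> s \<noteq> \<zero>\<^bsub>K\<^esub>}" "{s. \<phi> s \<noteq> \<zero>\<^bsub>K\<^esub>} \<subseteq> carrier V \<times> carrier W"
  using assms by (cases p; simp add: free_module_def)+

lemma free_lift_ext: assumes "\<phi> \<in> carrier F" "finite S" "{s. \<phi> s \<noteq> \<zero>\<^bsub>K\<^esub>} \<subseteq> S" "S \<subseteq> carrier V \<times> carrier W"
  shows "free_lift K U \<beta> \<phi> = (\<Oplus>\<^bsub>U\<^esub>p\<in>S. \<phi> p \<odot>\<^bsub>U\<^esub> \<beta> (fst p) (snd p))"
  unfolding free_lift_def
proof (rule U.add.finprod_mono_neutral_cong_left)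
  show "\<And>i. i \<in> S - {p. \<phi> p \<noteq> \<zero>} \<Longrightarrow> \<phi> i \<odot>\<^bsub>U\<^esub> \<beta> (fst i) (snd i) = \<zero>\<^bsub>U\<^esub>"
    using assms(4) by (auto intro!: U.smult_l_null b_closed)
  show "(\<lambda>p. \<phi> p \<odot>\<^bsub>U\<^esub> \<beta> (fst p) (snd p)) \<in> S \<rightarrow> carrier U"
    using assms free_module_D[OF assms(1)] b_closed by (auto intro!: U.smult_closed)
qed (use assms in auto)

lemma free_lift_closed: assumes "\<phi> \<in> carrier F" shows "free_lift K U \<beta> \<phi> \<in> carrier U"
  unfolding free_lift_def using free_module_D[OF assms] b_closed 
  by (intro U.finsum_closed) (auto intro!: U.smult_closed)

lemma free_lift_add: assumes "\<phi> \<in> carrier F" "\<psi> \<in> carrier F"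
  shows "free_lift K U \<beta> (\<phi> \<oplus>\<^bsub>F\<^esub> \<psi>) = free_lift K U \<beta> \<phi> \<oplus>\<^bsub>U\<^esub> free_lift K U \<beta> \<psi>"
proof -
  let ?S = "{s. \<phi> s \<noteq> \<zero>\<^bsub>K\<^esub>} \<union> {s. \<psi> s \<noteq> \<zero>\<^bsub>K\<^esub>}"
  note [simp] = free_module_D(1)[OF assms(1)] free_module_D(1)[OF assms(2)]
  have S: "finite ?S" "?S \<subseteq> carrier V \<times> carrier W" using free_module_D[OF assms(1)] free_module_D[OF assms(2)] by auto
  have pt: "(\<phi> \<oplus>\<^bsub>F\<^esub> \<psi>) p = \<phi> p \<oplus> \<psi> p" for p by (simp add: free_module_def)
  have cl: "\<phi> \<oplus>\<^bsub>F\<^esub> \<psi> \<in> carrier F" using assms Q.M.M.a_closed by auto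
  have bc: "\<And>p. p \<in> ?S \<Longrightarrow> \<beta> (fst p) (snd p) \<in> carrier U" by (rule b_closed; drule subsetD[OF S(2)]; simp add: mem_Times_iff)
  have "free_lift K U \<beta> (\<phi> \<oplus>\<^bsub>F\<^esub> \<psi>) = (\<Oplus>\<^bsub>U\<^esub>p\<in>?S. (\<phi> \<oplus>\<^bsub>F\<^esub> \<psi>) p \<odot>\<^bsub>U\<^esub> \<beta> (fst p) (snd p))"
    by (rule free_lift_ext) (use cl S pt in auto)
  also have "\<dots> = (\<Oplus>\<^bsub>U\<^esub>p\<in>?S. \<phi> p \<odot>\<^bsub>U\<^esub> \<beta> (fst p) (snd p) \<oplus>\<^bsub>U\<^esub> \<psi> p \<odot>\<^bsub>U\<^esub> \<beta> (fst p) (snd p))"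
    by (rule U.finsum_cong') (use bc in \<open>auto simp: pt U.smult_l_distr intro!: U.smult_closed\<close>)
  also have "\<dots> = (\<Oplus>\<^bsub>U\<^esub>p\<in>?S. \<phi> p \<odot>\<^bsub>U\<^esub> \<beta> (fst p) (snd p)) \<oplus>\<^bsub>U\<^esub> (\<Oplus>\<^bsub>U\<^esub>p\<in>?S. \<psi> p \<odot>\<^bsub>U\<^esub> \<beta> (fst p) (snd p))"
    by (rule U.finsum_addf) (use bc in \<open>auto intro!: U.smult_closed\<close>)
  finally show ?thesis
    using free_lift_ext[OF assms(1) S(1) _ S(2)] free_lift_ext[OF assms(2) S(1) _ S(2)] by simp
qed

lemma free_lift_smult: assumes "\<phi> \<in> carrier F" "c \<in> carrier K"
  shows "free_lift K U \<beta> (c \<odot>\<^bsub>F\<^esub> \<phi>) = c \<odot>\<^bsub>U\<^esub> free_lift K U \<beta> \<phi>"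
proof -
  let ?S = "{s. \<phi> s \<noteq> \<zero>\<^bsub>K\<^esub>}"
  note [simp] = free_module_D(1)[OF assms(1)]
  have S: "finite ?S" "?S \<subseteq> carrier V \<times> carrier W" using free_module_D[OF assms(1)] by auto
  have pt: "(c \<odot>\<^bsub>F\<^esub> \<phi>) p = c \<otimes> \<phi> p" for p by (simp add: free_module_def)
  have cl: "c \<odot>\<^bsub>F\<^esub> \<phi> \<in> carrier F" using assms Q.M.smult_closed by auto
  have bc: "\<And>p. p \<in> ?S \<Longrightarrow> \<beta> (fst p) (snd p) \<in> carrier U" by (rule b_closed; drule subsetD[OF S(2)]; simp add: mem_Times_iff)
  have "free_lift K U \<beta> (c \<odot>\<^bsub>F\<^esub> \<phi>) = (\<Oplus>\<^bsub>U\<^esub>p\<in>?S. (c \<odot>\<^bsub>F\<^esub> \<phi>) p \<odot>\<^bsub>U\<^esub> \<beta> (fst p) (snd p))"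
    by (rule free_lift_ext) (use cl S pt assms in auto)
  also have "\<dots> = (\<Oplus>\<^bsub>U\<^esub>p\<in>?S. c \<odot>\<^bsub>U\<^esub> (\<phi> p \<odot>\<^bsub>U\<^esub> \<beta> (fst p) (snd p)))"
    by (rule U.finsum_cong') (use bc assms in \<open>auto simp: pt U.smult_assoc1 intro!: U.smult_closed\<close>)
  also have "\<dots> = c \<odot>\<^bsub>U\<^esub> (\<Oplus>\<^bsub>U\<^esub>p\<in>?S. \<phi> p \<odot>\<^bsub>U\<^esub> \<beta> (fst p) (snd p))"
    by (rule U.finsum_smult_ldistr[symmetric]) (use bc assms S in \<open>auto intro!: U.smult_closed\<close>)
  finally show ?thesis by (simp add: free_lift_def)
qed

lemma gen_closed: "v \<in> carrier V \<Longrightarrow> w \<in> carrier W \<Longrightarrow> free_gen K (v,w) \<in> carrier F"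
  by (intro free_gen_closed K.field_axioms) auto

lemma free_lift_gen: assumes "v \<in> carrier V" "w \<in> carrier W"
  shows "free_lift K U \<beta> (free_gen K (v,w)) = \<beta> v w"
proof -
  have "free_lift K U \<beta> (free_gen K (v,w)) = (\<Oplus>\<^bsub>U\<^esub>p\<in>{(v,w)}. free_gen K (v,w) p \<odot>\<^bsub>U\<^esub> \<beta> (fst p) (snd p))"
    by (rule free_lift_ext) (use assms gen_closed in \<open>auto simp: free_gen_def split: if_splits\<close>)
  also have "\<dots> = \<beta> v w" using b_closed[OF assms] by (simp add: free_gen_def)
  finally show ?thesis .
qed

lemma free_lift_neg: assumes "\<phi> \<in> carrier F" 
  shows "free_lift K U \<beta> (\<ominus>\<^bsub>F\<^esub> \<phi>) = \<ominus>\<^bsub>U\<^esub> free_lift K U \<beta> \<phi>"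
proof -
  have "\<ominus>\<^bsub>F\<^esub> \<phi> = (\<ominus> \<one>) \<odot>\<^bsub>F\<^esub> \<phi>" using assms by (simp add: Q.M.smult_l_minus)
  then show ?thesis using assms free_lift_smult free_lift_closed by (simp add: U.smult_l_minus)
qed

lemma free_lift_minus: assumes "\<phi> \<in> carrier F" "\<psi> \<in> carrier F"
  shows "free_lift K U \<beta> (\<phi> \<ominus>\<^bsub>F\<^esub> \<psi>) = free_lift K U \<beta> \<phi> \<ominus>\<^bsub>U\<^esub> free_lift K U \<beta> \<psi>"
  using assms by (simp add: a_minus_def free_lift_add free_lift_neg)

lemma free_lift_rel: assumes "x \<in> tensor_relators K V W" shows "x \<in> carrier F \<and> free_lift K U \<beta> x = \<zero>\<^bsub>U\<^esub>"
proof -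
  have zero: "free_lift K U \<beta> (\<phi> \<ominus>\<^bsub>F\<^esub> \<psi>) = \<zero>\<^bsub>U\<^esub>"
    if "\<phi> \<in> carrier F" "\<psi> \<in> carrier F" "free_lift K U \<beta> \<phi> = free_lift K U \<beta> \<psi>" for \<phi> \<psi>
    using that free_lift_closed[OF that(2)] by (simp add: a_minus_def free_lift_add free_lift_neg U.M.r_neg)
  show ?thesis
    using assms bil unfolding tensor_relators_def Let_def bilinear_map_def linear_map_def
    by (auto intro!: zero Q.M.M.minus_closed
        simp: free_lift_add free_lift_smult free_lift_gen gen_closed)
qed

lemma free_lift_kernel: assumes "x \<in> tensor_kernel K V W" shows "x \<in> carrier F \<and> free_lift K U \<beta> x = \<zero>\<^bsub>U\<^esub>"
proof -
  have "submodule {x\<in>carrier F. free_lift K U \<beta> x = \<zero>\<^bsub>U\<^esub>} K F"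
  proof (rule Q.M.submoduleI)
    have "free_lift K U \<beta> \<zero>\<^bsub>F\<^esub> = \<zero>\<^bsub>U\<^esub>" by (simp add: free_lift_def free_module_def)
    then show "\<zero>\<^bsub>F\<^esub> \<in> {x\<in>carrier F. free_lift K U \<beta> x = \<zero>\<^bsub>U\<^esub>}" by simp
  qed (auto simp: free_lift_add free_lift_neg free_lift_smult)
  moreover have "tensor_relators K V W \<subseteq> {x\<in>carrier F. free_lift K U \<beta> x = \<zero>\<^bsub>U\<^esub>}"
    using free_lift_rel by blast
  ultimately have "tensor_kernel K V W \<subseteq> {x\<in>carrier F. free_lift K U \<beta> x = \<zero>\<^bsub>U\<^esub>}"
    unfolding tensor_kernel_def by (intro hull_minimal)
  then show ?thesis using assms by blast
qed

lemma tensor_lift_coset: assumes "\<phi> \<in> carrier F"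
  shows "tensor_lift K U \<beta> (tensor_kernel K V W +>\<^bsub>F\<^esub> \<phi>) = free_lift K U \<beta> \<phi>"
proof -
  let ?X = "tensor_kernel K V W +>\<^bsub>F\<^esub> \<phi>"
  define \<psi> where "\<psi> = (SOME \<psi>. \<psi> \<in> ?X)"
  have "\<psi> \<in> ?X" unfolding \<psi>_def by (rule someI[of _ \<phi>]) (rule Q.A.a_rcos_self[OF assms])
  then obtain n where n: "n \<in> tensor_kernel K V W" "\<psi> = n \<oplus>\<^bsub>F\<^esub> \<phi>" by (auto simp: a_r_coset_def')
  have "tensor_lift K U \<beta> ?X = free_lift K U \<beta> \<psi>"
    by (simp add: tensor_lift_def free_lift_def \<psi>_def Let_def)
  also have "\<dots> = free_lift K U \<beta> \<phi>" using n free_lift_kernel[OF n(1)] assms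
    by (simp add: free_lift_add free_lift_closed)
  finally show ?thesis .
qed

lemma carrier_tensor: "carrier (V \<boxtimes>\<^bsub>K\<^esub> W) = (\<lambda>x. tensor_kernel K V W +>\<^bsub>F\<^esub> x) ` carrier F"
  unfolding tensor_def by (rule Q.carrier_quot)

lemma tensor_lift_linear: "linear_map K (V \<boxtimes>\<^bsub>K\<^esub> W) U (tensor_lift K U \<beta>)"
  unfolding linear_map_def 
  by (auto simp: carrier_tensor tensor_lift_coset free_lift_closed)
     (simp_all add: tensor_def Q.add_coset Q.smult_coset tensor_lift_coset free_lift_add free_lift_smult)

lemma tensor_lift_pure: "v \<in> carrier V \<Longrightarrow> w \<in> carrier W \<Longrightarrow> tensor_lift K U \<beta> (pure_tensor K V W v w) = \<beta> v w"
  by (simp add: pure_tensor_def tensor_lift_coset gen_closed free_lift_gen)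
end

lemma pure_tensor_bilinear: assumes "field K" "module K V" "module K W"
  shows "bilinear_map K V W (V \<boxtimes>\<^bsub>K\<^esub> W) (pure_tensor K V W)"
proof -
  interpret V: module K V by fact
  interpret W: module K W by fact
  interpret Q: module_quotient K "free_module K (carrier V \<times> carrier W)" "tensor_kernel K V W"
    using tensor_kernel_submodule[OF assms] free_module_module[OF assms(1)] by (intro module_quotient.intro)
  have gen: "free_gen K (v,w) \<in> carrier (free_module K (carrier V \<times> carrier W))" if "v \<in> carrier V" "w \<in> carrier W" for v w
    using that by (intro free_gen_closed[OF assms(1)]) auto
  have *: "tensor_relators K V W \<subseteq> tensor_kernel K V W" unfolding tensor_kernel_def by (rule hull_subset)
  let ?F = "free_module K (carrier V \<times> carrier W)"
  have cl: "pure_tensor K V W v w \<in> carrier (V \<boxtimes>\<^bsub>K\<^esub> W)" if "v \<in> carrier V" "w \<in> carrier W" for v w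
    unfolding pure_tensor_def tensor_def Q.carrier_quot using gen[OF that] by blast
  have r1: "pure_tensor K V W (v \<oplus>\<^bsub>V\<^esub> v') w = pure_tensor K V W v w \<oplus>\<^bsub>V \<boxtimes>\<^bsub>K\<^esub> W\<^esub> pure_tensor K V W v' w"
    if m: "v \<in> carrier V" "v' \<in> carrier V" "w \<in> carrier W" for v v' w
    unfolding pure_tensor_def tensor_def using m
    apply (subst Q.add_coset, (intro gen; simp)+)
    apply (rule Q.coset_eqI)
    apply (intro gen; simp)
    apply (intro Q.M.M.a_closed gen; simp)
    apply (rule subsetD[OF *])
    unfolding tensor_relators_def Let_def by blast
  have r2: "pure_tensor K V W v (w \<oplus>\<^bsub>W\<^esub> w') = pure_tensor K V W v w \<oplus>\<^bsub>V \<boxtimes>\<^bsub>K\<^esub> W\<^esub> pure_tensor K V W v w'"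
    if m: "v \<in> carrier V" "w' \<in> carrier W" "w \<in> carrier W" for v w' w
    unfolding pure_tensor_def tensor_def using m
    apply (subst Q.add_coset, (intro gen; simp)+)
    apply (rule Q.coset_eqI)
    apply (intro gen; simp)
    apply (intro Q.M.M.a_closed gen; simp)
    apply (rule subsetD[OF *])
    unfolding tensor_relators_def Let_def by blast
  have r3: "pure_tensor K V W (c \<odot>\<^bsub>V\<^esub> v) w = c \<odot>\<^bsub>V \<boxtimes>\<^bsub>K\<^esub> W\<^esub> pure_tensor K V W v w"
    if m: "v \<in> carrier V" "c \<in> carrier K" "w \<in> carrier W" for v c w
    unfolding pure_tensor_def tensor_def using m
    apply (subst Q.smult_coset, simp, (intro gen; simp))
    apply (rule Q.coset_eqI)
    apply (intro gen; simp)
    apply (intro Q.M.smult_closed gen; simp)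
    apply (rule subsetD[OF *])
    unfolding tensor_relators_def Let_def by blast
  have r4: "pure_tensor K V W v (c \<odot>\<^bsub>W\<^esub> w) = c \<odot>\<^bsub>V \<boxtimes>\<^bsub>K\<^esub> W\<^esub> pure_tensor K V W v w"
    if m: "v \<in> carrier V" "c \<in> carrier K" "w \<in> carrier W" for v c w
    unfolding pure_tensor_def tensor_def using m
    apply (subst Q.smult_coset, simp, (intro gen; simp))
    apply (rule Q.coset_eqI)
    apply (intro gen; simp)
    apply (intro Q.M.smult_closed gen; simp)
    apply (rule subsetD[OF *])
    unfolding tensor_relators_def Let_def by blast
  show ?thesis unfolding bilinear_map_def linear_map_def
    using cl r1 r2 r3 r4 by auto
qed

lemma linear_map_id: "linear_map K V V id" by (auto simp: linear_map_def)

lemma tensor_map_pure: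
  assumes "field K" "module K V" "module K W" "module K V'" "module K W'" "linear_map K V V' f" "linear_map K W W' g"
  shows "linear_map K (V \<boxtimes>\<^bsub>K\<^esub> W) (V' \<boxtimes>\<^bsub>K\<^esub> W') (tensor_map K V' W' f g)"
    "v \<in> carrier V \<Longrightarrow> w \<in> carrier W \<Longrightarrow> tensor_map K V' W' f g (pure_tensor K V W v w) = pure_tensor K V' W' (f v) (g w)"
proof -
  have "bilinear_map K V W (V' \<boxtimes>\<^bsub>K\<^esub> W') (\<lambda>v w. pure_tensor K V' W' (f v) (g w))"
    using pure_tensor_bilinear[OF assms(1,4,5)] assms(6,7)
    by (auto simp: bilinear_map_def linear_map_def Pi_iff)
  then interpret bilinear_factor K V W "V' \<boxtimes>\<^bsub>K\<^esub> W'" "\<lambda>v w. pure_tensor K V' W' (f v) (g w)"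
    using assms tensor_module by (intro bilinear_factor.intro bilinear_factor_axioms.intro) auto
  show "linear_map K (V \<boxtimes>\<^bsub>K\<^esub> W) (V' \<boxtimes>\<^bsub>K\<^esub> W') (tensor_map K V' W' f g)"
    using tensor_lift_linear by (simp add: tensor_map_def)
  show "v \<in> carrier V \<Longrightarrow> w \<in> carrier W \<Longrightarrow> tensor_map K V' W' f g (pure_tensor K V W v w) = pure_tensor K V' W' (f v) (g w)"
    using tensor_lift_pure by (simp add: tensor_map_def)
qed


lemma free_module_generated:
  assumes K: "field K" and N: "submodule N K (free_module K S)"
    and gens: "\<And>s. s \<in> S \<Longrightarrow> free_gen K s \<in> N" and \<phi>: "\<phi> \<in> carrier (free_module K S)"
  shows "\<phi> \<in> N"
proof -
  interpret K: field K by fact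
  interpret F: module K "free_module K S" by (rule free_module_module[OF K])
  note N = F.submoduleE[OF N]
  have "finite {s. \<phi> s \<noteq> \<zero>\<^bsub>K\<^esub>}" using \<phi> by (simp add: free_module_def)
  then show ?thesis using \<phi>
  proof (induction "{s. \<phi> s \<noteq> \<zero>\<^bsub>K\<^esub>}" arbitrary: \<phi> rule: finite_induct)
    case empty
    then have "\<phi> = \<zero>\<^bsub>free_module K S\<^esub>" by (auto simp: free_module_def)
    moreover obtain n where "n \<in> N" using N(2) by blast
    ultimately show ?case using N(1) N(5)[OF N(3), of n n] by (auto simp: F.M.l_neg)
  next
    case (insert p P)
    define \<psi> where "\<psi> = \<phi>(p := \<zero>\<^bsub>K\<^esub>)"
    have [simp]: "\<phi> s \<in> carrier K" for s using insert.prems by (simp add: free_module_def)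
    have supp: "{s. \<psi> s \<noteq> \<zero>\<^bsub>K\<^esub>} = P" using insert.hyps(2,4) by (auto simp: \<psi>_def)
    have "P \<subseteq> S" "p \<in> S" using insert.prems insert.hyps(4) by (auto simp: free_module_def)
    then have "\<psi> \<in> carrier (free_module K S)" using supp insert.hyps(1)
      by (simp add: free_module_def) (simp add: \<psi>_def)
    then have "\<psi> \<in> N" using insert.hyps(3) supp by simp
    moreover have "\<phi> p \<odot>\<^bsub>free_module K S\<^esub> free_gen K p \<in> N" using \<open>p \<in> S\<close> gens N(4) by simp
    moreover have "\<phi> = \<psi> \<oplus>\<^bsub>free_module K S\<^esub> (\<phi> p \<odot>\<^bsub>free_module K S\<^esub> free_gen K p)"
      by (auto simp: free_module_def \<psi>_def free_gen_def)
    ultimately show ?case using N(5) by metis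
  qed
qed

lemma linear_map_zero:
  assumes "module K V" "module K W" "linear_map K V W f"
  shows "f \<zero>\<^bsub>V\<^esub> = \<zero>\<^bsub>W\<^esub>"
proof -
  interpret V: module K V by fact
  interpret W: module K W by fact
  have z: "f \<zero>\<^bsub>V\<^esub> \<in> carrier W" using assms(3) by (auto simp: linear_map_def)
  have "f (\<zero>\<^bsub>K\<^esub> \<odot>\<^bsub>V\<^esub> \<zero>\<^bsub>V\<^esub>) = \<zero>\<^bsub>K\<^esub> \<odot>\<^bsub>W\<^esub> f \<zero>\<^bsub>V\<^esub>"
    using assms(3) V.R.zero_closed V.M.zero_closed unfolding linear_map_def by blast
  then show ?thesis using z by simp
qed

lemma tensor_linear_unique:
  assumes K: "field K" and V: "module K V" and W: "module K W" and U: "module K U"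
    and f: "linear_map K (V \<boxtimes>\<^bsub>K\<^esub> W) U f" and g: "linear_map K (V \<boxtimes>\<^bsub>K\<^esub> W) U g"
    and eq: "\<And>v w. v \<in> carrier V \<Longrightarrow> w \<in> carrier W \<Longrightarrow>
               f (pure_tensor K V W v w) = g (pure_tensor K V W v w)"
    and x: "x \<in> carrier (V \<boxtimes>\<^bsub>K\<^esub> W)"
  shows "f x = g x"
proof -
  let ?F = "free_module K (carrier V \<times> carrier W)" and ?N = "tensor_kernel K V W"
  interpret U: module K U by fact
  interpret T: module K "V \<boxtimes>\<^bsub>K\<^esub> W" by (rule tensor_module[OF K V W])
  interpret Q: module_quotient K ?F ?N
    using tensor_kernel_submodule[OF K V W] free_module_module[OF K] by (intro module_quotient.intro)
  let ?c = "\<lambda>\<phi>. ?N +>\<^bsub>?F\<^esub> \<phi>"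
  have c: "?c \<phi> \<in> carrier (V \<boxtimes>\<^bsub>K\<^esub> W)" if "\<phi> \<in> carrier ?F" for \<phi>
    using that by (auto simp: tensor_def Q.carrier_quot)
  have add: "?c (\<phi> \<oplus>\<^bsub>?F\<^esub> \<psi>) = ?c \<phi> \<oplus>\<^bsub>V \<boxtimes>\<^bsub>K\<^esub> W\<^esub> ?c \<psi>"
    if "\<phi> \<in> carrier ?F" "\<psi> \<in> carrier ?F" for \<phi> \<psi>
    using that by (simp add: tensor_def Q.add_coset)
  have smult: "?c (a \<odot>\<^bsub>?F\<^esub> \<phi>) = a \<odot>\<^bsub>V \<boxtimes>\<^bsub>K\<^esub> W\<^esub> ?c \<phi>"
    if "\<phi> \<in> carrier ?F" "a \<in> carrier K" for \<phi> a
    using that by (simp add: tensor_def Q.smult_coset)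
  let ?E = "{\<phi> \<in> carrier ?F. f (?c \<phi>) = g (?c \<phi>)}"
  have sm: "a \<odot>\<^bsub>?F\<^esub> \<phi> \<in> ?E" if "a \<in> carrier K" "\<phi> \<in> ?E" for a \<phi>
    using that f g c by (auto simp: smult linear_map_def)
  have "submodule ?E K ?F"
  proof (rule Q.M.submoduleI)
    have "?c \<zero>\<^bsub>?F\<^esub> = \<zero>\<^bsub>V \<boxtimes>\<^bsub>K\<^esub> W\<^esub>" unfolding tensor_def Q.zero_quot ..
    then show "\<zero>\<^bsub>?F\<^esub> \<in> ?E"
      using linear_map_zero[OF T.module_axioms U f] linear_map_zero[OF T.module_axioms U g] by simp
  next
    fix \<phi> assume \<phi>: "\<phi> \<in> ?E"
    have "\<ominus>\<^bsub>?F\<^esub> \<phi> = (\<ominus>\<^bsub>K\<^esub> \<one>\<^bsub>K\<^esub>) \<odot>\<^bsub>?F\<^esub> \<phi>" using \<phi> by (simp add: Q.M.smult_l_minus)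
    then show "\<ominus>\<^bsub>?F\<^esub> \<phi> \<in> ?E" using sm[OF _ \<phi>] by simp
  next
    fix \<phi> \<psi> assume "\<phi> \<in> ?E" "\<psi> \<in> ?E"
    then show "\<phi> \<oplus>\<^bsub>?F\<^esub> \<psi> \<in> ?E" using f g c by (auto simp: add linear_map_def)
  qed (use sm in auto)
  moreover have "free_gen K p \<in> ?E" if "p \<in> carrier V \<times> carrier W" for p
    using that eq free_gen_closed[OF K that] by (cases p) (auto simp: pure_tensor_def)
  moreover obtain \<phi> where "\<phi> \<in> carrier ?F" "x = ?c \<phi>"
    using x by (auto simp: tensor_def Q.carrier_quot)
  ultimately show ?thesis using free_module_generated[OF K, of ?E] by blast
qed

lemma tensor_lift_props:
  assumes "field K" "module K V" "module K W" "module K U" "bilinear_map K V W U \<beta>"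
  shows "linear_map K (V \<boxtimes>\<^bsub>K\<^esub> W) U (tensor_lift K U \<beta>)"
    and "v \<in> carrier V \<Longrightarrow> w \<in> carrier W \<Longrightarrow> tensor_lift K U \<beta> (pure_tensor K V W v w) = \<beta> v w"
proof -
  interpret bilinear_factor K V W U \<beta> using assms by (intro bilinear_factor.intro bilinear_factor_axioms.intro)
  show "linear_map K (V \<boxtimes>\<^bsub>K\<^esub> W) U (tensor_lift K U \<beta>)" by (rule tensor_lift_linear)
  show "v \<in> carrier V \<Longrightarrow> w \<in> carrier W \<Longrightarrow> tensor_lift K U \<beta> (pure_tensor K V W v w) = \<beta> v w"
    by (rule tensor_lift_pure)
qed


lemma linear_map_comp: "linear_map K V W f \<Longrightarrow> linear_map K W X g \<Longrightarrow> linear_map K V X (\<lambda>x. g (f x))"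
  by (auto simp: linear_map_def Pi_iff)

lemma bilinear_map_closed: "bilinear_map K V W U \<beta> \<Longrightarrow> v \<in> carrier V \<Longrightarrow> w \<in> carrier W \<Longrightarrow> \<beta> v w \<in> carrier U"
  by (auto simp: bilinear_map_def linear_map_def)

lemma tensor_assoc_props:
  assumes K: "field K" and m: "module K U" "module K V" "module K W"
  shows "linear_map K ((U \<boxtimes>\<^bsub>K\<^esub> V) \<boxtimes>\<^bsub>K\<^esub> W) (U \<boxtimes>\<^bsub>K\<^esub> (V \<boxtimes>\<^bsub>K\<^esub> W)) (tensor_assoc K U V W)"
    and "u \<in> carrier U \<Longrightarrow> v \<in> carrier V \<Longrightarrow> w \<in> carrier W \<Longrightarrow>
      tensor_assoc K U V W (pure_tensor K (U \<boxtimes>\<^bsub>K\<^esub> V) W (pure_tensor K U V u v) w) =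
      pure_tensor K U (V \<boxtimes>\<^bsub>K\<^esub> W) u (pure_tensor K V W v w)"
proof -
  let ?T = "U \<boxtimes>\<^bsub>K\<^esub> (V \<boxtimes>\<^bsub>K\<^esub> W)"
  let ?t = "\<lambda>u v w. pure_tensor K U (V \<boxtimes>\<^bsub>K\<^esub> W) u (pure_tensor K V W v w)"
  note UV = tensor_module[OF K m(1,2)] and VW = tensor_module[OF K m(2,3)]
  note T = tensor_module[OF K m(1) VW]
  interpret T: module K ?T by (rule T)
  note p1 = pure_tensor_bilinear[OF K m(2,3)] and p2 = pure_tensor_bilinear[OF K m(1) VW] and p3 = pure_tensor_bilinear[OF K m(1,2)]
  have b: "bilinear_map K U V ?T (\<lambda>u v. ?t u v w)" if "w \<in> carrier W" for w
    unfolding bilinear_map_def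
  proof (intro conjI ballI)
    fix u assume u: "u \<in> carrier U"
    show "linear_map K V ?T (\<lambda>v. ?t u v w)"
      by (rule linear_map_comp[of K V "V \<boxtimes>\<^bsub>K\<^esub> W" "\<lambda>v. pure_tensor K V W v w"])
        (use p1 p2 that u in \<open>auto simp: bilinear_map_def\<close>)
  next
    fix v assume v: "v \<in> carrier V"
    have "pure_tensor K V W v w \<in> carrier (V \<boxtimes>\<^bsub>K\<^esub> W)" by (rule bilinear_map_closed[OF p1 v that])
    then show "linear_map K U ?T (\<lambda>u. ?t u v w)" using p2 by (auto simp: bilinear_map_def)
  qed
  have tl: "linear_map K W ?T (\<lambda>w. ?t u v w)" if "u \<in> carrier U" "v \<in> carrier V" for u v
    by (rule linear_map_comp[of K W "V \<boxtimes>\<^bsub>K\<^esub> W" "\<lambda>w. pure_tensor K V W v w"])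
        (use p1 p2 that in \<open>auto simp: bilinear_map_def\<close>)
  note L = tensor_lift_props[OF K m(1,2) T b]
  have b2: "bilinear_map K (U \<boxtimes>\<^bsub>K\<^esub> V) W ?T (\<lambda>x w. tensor_lift K ?T (\<lambda>u v. ?t u v w) x)"
    unfolding bilinear_map_def
  proof (intro conjI ballI L)
    fix x assume x: "x \<in> carrier (U \<boxtimes>\<^bsub>K\<^esub> V)"
    have lin_add: "linear_map K (U \<boxtimes>\<^bsub>K\<^esub> V) ?T (\<lambda>x. f x \<oplus>\<^bsub>?T\<^esub> g x)"
      if "linear_map K (U \<boxtimes>\<^bsub>K\<^esub> V) ?T f" "linear_map K (U \<boxtimes>\<^bsub>K\<^esub> V) ?T g" for f g
      using that unfolding linear_map_def Pi_iff by (auto simp: T.smult_r_distr T.M.a_ac)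
    have lin_sm: "linear_map K (U \<boxtimes>\<^bsub>K\<^esub> V) ?T (\<lambda>x. c \<odot>\<^bsub>?T\<^esub> f x)"
      if "linear_map K (U \<boxtimes>\<^bsub>K\<^esub> V) ?T f" "c \<in> carrier K" for f c
      using that unfolding linear_map_def Pi_iff by (auto simp: T.smult_r_distr T.smult_assoc1[symmetric] T.R.m_comm)
    interpret W: module K W by (rule m(3))
    have a: "tensor_lift K ?T (\<lambda>u v. ?t u v (w \<oplus>\<^bsub>W\<^esub> w')) x = tensor_lift K ?T (\<lambda>u v. ?t u v w) x \<oplus>\<^bsub>?T\<^esub> tensor_lift K ?T (\<lambda>u v. ?t u v w') x"
      if "w \<in> carrier W" "w' \<in> carrier W" for w w'
      by (rule tensor_linear_unique[OF K m(1,2) T L(1) lin_add[OF L(1) L(1)] _ x])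
         (use that tl in \<open>auto simp: L(2) linear_map_def\<close>)
    have s: "tensor_lift K ?T (\<lambda>u v. ?t u v (c \<odot>\<^bsub>W\<^esub> w)) x = c \<odot>\<^bsub>?T\<^esub> tensor_lift K ?T (\<lambda>u v. ?t u v w) x"
      if "w \<in> carrier W" "c \<in> carrier K" for w c
      by (rule tensor_linear_unique[OF K m(1,2) T L(1) lin_sm[OF L(1)] _ x])
         (use that tl in \<open>auto simp: L(2) linear_map_def\<close>)
    show "linear_map K W ?T (\<lambda>w. tensor_lift K ?T (\<lambda>u v. ?t u v w) x)"
      unfolding linear_map_def using a s L(1) x by (auto simp: linear_map_def Pi_iff)
  qed
  note R = tensor_lift_props[OF K UV m(3) T b2]
  show "linear_map K ((U \<boxtimes>\<^bsub>K\<^esub> V) \<boxtimes>\<^bsub>K\<^esub> W) (U \<boxtimes>\<^bsub>K\<^esub> (V \<boxtimes>\<^bsub>K\<^esub> W)) (tensor_assoc K U V W)"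
    using R(1) by (simp add: tensor_assoc_def)
  assume "u \<in> carrier U" "v \<in> carrier V" "w \<in> carrier W"
  then show "tensor_assoc K U V W (pure_tensor K (U \<boxtimes>\<^bsub>K\<^esub> V) W (pure_tensor K U V u v) w) = ?t u v w"
    using R(2)[of "pure_tensor K U V u v" w] L(2) bilinear_map_closed[OF p3]
    by (simp add: tensor_assoc_def)
qed

end

theory Submission
  imports Defs
begin

text \<open>
  Put \<open>R = A \<otimes>\<^sub>\<tau> B\<close>, let \<open>\<alpha> : A \<rightarrow> R\<close> and \<open>\<beta> : B \<rightarrow> R\<close> be the inclusions, and let \<open>e = \<Gamma>\<^sub>A 1\<close> and
  \<open>f = \<Gamma>\<^sub>B 1\<close> be the separability idempotents.  Since \<open>\<tau>\<close> is bijective, \<open>a \<otimes> b \<mapsto> \<alpha> a \<beta> b\<close> and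
  \<open>b \<otimes> a \<mapsto> \<beta> b \<alpha> a\<close> are linear isomorphisms onto \<open>R\<close>, so that \<open>R \<otimes>\<^sub>B R \<cong> A \<otimes> R\<close> and
  \<open>R \<otimes>\<^sub>A R \<cong> R \<otimes> B\<close>, and \<open>R \<otimes>\<^sub>B R \<otimes>\<^sub>A R \<cong> R \<otimes> R\<close> as \<open>R\<close>-bimodules.  Under these identifications the
  first identity says that \<open>e\<close>, viewed in \<open>R \<otimes>\<^sub>B R\<close>, commutes with \<open>B\<close>; the second says that \<open>f\<close>,
  viewed in \<open>R \<otimes>\<^sub>A R\<close>, commutes with \<open>A\<close>; and \<open>\<Gamma>\<^sub>R 1\<close> is \<open>z = \<Sum> e' \<otimes> e'' f' \<otimes> f''\<close>.  The map \<open>\<Gamma>\<^sub>R\<close>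
  is a bimodule map iff \<open>z\<close> commutes with \<open>A\<close> and \<open>B\<close>.  If both identities hold, elements of \<open>A\<close>
  and \<open>B\<close> can be moved through \<open>z\<close>.  Conversely, multiplying the last two (first two) tensor
  factors of \<open>z\<close> gives back \<open>e\<close> (\<open>f\<close>), because \<open>\<Sum> f' f'' = 1\<close> (\<open>\<Sum> e' e'' = 1\<close>).
\<close>

section \<open>Sweedler sums\<close>

text \<open>
  \<open>sweedler K V W U \<beta> t\<close> is \<open>\<Sum> \<beta> t' t''\<close> in Sweedler notation \<open>t = \<Sum> t' \<otimes> t''\<close>.  Unlike for \<open>tensor_lift\<close>,
  the factors are arguments, so that rewrite rules can match them, and the guard makes the
  congruence rule below unconditional.
\<close>

definition sweedler ::
    "('k, 'm) ring_scheme \<Rightarrow> ('k, 'v) module \<Rightarrow> ('k, 'w) module \<Rightarrow> ('k, 'u) module \<Rightarrow>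
     ('v \<Rightarrow> 'w \<Rightarrow> 'u) \<Rightarrow> ('v \<times> 'w \<Rightarrow> 'k) set \<Rightarrow> 'u" where
  "sweedler K V W U \<beta> =
     tensor_lift K U (\<lambda>v w. if v \<in> carrier V \<and> w \<in> carrier W then \<beta> v w else \<zero>\<^bsub>U\<^esub>)"

lemma sweedler_cong [cong]:
  assumes "\<And>v w. v \<in> carrier V \<Longrightarrow> w \<in> carrier W \<Longrightarrow> \<beta> v w = \<beta>' v w" and "t = t'" "U = U'"
  shows "sweedler K V W U \<beta> t = sweedler K V W U' \<beta>' t'"
proof -
  have "(\<lambda>v w. if v \<in> carrier V \<and> w \<in> carrier W then \<beta> v w else \<zero>\<^bsub>U\<^esub>) =
      (\<lambda>v w. if v \<in> carrier V \<and> w \<in> carrier W then \<beta>' v w else \<zero>\<^bsub>U\<^esub>)"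
    using assms(1) by (intro ext) simp
  then show ?thesis using assms(2,3) by (simp only: sweedler_def)
qed

text \<open>These rules pull Sweedler sums outward and break linearity goals down to their innermost
  maps, so that multilinear expressions can be compared by rewriting.\<close>

named_theorems tensor_simps

locale base_field = K?: field K for K :: "('k, 'm) ring_scheme" (structure)
begin

lemmas K_field = K.field_axioms

lemma tensor_product_module [tensor_simps]: "module K V \<Longrightarrow> module K W \<Longrightarrow> module K (V \<boxtimes> W)"
  by (rule tensor_module[OF K_field])

text \<open>Linearity only tests carrier elements, and the module hypothesis keeps their sums and
  multiples in the carrier. The rule serves to replace a map by a Sweedler form that is valid on the
  carrier only.\<close>

lemma linear_cong:
  assumes "\<And>x. x \<in> carrier V \<Longrightarrow> f x = g x" "module K V"
  shows "linear_map K V W f = linear_map K V W g"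
proof -
  interpret V: module K V by fact
  show ?thesis using assms(1) unfolding linear_map_def Pi_iff by auto
qed

lemma bilinear_map_I:
  "(\<And>v. v \<in> carrier V \<Longrightarrow> linear_map K W U (\<lambda>w. \<beta> v w)) \<Longrightarrow>
   (\<And>w. w \<in> carrier W \<Longrightarrow> linear_map K V U (\<lambda>v. \<beta> v w)) \<Longrightarrow> bilinear_map K V W U \<beta>"
  by (simp add: bilinear_map_def)

lemma bilinear_iff [tensor_simps]:
  "bilinear_map K V W U \<beta> \<longleftrightarrow>
    (\<forall>v\<in>carrier V. linear_map K W U (\<lambda>w. \<beta> v w)) \<and> (\<forall>w\<in>carrier W. linear_map K V U (\<lambda>v. \<beta> v w))"
  by (rule bilinear_map_def)

lemma linear_closed: "linear_map K V W f \<Longrightarrow> x \<in> carrier V \<Longrightarrow> f x \<in> carrier W"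
  by (auto simp: linear_map_def)

text \<open>Since \<open>V\<close> and \<open>W\<close> are modules, the linearity conditions never
  leave the carriers, so the default value outside them is never met.\<close>

lemma bilinear_guard:
  assumes "module K V" "module K W" "bilinear_map K V W U \<beta>"
  shows "bilinear_map K V W U (\<lambda>v w. if v \<in> carrier V \<and> w \<in> carrier W then \<beta> v w else \<zero>\<^bsub>U\<^esub>)"
proof -
  interpret V: module K V by fact
  interpret W: module K W by fact
  show ?thesis using assms(3) unfolding bilinear_map_def linear_map_def Pi_iff by auto
qed

context
  fixes V :: "('k, 'v) module" and W :: "('k, 'w) module" and U :: "('k, 'u) module"
  assumes m: "module K V" "module K W" "module K U"
begin

lemma sweedler_linear:
  "bilinear_map K V W U \<beta> \<Longrightarrow> linear_map K (V \<boxtimes> W) U (sweedler K V W U \<beta>)"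
  unfolding sweedler_def by (rule tensor_lift_props[OF K_field m bilinear_guard[OF m(1,2)]])

lemma sweedler_pure:
  "bilinear_map K V W U \<beta> \<Longrightarrow> v \<in> carrier V \<Longrightarrow> w \<in> carrier W \<Longrightarrow>
    sweedler K V W U \<beta> (pure_tensor K V W v w) = \<beta> v w"
  unfolding sweedler_def by (subst tensor_lift_props(2)[OF K_field m bilinear_guard[OF m(1,2)]]) auto

lemma sweedler_closed:
  "bilinear_map K V W U \<beta> \<Longrightarrow> t \<in> carrier (V \<boxtimes> W) \<Longrightarrow> sweedler K V W U \<beta> t \<in> carrier U"
  by (rule linear_closed[OF sweedler_linear])

lemma tensor_eqI:
  assumes "linear_map K (V \<boxtimes> W) U f" "linear_map K (V \<boxtimes> W) U g" "t \<in> carrier (V \<boxtimes> W)"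
    "\<And>v w. v \<in> carrier V \<Longrightarrow> w \<in> carrier W \<Longrightarrow> f (pure_tensor K V W v w) = g (pure_tensor K V W v w)"
  shows "f t = g t"
  by (rule tensor_linear_unique[OF K_field m assms(1,2,4,3)])

lemma lift_sweedler:
  assumes "bilinear_map K V W U \<beta>" "t \<in> carrier (V \<boxtimes> W)"
  shows "tensor_lift K U \<beta> t = sweedler K V W U \<beta> t"
  by (rule tensor_eqI[OF _ _ assms(2)])
    (simp_all add: tensor_lift_props[OF K_field m assms(1)] sweedler_linear sweedler_pure assms(1))

end

lemma linear_app: "linear_map K W U g \<Longrightarrow> linear_map K V W f \<Longrightarrow> linear_map K V U (\<lambda>x. g (f x))"
  by (rule linear_map_comp)

lemma linear_ident [tensor_simps]: "linear_map K V V (\<lambda>x. x)"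
  by (auto simp: linear_map_def)

lemma pure_closed [tensor_simps]:
  "module K V \<Longrightarrow> module K W \<Longrightarrow> v \<in> carrier V \<Longrightarrow> w \<in> carrier W \<Longrightarrow>
    pure_tensor K V W v w \<in> carrier (V \<boxtimes> W)"
  by (rule bilinear_map_closed[OF pure_tensor_bilinear[OF K_field]])

text \<open>The inner map \<open>f\<close> is built into this and the following linearity rules, so
  that they decompose nested expressions however deep the variable sits.\<close>

lemma linear_pure_left [tensor_simps]:
  "module K W \<Longrightarrow> module K X \<Longrightarrow> linear_map K V W f \<Longrightarrow> x \<in> carrier X \<Longrightarrow>
    linear_map K V (W \<boxtimes> X) (\<lambda>v. pure_tensor K W X (f v) x)"
  by (rule linear_app[of W _ "\<lambda>w. pure_tensor K W X w x"])
    (use pure_tensor_bilinear[OF K_field, of W X] in \<open>simp_all add: bilinear_map_def\<close>)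

lemma linear_pure_right [tensor_simps]:
  "module K W \<Longrightarrow> module K X \<Longrightarrow> linear_map K V X f \<Longrightarrow> w \<in> carrier W \<Longrightarrow>
    linear_map K V (W \<boxtimes> X) (\<lambda>v. pure_tensor K W X w (f v))"
  by (rule linear_app[of X _ "\<lambda>x. pure_tensor K W X w x"])
    (use pure_tensor_bilinear[OF K_field, of W X] in \<open>simp_all add: bilinear_map_def\<close>)

lemma linear_sweedler_arg [tensor_simps]:
  "module K P \<Longrightarrow> module K Q \<Longrightarrow> module K U \<Longrightarrow> linear_map K V (P \<boxtimes> Q) f \<Longrightarrow>
   bilinear_map K P Q U \<beta> \<Longrightarrow> linear_map K V U (\<lambda>x. sweedler K P Q U \<beta> (f x))"
  by (rule linear_app[OF sweedler_linear])

lemma linear_add: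
  assumes "module K U" "linear_map K V U f" "linear_map K V U g" "module K V"
  shows "linear_map K V U (\<lambda>x. f x \<oplus>\<^bsub>U\<^esub> g x)"
proof -
  interpret U: module K U by fact
  interpret V: module K V by fact
  show ?thesis using assms(2,3) unfolding linear_map_def Pi_iff
    by (auto simp: U.smult_r_distr U.M.a_ac)
qed

lemma linear_smult:
  assumes "module K U" "linear_map K V U f" "c \<in> carrier K" "module K V"
  shows "linear_map K V U (\<lambda>x. c \<odot>\<^bsub>U\<^esub> f x)"
proof -
  interpret U: module K U by fact
  interpret V: module K V by fact
  show ?thesis using assms(2,3) unfolding linear_map_def Pi_iff
    by (auto simp: U.smult_r_distr U.smult_assoc1[symmetric] K.m_comm)
qed

text \<open>For a parameter in the summand instead of in \<open>t\<close>. Additivity and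
  homogeneity in \<open>x\<close> are equations between maps linear in \<open>t\<close>, so pure
  tensors suffice, and there they are the hypothesis \<open>l\<close>.\<close>

lemma linear_sweedler_fun [tensor_simps]:
  assumes m: "module K V" "module K P" "module K Q" "module K U" and t: "t \<in> carrier (P \<boxtimes> Q)"
    and b: "\<And>x. x \<in> carrier V \<Longrightarrow> bilinear_map K P Q U (\<beta> x)"
    and l: "\<And>p q. p \<in> carrier P \<Longrightarrow> q \<in> carrier Q \<Longrightarrow> linear_map K V U (\<lambda>x. \<beta> x p q)"
  shows "linear_map K V U (\<lambda>x. sweedler K P Q U (\<beta> x) t)"
proof -
  interpret V: module K V by fact
  interpret U: module K U by fact
  note T = tensor_product_module[OF m(2,3)]
  note sl = sweedler_linear[OF m(2,3,4)] and sp = sweedler_pure[OF m(2,3,4)]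
  have "sweedler K P Q U (\<beta> (x \<oplus>\<^bsub>V\<^esub> y)) t = sweedler K P Q U (\<beta> x) t \<oplus>\<^bsub>U\<^esub> sweedler K P Q U (\<beta> y) t"
    if "x \<in> carrier V" "y \<in> carrier V" for x y
    by (rule tensor_eqI[OF m(2,3,4) sl linear_add[OF m(4) sl sl T] t])
      (simp_all only: sp[OF b] that V.M.a_closed b l[unfolded linear_map_def])
  moreover have "sweedler K P Q U (\<beta> (c \<odot>\<^bsub>V\<^esub> x)) t = c \<odot>\<^bsub>U\<^esub> sweedler K P Q U (\<beta> x) t"
    if "x \<in> carrier V" "c \<in> carrier K" for x c
    by (rule tensor_eqI[OF m(2,3,4) sl linear_smult[OF m(4) sl _ T] t])
      (simp_all only: sp[OF b] that V.smult_closed b l[unfolded linear_map_def])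
  ultimately show ?thesis
    using b t sweedler_closed[OF m(2,3,4)] by (auto simp: linear_map_def)
qed

lemmas [tensor_simps] = sweedler_closed sweedler_pure

text \<open>Both sides are linear in \<open>t\<close> and agree on pure tensors. The rules that move
  a sum past another sum, a product or a pure tensor are instances.\<close>

lemma sweedler_push:
  assumes "module K V" "module K W" "module K U" "module K X" "linear_map K U X g"
    "bilinear_map K V W U \<beta>" "t \<in> carrier (V \<boxtimes> W)"
  shows "g (sweedler K V W U \<beta> t) = sweedler K V W X (\<lambda>v w. g (\<beta> v w)) t"
proof -
  have b: "bilinear_map K V W X (\<lambda>v w. g (\<beta> v w))"
    by (rule bilinear_map_I; rule linear_app[OF assms(5)]) (use assms(6) in \<open>simp_all add: bilinear_map_def\<close>)
  show ?thesis
    by (rule tensor_eqI[OF assms(1,2,4) linear_app[OF assms(5) sweedler_linear] sweedler_linear])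
      (use assms b in \<open>auto simp: sweedler_pure\<close>)
qed

lemma sweedler_sweedler [tensor_simps]:
  assumes "module K V" "module K W" "module K P" "module K Q" "module K U"
    "t \<in> carrier (V \<boxtimes> W)" "bilinear_map K V W (P \<boxtimes> Q) \<beta>" "bilinear_map K P Q U \<gamma>"
  shows "sweedler K P Q U \<gamma> (sweedler K V W (P \<boxtimes> Q) \<beta> t) =
    sweedler K V W U (\<lambda>v w. sweedler K P Q U \<gamma> (\<beta> v w)) t"
  by (rule sweedler_push) (use assms in \<open>simp_all add: sweedler_linear tensor_product_module\<close>)

lemma sweedler_id [tensor_simps]:
  assumes "module K V" "module K W" "t \<in> carrier (V \<boxtimes> W)"
  shows "sweedler K V W (V \<boxtimes> W) (\<lambda>v w. pure_tensor K V W v w) t = t"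
proof -
  note b = pure_tensor_bilinear[OF K_field assms(1,2)]
    and T = tensor_product_module[OF assms(1,2)]
  show ?thesis
    by (rule tensor_eqI[OF assms(1,2) T sweedler_linear[OF assms(1,2) T b] linear_ident assms(3)])
      (rule sweedler_pure[OF assms(1,2) T b])
qed

text \<open>A Fubini rule. Both sides are linear in \<open>t'\<close>, and for pure
  \<open>t'\<close> the sum over \<open>P\<close> and \<open>Q\<close> collapses to one
  term.\<close>

lemma sweedler_swap:
  assumes m: "module K V" "module K W" "module K P" "module K Q" "module K U"
    and t: "t \<in> carrier (V \<boxtimes> W)" "t' \<in> carrier (P \<boxtimes> Q)"
    and b1: "\<And>v w. v \<in> carrier V \<Longrightarrow> w \<in> carrier W \<Longrightarrow> bilinear_map K P Q U (\<gamma> v w)"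
    and b2: "\<And>p q. p \<in> carrier P \<Longrightarrow> q \<in> carrier Q \<Longrightarrow> bilinear_map K V W U (\<lambda>v w. \<gamma> v w p q)"
  shows "sweedler K V W U (\<lambda>v w. sweedler K P Q U (\<gamma> v w) t') t =
    sweedler K P Q U (\<lambda>p q. sweedler K V W U (\<lambda>v w. \<gamma> v w p q) t) t'"
proof (rule tensor_eqI[OF m(3,4,5) _ _ t(2)])
  \<comment> \<open>Bilinearity is split into its four one-variable parts, the form in which
    \<open>linear_sweedler_fun\<close> consumes it.\<close>
  have b2': "linear_map K V U (\<lambda>v. \<gamma> v w p q)"
    if "w \<in> carrier W" "p \<in> carrier P" "q \<in> carrier Q" for w p q
    using b2[OF that(2,3)] that(1) by (simp add: bilinear_map_def)
  have b2'': "linear_map K W U (\<lambda>w. \<gamma> v w p q)"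
    if "v \<in> carrier V" "p \<in> carrier P" "q \<in> carrier Q" for v p q
    using b2[OF that(2,3)] that(1) by (simp add: bilinear_map_def)
  have b1': "linear_map K P U (\<lambda>p. \<gamma> v w p q)"
    if "v \<in> carrier V" "w \<in> carrier W" "q \<in> carrier Q" for v w q
    using b1[OF that(1,2)] that(3) by (simp add: bilinear_map_def)
  have b1'': "linear_map K Q U (\<lambda>q. \<gamma> v w p q)"
    if "v \<in> carrier V" "w \<in> carrier W" "p \<in> carrier P" for v w p
    using b1[OF that(1,2)] that(3) by (simp add: bilinear_map_def)
  have bs: "bilinear_map K V W U (\<lambda>v w. sweedler K P Q U (\<gamma> v w) t')" if "t' \<in> carrier (P \<boxtimes> Q)" for t'
    by (rule bilinear_map_I; rule linear_sweedler_fun) (use m that b1 b2' b2'' in simp_all)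
  show "linear_map K (P \<boxtimes> Q) U (\<lambda>t'. sweedler K V W U (\<lambda>v w. sweedler K P Q U (\<gamma> v w) t') t)"
    by (rule linear_sweedler_fun) (use m t bs b1 in \<open>auto simp: tensor_product_module sweedler_linear\<close>)
  have b3: "bilinear_map K P Q U (\<lambda>p q. sweedler K V W U (\<lambda>v w. \<gamma> v w p q) t)"
    by (rule bilinear_map_I; rule linear_sweedler_fun) (use m t b2 b1' b1'' in simp_all)
  then show "linear_map K (P \<boxtimes> Q) U (sweedler K P Q U (\<lambda>p q. sweedler K V W U (\<lambda>v w. \<gamma> v w p q) t))"
    by (rule sweedler_linear[OF m(3,4,5)])
  show "sweedler K V W U (\<lambda>v w. sweedler K P Q U (\<gamma> v w) (pure_tensor K P Q p q)) t =
    sweedler K P Q U (\<lambda>p q. sweedler K V W U (\<lambda>v w. \<gamma> v w p q) t) (pure_tensor K P Q p q)"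
    if "p \<in> carrier P" "q \<in> carrier Q" for p q
    using that by (simp add: sweedler_pure[OF m(3,4,5) b3] sweedler_pure[OF m(3,4,5) b1])
qed

end

section \<open>Evaluation of the structural maps\<close>

context base_field
begin

context
  fixes A :: "('k, 'a) module"
  assumes alg: "assoc_algebra K A"
begin

interpretation A: assoc_algebra K A by (rule alg)

text \<open>The locale facts are restated with \<open>assoc_algebra K A\<close> as a premise, so
  that one set of rewrite rules serves all algebras involved.\<close>

lemma algebra_module: "module K A" by (rule A.module_axioms)

lemma algebra_mult_closed:
  "x \<in> carrier A \<Longrightarrow> y \<in> carrier A \<Longrightarrow> x \<otimes>\<^bsub>A\<^esub> y \<in> carrier A"
  by (rule A.A.m_closed)

lemma algebra_one_closed: "\<one>\<^bsub>A\<^esub> \<in> carrier A" by (rule A.A.one_closed)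

lemma algebra_mult_assoc:
  "x \<in> carrier A \<Longrightarrow> y \<in> carrier A \<Longrightarrow> z \<in> carrier A \<Longrightarrow>
    x \<otimes>\<^bsub>A\<^esub> y \<otimes>\<^bsub>A\<^esub> z = x \<otimes>\<^bsub>A\<^esub> (y \<otimes>\<^bsub>A\<^esub> z)"
  by (rule A.A.m_assoc)

lemma algebra_one_mult:
  "x \<in> carrier A \<Longrightarrow> \<one>\<^bsub>A\<^esub> \<otimes>\<^bsub>A\<^esub> x = x" "x \<in> carrier A \<Longrightarrow> x \<otimes>\<^bsub>A\<^esub> \<one>\<^bsub>A\<^esub> = x"
  by (rule A.A.l_one A.A.r_one; assumption)+

lemma linear_mult_right:
  "linear_map K V A f \<Longrightarrow> y \<in> carrier A \<Longrightarrow> linear_map K V A (\<lambda>v. f v \<otimes>\<^bsub>A\<^esub> y)"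
  by (simp add: linear_map_def Pi_iff A.A.l_distr A.smult_mult_left)

lemma linear_mult_left:
  "linear_map K V A f \<Longrightarrow> y \<in> carrier A \<Longrightarrow> linear_map K V A (\<lambda>v. y \<otimes>\<^bsub>A\<^esub> f v)"
  by (simp add: linear_map_def Pi_iff A.A.r_distr A.smult_mult_right)

end

lemmas [tensor_simps] = algebra_module algebra_mult_closed algebra_one_closed
  algebra_mult_assoc algebra_one_mult linear_mult_right linear_mult_left

lemma sweedler_mult_right [tensor_simps]:
  assumes "assoc_algebra K A" "module K V" "module K W" "bilinear_map K V W A \<beta>"
    "t \<in> carrier (V \<boxtimes> W)" "y \<in> carrier A"
  shows "sweedler K V W A \<beta> t \<otimes>\<^bsub>A\<^esub> y = sweedler K V W A (\<lambda>v w. \<beta> v w \<otimes>\<^bsub>A\<^esub> y) t"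
  using assms by (intro sweedler_push[where g = "\<lambda>x. x \<otimes>\<^bsub>A\<^esub> y"]) (simp_all add: tensor_simps del: bilinear_iff)

lemma sweedler_mult_left [tensor_simps]:
  assumes "assoc_algebra K A" "module K V" "module K W" "bilinear_map K V W A \<beta>"
    "t \<in> carrier (V \<boxtimes> W)" "y \<in> carrier A"
  shows "y \<otimes>\<^bsub>A\<^esub> sweedler K V W A \<beta> t = sweedler K V W A (\<lambda>v w. y \<otimes>\<^bsub>A\<^esub> \<beta> v w) t"
  using assms by (intro sweedler_push[where g = "\<lambda>x. y \<otimes>\<^bsub>A\<^esub> x"]) (simp_all add: tensor_simps del: bilinear_iff)

lemma sweedler_pure_right [tensor_simps]:
  assumes "module K V" "module K W" "module K X" "module K Y" "bilinear_map K V W Y \<beta>"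
    "t \<in> carrier (V \<boxtimes> W)" "x \<in> carrier X"
  shows "pure_tensor K X Y x (sweedler K V W Y \<beta> t) =
    sweedler K V W (X \<boxtimes> Y) (\<lambda>v w. pure_tensor K X Y x (\<beta> v w)) t"
  using assms by (intro sweedler_push[where g = "\<lambda>y. pure_tensor K X Y x y"]) (simp_all add: tensor_simps del: bilinear_iff)

section \<open>Structural maps of tensor products as Sweedler sums\<close>

lemma tensor_map_eval:
  assumes "module K V" "module K W" "module K V'" "module K W'"
    "linear_map K V V' f" "linear_map K W W' g" "t \<in> carrier (V \<boxtimes> W)"
  shows "tensor_map K V' W' f g t =
    sweedler K V W (V' \<boxtimes> W') (\<lambda>v w. pure_tensor K V' W' (f v) (g w)) t"
  unfolding tensor_map_def
  by (rule lift_sweedler)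
    (use assms in \<open>simp_all add: tensor_simps linear_closed[OF assms(5)] linear_closed[OF assms(6)]\<close>)

text \<open>Instead of unfolding the nested lifts, uniqueness is applied twice: first in the factor
  from \<open>U \<boxtimes> V\<close>, then on the whole product.\<close>

lemma tensor_assoc_eval:
  assumes "module K U" "module K V" "module K W" "t \<in> carrier ((U \<boxtimes> V) \<boxtimes> W)"
  shows "tensor_assoc K U V W t =
    sweedler K (U \<boxtimes> V) W (U \<boxtimes> (V \<boxtimes> W))
      (\<lambda>x w. sweedler K U V (U \<boxtimes> (V \<boxtimes> W))
        (\<lambda>u v. pure_tensor K U (V \<boxtimes> W) u (pure_tensor K V W v w)) x) t"
    (is "_ = sweedler K ?UV W ?T ?\<beta> t")
proof -
  have \<beta>: "bilinear_map K ?UV W ?T ?\<beta>" using assms(1-3) by (simp add: tensor_simps)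
  have L: "linear_map K (?UV \<boxtimes> W) ?T (sweedler K ?UV W ?T ?\<beta>)"
    by (rule sweedler_linear[OF _ _ _ \<beta>]) (use assms in \<open>simp_all add: tensor_simps\<close>)
  have "tensor_assoc K U V W (pure_tensor K ?UV W x w) = sweedler K ?UV W ?T ?\<beta> (pure_tensor K ?UV W x w)"
    if x: "x \<in> carrier ?UV" and w: "w \<in> carrier W" for x w
    by (rule tensor_eqI[OF assms(1,2) _ linear_app[OF tensor_assoc_props(1)[OF K_field assms(1-3)]] linear_app[OF L] x])
      (use assms(1-3) w in \<open>simp_all add: tensor_simps tensor_assoc_props(2)[OF K_field]\<close>)
  then show ?thesis
    by (intro tensor_eqI[OF _ assms(3) _ tensor_assoc_props(1)[OF K_field assms(1-3)] L assms(4)])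
      (use assms in \<open>simp_all add: tensor_simps\<close>)
qed

lemma tensor_unassoc_eval:
  assumes "module K U" "module K V" "module K W" "t \<in> carrier (U \<boxtimes> (V \<boxtimes> W))"
  shows "tensor_unassoc K U V W t =
    sweedler K U (V \<boxtimes> W) ((U \<boxtimes> V) \<boxtimes> W)
      (\<lambda>u x. sweedler K V W ((U \<boxtimes> V) \<boxtimes> W)
        (\<lambda>v w. pure_tensor K (U \<boxtimes> V) W (pure_tensor K U V u v) w) x) t"
    (is "_ = sweedler K U ?VW ?T ?\<beta> t")
proof -
  let ?b = "\<lambda>u. tensor_lift K ?T (\<lambda>v w. pure_tensor K (U \<boxtimes> V) W (pure_tensor K U V u v) w)"
  have \<beta>: "bilinear_map K U ?VW ?T ?\<beta>" using assms(1-3) by (simp add: tensor_simps)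
  \<comment> \<open>The inner lift agrees with its Sweedler form on carrier elements; this also
    yields the bilinearity that the outer lift requires.\<close>
  have e: "?b u x = ?\<beta> u x" if "u \<in> carrier U" "x \<in> carrier ?VW" for u x
    by (rule lift_sweedler) (use assms that in \<open>simp_all add: tensor_simps\<close>)
  have "bilinear_map K U ?VW ?T ?b"
  proof (rule bilinear_map_I)
    fix u assume u: "u \<in> carrier U"
    show "linear_map K ?VW ?T (\<lambda>x. ?b u x)"
      by (subst linear_cong[OF e[OF u]]) (use assms u \<beta> in \<open>simp_all add: tensor_simps\<close>)
  next
    fix x assume x: "x \<in> carrier ?VW"
    show "linear_map K U ?T (\<lambda>u. ?b u x)"
      by (subst linear_cong[OF e[OF _ x]]) (use assms x \<beta> in \<open>simp_all add: tensor_simps\<close>)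
  qed
  then have "tensor_lift K ?T ?b t = sweedler K U ?VW ?T ?b t"
    by (rule lift_sweedler[OF _ _ _ _ assms(4), rotated -1]) (use assms in \<open>simp_all add: tensor_simps\<close>)
  also have "\<dots> = sweedler K U ?VW ?T ?\<beta> t" by (rule sweedler_cong) (simp_all add: e)
  finally show ?thesis by (simp add: tensor_unassoc_def)
qed

lemma mult_map_eval:
  assumes "assoc_algebra K A" "t \<in> carrier (A \<boxtimes> A)"
  shows "mult_map K A t = sweedler K A A A (\<lambda>x y. x \<otimes>\<^bsub>A\<^esub> y) t"
  unfolding mult_map_def by (rule lift_sweedler) (use assms in \<open>simp_all add: tensor_simps\<close>)

lemma tensor_map_id_left_eval:
  assumes "module K V" "module K W" "module K W'"
    "linear_map K W W' g" "t \<in> carrier (V \<boxtimes> W)"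
  shows "tensor_map K V W' id g t =
    sweedler K V W (V \<boxtimes> W') (\<lambda>v w. pure_tensor K V W' v (g w)) t"
  using assms by (simp add: tensor_map_eval[of V W] linear_map_id)

lemma tensor_map_id_right_eval:
  assumes "module K V" "module K W" "module K V'"
    "linear_map K V V' f" "t \<in> carrier (V \<boxtimes> W)"
  shows "tensor_map K V' W f id t =
    sweedler K V W (V' \<boxtimes> W) (\<lambda>v w. pure_tensor K V' W (f v) w) t"
  using assms by (simp add: tensor_map_eval[of V W] linear_map_id)

lemma tensor_assoc_linear [tensor_simps]:
  "module K U \<Longrightarrow> module K V \<Longrightarrow> module K W \<Longrightarrow> linear_map K X ((U \<boxtimes> V) \<boxtimes> W) f \<Longrightarrow>
    linear_map K X (U \<boxtimes> (V \<boxtimes> W)) (\<lambda>x. tensor_assoc K U V W (f x))"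
  by (rule linear_app[OF tensor_assoc_props(1)[OF K_field]])

lemma tensor_unassoc_linear [tensor_simps]:
  assumes "module K U" "module K V" "module K W" "linear_map K X (U \<boxtimes> (V \<boxtimes> W)) f"
  shows "linear_map K X ((U \<boxtimes> V) \<boxtimes> W) (\<lambda>x. tensor_unassoc K U V W (f x))"
proof (rule linear_app[OF _ assms(4)])
  show "linear_map K (U \<boxtimes> (V \<boxtimes> W)) ((U \<boxtimes> V) \<boxtimes> W) (\<lambda>x. tensor_unassoc K U V W x)"
    by (subst linear_cong[OF tensor_unassoc_eval]) (use assms in \<open>simp_all add: tensor_simps\<close>)
qed

lemma tensor_map_linear:
  "module K V \<Longrightarrow> module K W \<Longrightarrow> module K V' \<Longrightarrow> module K W' \<Longrightarrow>
   linear_map K V V' f \<Longrightarrow> linear_map K W W' g \<Longrightarrow> linear_map K X (V \<boxtimes> W) h \<Longrightarrow>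
   linear_map K X (V' \<boxtimes> W') (\<lambda>x. tensor_map K V' W' f g (h x))"
  by (rule linear_app[OF tensor_map_pure(1)[OF K_field]])

lemmas tensor_pure =
  tensor_assoc_props(2)[OF K_field]
  tensor_map_pure(2)[OF K_field]

lemma tensor_unassoc_pure:
  "module K U \<Longrightarrow> module K V \<Longrightarrow> module K W \<Longrightarrow> u \<in> carrier U \<Longrightarrow> v \<in> carrier V \<Longrightarrow> w \<in> carrier W \<Longrightarrow>
    tensor_unassoc K U V W (pure_tensor K U (V \<boxtimes> W) u (pure_tensor K V W v w)) =
    pure_tensor K (U \<boxtimes> V) W (pure_tensor K U V u v) w"
  by (simp add: tensor_unassoc_eval tensor_simps)

context
  fixes U :: "('k, 'u) module" and V :: "('k, 'v) module" and W :: "('k, 'w) module"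
    and X :: "('k, 'x) module" and V' :: "('k, 'v2) module" and W' :: "('k, 'w2) module" and f
  assumes m: "module K U" "module K V" "module K W" "module K X" "module K V'" "module K W'"
    and f: "linear_map K (V \<boxtimes> W) (V' \<boxtimes> W') f"
begin

lemma tensor_middle_linear:
  assumes "linear_map K Y ((U \<boxtimes> V) \<boxtimes> (W \<boxtimes> X)) g"
  shows "linear_map K Y ((U \<boxtimes> V') \<boxtimes> (W' \<boxtimes> X)) (\<lambda>y. tensor_middle K U V W X V' W' f (g y))"
proof -
  note [simp] = m f linear_map_id
  \<comment> \<open>\<open>G\<close> is \<open>f \<otimes> 1\<close> in right-bracketed form; naming
    it lets \<open>1 \<otimes> G\<close> be treated as the tensor product of two linear
    maps.\<close>
  define G where "G = tensor_assoc K V' W' X \<circ> tensor_map K (V' \<boxtimes> W') X f id \<circ> tensor_unassoc K V W X"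
  have "linear_map K (V \<boxtimes> (W \<boxtimes> X)) (V' \<boxtimes> (W' \<boxtimes> X)) (\<lambda>x. G x)"
    by (simp add: G_def tensor_simps tensor_map_linear[of "V \<boxtimes> W" X])
  then show ?thesis unfolding tensor_middle_def G_def[symmetric]
    using assms by (simp add: tensor_simps tensor_map_linear[of U "V \<boxtimes> (W \<boxtimes> X)"])
qed

text \<open>On four pure factors every rebracketing evaluates, which leaves \<open>f\<close> as the
  only source of a sum.\<close>

lemma tensor_middle_pure4:
  assumes "u \<in> carrier U" "v \<in> carrier V" "w \<in> carrier W" "x \<in> carrier X"
  shows "tensor_middle K U V W X V' W' f
      (pure_tensor K (U \<boxtimes> V) (W \<boxtimes> X) (pure_tensor K U V u v) (pure_tensor K W X w x)) =
    sweedler K V' W' ((U \<boxtimes> V') \<boxtimes> (W' \<boxtimes> X))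
      (\<lambda>v' w'. pure_tensor K (U \<boxtimes> V') (W' \<boxtimes> X) (pure_tensor K U V' u v') (pure_tensor K W' X w' x))
      (f (pure_tensor K V W v w))"
proof -
  note [simp] = m f linear_map_id assms linear_closed[OF f]
  define G where "G = tensor_assoc K V' W' X \<circ> tensor_map K (V' \<boxtimes> W') X f id \<circ> tensor_unassoc K V W X"
  have "linear_map K (V \<boxtimes> (W \<boxtimes> X)) (V' \<boxtimes> (W' \<boxtimes> X)) (\<lambda>x. G x)"
    by (simp add: G_def tensor_simps tensor_map_linear[of "V \<boxtimes> W" X])
  moreover have "G (pure_tensor K V (W \<boxtimes> X) v (pure_tensor K W X w x)) =
    sweedler K V' W' (V' \<boxtimes> (W' \<boxtimes> X)) (\<lambda>v' w'. pure_tensor K V' (W' \<boxtimes> X) v' (pure_tensor K W' X w' x))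
       (f (pure_tensor K V W v w))"
    by (simp add: G_def tensor_unassoc_pure tensor_map_pure[OF K_field, of "V \<boxtimes> W" X] tensor_simps tensor_assoc_eval)
  ultimately show ?thesis unfolding tensor_middle_def G_def[symmetric]
    by (simp add: tensor_unassoc_eval tensor_map_pure[OF K_field, of U "V \<boxtimes> (W \<boxtimes> X)"] tensor_simps tensor_pure)
qed

text \<open>The formula for four pure factors extends by linearity in two stages, first to all
  \<open>q\<close> and then to all \<open>p\<close>.\<close>

lemma tensor_middle_pure:
  assumes p: "p \<in> carrier (U \<boxtimes> V)" and q: "q \<in> carrier (W \<boxtimes> X)"
  shows "tensor_middle K U V W X V' W' f (pure_tensor K (U \<boxtimes> V) (W \<boxtimes> X) p q) =
    sweedler K U V ((U \<boxtimes> V') \<boxtimes> (W' \<boxtimes> X))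
        (\<lambda>u v. sweedler K W X ((U \<boxtimes> V') \<boxtimes> (W' \<boxtimes> X))
          (\<lambda>w x. sweedler K V' W' ((U \<boxtimes> V') \<boxtimes> (W' \<boxtimes> X))
            (\<lambda>v' w'. pure_tensor K (U \<boxtimes> V') (W' \<boxtimes> X) (pure_tensor K U V' u v') (pure_tensor K W' X w' x))
            (f (pure_tensor K V W v w))) q) p"
    (is "?l p q = ?r p q")
proof -
  note [simp] = m linear_closed[OF f] linear_app[OF f]
  have 1: "?l (pure_tensor K U V u v) q = ?r (pure_tensor K U V u v) q"
    if [simp]: "u \<in> carrier U" "v \<in> carrier V" for u v
    by (rule tensor_eqI[OF m(3,4) _ _ _ q, where U = "(U \<boxtimes> V') \<boxtimes> (W' \<boxtimes> X)"])
      (simp_all add: tensor_simps tensor_middle_linear tensor_middle_pure4)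
  show ?thesis
    by (rule tensor_eqI[OF m(1,2) _ _ _ p, where U = "(U \<boxtimes> V') \<boxtimes> (W' \<boxtimes> X)"])
      (use q in \<open>simp_all add: tensor_simps tensor_middle_linear 1[simplified tensor_simps]\<close>)
qed

end

lemma tensor3_eqI:
  assumes m: "module K U" "module K V" "module K W" "module K X"
    and "linear_map K (U \<boxtimes> (V \<boxtimes> W)) X f" "linear_map K (U \<boxtimes> (V \<boxtimes> W)) X g" "t \<in> carrier (U \<boxtimes> (V \<boxtimes> W))"
    and eq: "\<And>u v w. u \<in> carrier U \<Longrightarrow> v \<in> carrier V \<Longrightarrow> w \<in> carrier W \<Longrightarrow>
      f (pure_tensor K U (V \<boxtimes> W) u (pure_tensor K V W v w)) = g (pure_tensor K U (V \<boxtimes> W) u (pure_tensor K V W v w))"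
  shows "f t = g t"
proof (rule tensor_eqI[OF m(1) _ m(4) assms(5-7)])
  fix u y assume u: "u \<in> carrier U" and y: "y \<in> carrier (V \<boxtimes> W)"
  show "f (pure_tensor K U (V \<boxtimes> W) u y) = g (pure_tensor K U (V \<boxtimes> W) u y)"
    by (rule tensor_eqI[OF m(2-4) _ _ y]; (rule linear_app[OF assms(5)] linear_app[OF assms(6)] eq)?)
      (use m u in \<open>simp_all add: tensor_simps\<close>)
qed (use m in \<open>simp add: tensor_simps\<close>)

end

section \<open>Bimodule splittings in Sweedler form\<close>

context base_field
begin

lemma mult_map_linear [tensor_simps]:
  assumes "assoc_algebra K A" "linear_map K X (A \<boxtimes> A) f"
  shows "linear_map K X A (\<lambda>x. mult_map K A (f x))"
proof (rule linear_app[OF _ assms(2)])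
  show "linear_map K (A \<boxtimes> A) A (\<lambda>x. mult_map K A x)"
    by (subst linear_cong[OF mult_map_eval]) (use assms in \<open>simp_all add: tensor_simps\<close>)
qed

lemma tensor_map_sweedler:
  assumes "module K V" "module K W" "module K V'" "module K W'" "module K P" "module K Q"
    "linear_map K V V' f" "linear_map K W W' g" "bilinear_map K P Q (V \<boxtimes> W) \<beta>" "t \<in> carrier (P \<boxtimes> Q)"
  shows "tensor_map K V' W' f g (sweedler K P Q (V \<boxtimes> W) \<beta> t) =
    sweedler K P Q (V' \<boxtimes> W') (\<lambda>p q. tensor_map K V' W' f g (\<beta> p q)) t"
  by (rule sweedler_push[OF assms(5,6) _ _ tensor_map_pure(1)[OF K_field]])
    (use assms in \<open>simp_all add: tensor_simps del: bilinear_iff\<close>)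

text \<open>For linear \<Gamma> the bimodule axiom equates two linear maps on a triple tensor
  product, hence is an equation on pure triples. If \<Gamma> is not linear, both sides of the
  equivalence fail.\<close>

lemma bimodule_right_inverse_iff:
  assumes alg: "assoc_algebra K A"
  shows "bimodule_right_inverse K A \<Gamma> \<longleftrightarrow>
    linear_map K A (A \<boxtimes> A) \<Gamma> \<and>
    (\<forall>x\<in>carrier A. sweedler K A A A (\<lambda>p q. p \<otimes>\<^bsub>A\<^esub> q) (\<Gamma> x) = x) \<and>
    (\<forall>x\<in>carrier A. \<forall>y\<in>carrier A. \<forall>z\<in>carrier A.
      \<Gamma> (x \<otimes>\<^bsub>A\<^esub> (y \<otimes>\<^bsub>A\<^esub> z)) =
      sweedler K A A (A \<boxtimes> A) (\<lambda>p q. pure_tensor K A A (x \<otimes>\<^bsub>A\<^esub> p) (q \<otimes>\<^bsub>A\<^esub> z)) (\<Gamma> y))"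
proof (cases "linear_map K A (A \<boxtimes> A) \<Gamma>")
  case \<Gamma>: True
  note [simp] = alg linear_closed[OF \<Gamma>] linear_app[OF \<Gamma>] \<Gamma> linear_map_id
  have mm [simp]: "linear_map K (A \<boxtimes> A) A (mult_map K A)"
    using mult_map_linear[OF alg linear_ident] .
  \<comment> \<open>\<open>G\<close> is \<open>\<Gamma> \<otimes> 1\<close> in right-bracketed form;
    \<open>L\<close> and \<open>M\<close> are the two sides of the bimodule axiom.\<close>
  define G where "G = tensor_assoc K A A A \<circ> tensor_map K (A \<boxtimes> A) A \<Gamma> id"
  define L where "L = (\<lambda>x. \<Gamma> (mult_map K A (tensor_map K A A id (mult_map K A) x)))"
  define M where "M = tensor_map K A A (mult_map K A) (mult_map K A) \<circ>
         tensor_unassoc K A A (A \<boxtimes> A) \<circ> tensor_map K A (A \<boxtimes> (A \<boxtimes> A)) id G"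
  have G [simp]: "linear_map K (A \<boxtimes> A) (A \<boxtimes> (A \<boxtimes> A)) G"
    using tensor_assoc_linear[OF _ _ _ tensor_map_linear[OF _ _ _ _ _ _ linear_ident, of A A], of A A A \<Gamma> id]
    by (simp add: G_def o_def tensor_simps)
  have "G (pure_tensor K A A y z) = sweedler K A A (A \<boxtimes> (A \<boxtimes> A))
      (\<lambda>p q. pure_tensor K A (A \<boxtimes> A) p (pure_tensor K A A q z)) (\<Gamma> y)"
    if "y \<in> carrier A" "z \<in> carrier A" for y z
    using that by (simp add: G_def tensor_map_pure[OF K_field, of A A] tensor_simps tensor_assoc_eval)
  then have M: "M (pure_tensor K A (A \<boxtimes> A) x (pure_tensor K A A y z)) =
      sweedler K A A (A \<boxtimes> A) (\<lambda>p q. pure_tensor K A A (x \<otimes>\<^bsub>A\<^esub> p) (q \<otimes>\<^bsub>A\<^esub> z)) (\<Gamma> y)"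
    if "x \<in> carrier A" "y \<in> carrier A" "z \<in> carrier A" for x y z
    using that
    by (simp add: M_def tensor_map_pure[OF K_field, of A "A \<boxtimes> A"] tensor_map_pure[OF K_field, of "A \<boxtimes> A" "A \<boxtimes> A"]
        tensor_simps tensor_unassoc_eval tensor_map_sweedler mult_map_eval)
  have L: "L (pure_tensor K A (A \<boxtimes> A) x (pure_tensor K A A y z)) = \<Gamma> (x \<otimes>\<^bsub>A\<^esub> (y \<otimes>\<^bsub>A\<^esub> z))"
    if "x \<in> carrier A" "y \<in> carrier A" "z \<in> carrier A" for x y z
    using that by (simp add: L_def tensor_map_pure[OF K_field, of A "A \<boxtimes> A"] tensor_simps mult_map_eval)
  have lins: "linear_map K (A \<boxtimes> (A \<boxtimes> A)) (A \<boxtimes> A) (\<lambda>x. L x)" "linear_map K (A \<boxtimes> (A \<boxtimes> A)) (A \<boxtimes> A) (\<lambda>x. M x)"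
    by (simp_all add: L_def M_def tensor_simps tensor_map_linear[of A "A \<boxtimes> A"] tensor_map_linear[of "A \<boxtimes> A" "A \<boxtimes> A"])
  have "(\<forall>t\<in>carrier (A \<boxtimes> (A \<boxtimes> A)). L t = M t) \<longleftrightarrow>
    (\<forall>x\<in>carrier A. \<forall>y\<in>carrier A. \<forall>z\<in>carrier A.
      \<Gamma> (x \<otimes>\<^bsub>A\<^esub> (y \<otimes>\<^bsub>A\<^esub> z)) =
      sweedler K A A (A \<boxtimes> A) (\<lambda>p q. pure_tensor K A A (x \<otimes>\<^bsub>A\<^esub> p) (q \<otimes>\<^bsub>A\<^esub> z)) (\<Gamma> y))"
    (is "?l \<longleftrightarrow> ?r")
  proof
    assume ?l
    then show ?r by (simp add: L[symmetric] M[symmetric] tensor_simps del: algebra_mult_assoc)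
  next
    assume ?r
    with L M show ?l by - (rule ballI, rule tensor3_eqI[OF _ _ _ _ lins], simp_all add: tensor_simps)
  qed
  moreover have "bimodule_right_inverse K A \<Gamma> \<longleftrightarrow>
      (\<forall>x\<in>carrier A. mult_map K A (\<Gamma> x) = x) \<and> (\<forall>t\<in>carrier (A \<boxtimes> (A \<boxtimes> A)). L t = M t)"
    unfolding bimodule_right_inverse_def L_def M_def G_def by (simp only: \<Gamma> simp_thms)
  moreover have "mult_map K A (\<Gamma> x) = sweedler K A A A (\<lambda>p q. p \<otimes>\<^bsub>A\<^esub> q) (\<Gamma> x)" if "x \<in> carrier A" for x
    using that by (simp add: mult_map_eval)
  ultimately show ?thesis using \<Gamma> by (simp only: simp_thms cong: ball_cong)
qed (simp add: bimodule_right_inverse_def)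

context
  fixes A :: "('k, 'a) module" and \<Gamma>
  assumes alg: "assoc_algebra K A" and \<Gamma>: "bimodule_right_inverse K A \<Gamma>"
begin

lemma bimodule_linear: "linear_map K A (A \<boxtimes> A) \<Gamma>"
  using \<Gamma> bimodule_right_inverse_iff[OF alg] by blast

lemma bimodule_mult: "x \<in> carrier A \<Longrightarrow> sweedler K A A A (\<lambda>p q. p \<otimes>\<^bsub>A\<^esub> q) (\<Gamma> x) = x"
  using \<Gamma> bimodule_right_inverse_iff[OF alg] by blast

text \<open>The bimodule axiom with the unit in its third slot. Together with the mirrored lemma
  below it says that \<Gamma> is left and right linear over \<open>A\<close>.\<close>

lemma sweedler_bimodule_left:
  assumes "module K U" "bilinear_map K A A U h" "a \<in> carrier A" "x \<in> carrier A"
  shows "sweedler K A A U h (\<Gamma> (a \<otimes>\<^bsub>A\<^esub> x)) = sweedler K A A U (\<lambda>p q. h (a \<otimes>\<^bsub>A\<^esub> p) q) (\<Gamma> x)"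
proof -
  note [simp] = alg linear_closed[OF bimodule_linear] assms
  have "\<Gamma> (a \<otimes>\<^bsub>A\<^esub> (x \<otimes>\<^bsub>A\<^esub> \<one>\<^bsub>A\<^esub>)) =
      sweedler K A A (A \<boxtimes> A) (\<lambda>p q. pure_tensor K A A (a \<otimes>\<^bsub>A\<^esub> p) (q \<otimes>\<^bsub>A\<^esub> \<one>\<^bsub>A\<^esub>)) (\<Gamma> x)"
    using \<Gamma> bimodule_right_inverse_iff[OF alg] by (simp add: tensor_simps del: algebra_one_mult)
  moreover have "linear_map K A U (h p)" "linear_map K A U (\<lambda>q. h q p)" if "p \<in> carrier A" for p
    using assms(2) that by (simp_all add: bilinear_map_def)
  ultimately show ?thesis by (simp add: tensor_simps)
qed

lemma sweedler_bimodule_right: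
  assumes "module K U" "bilinear_map K A A U h" "a \<in> carrier A" "x \<in> carrier A"
  shows "sweedler K A A U h (\<Gamma> (x \<otimes>\<^bsub>A\<^esub> a)) = sweedler K A A U (\<lambda>p q. h p (q \<otimes>\<^bsub>A\<^esub> a)) (\<Gamma> x)"
proof -
  note [simp] = alg linear_closed[OF bimodule_linear] assms
  have "\<Gamma> (\<one>\<^bsub>A\<^esub> \<otimes>\<^bsub>A\<^esub> (x \<otimes>\<^bsub>A\<^esub> a)) =
      sweedler K A A (A \<boxtimes> A) (\<lambda>p q. pure_tensor K A A (\<one>\<^bsub>A\<^esub> \<otimes>\<^bsub>A\<^esub> p) (q \<otimes>\<^bsub>A\<^esub> a)) (\<Gamma> x)"
    using \<Gamma> bimodule_right_inverse_iff[OF alg] by (simp add: tensor_simps del: algebra_one_mult)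
  moreover have "linear_map K A U (h p)" "linear_map K A U (\<lambda>q. h q p)" if "p \<in> carrier A" for p
    using assms(2) that by (simp_all add: bilinear_map_def)
  ultimately show ?thesis by (simp add: tensor_simps)
qed

end

end

section \<open>Algebras factorized by two subalgebras\<close>

text \<open>
  \<open>\<delta>\<close> and \<open>\<sigma>\<close> are the inverses of the multiplications \<open>A \<otimes> B \<rightarrow> R\<close> and \<open>B \<otimes> A \<rightarrow> R\<close>.
\<close>

locale algebra_factorization = base_field +
  fixes A :: "('k, 'a) module" and B :: "('k, 'b) module" and R :: "('k, 'r) module"
    and \<alpha> :: "'a \<Rightarrow> 'r" and \<beta> :: "'b \<Rightarrow> 'r"
    and \<delta> :: "'r \<Rightarrow> ('a \<times> 'b \<Rightarrow> 'k) set" and \<sigma> :: "'r \<Rightarrow> ('b \<times> 'a \<Rightarrow> 'k) set"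
  assumes algebras: "assoc_algebra K A" "assoc_algebra K B" "assoc_algebra K R"
    and linear: "linear_map K A R \<alpha>" "linear_map K B R \<beta>"
      "linear_map K R (A \<boxtimes> B) \<delta>" "linear_map K R (B \<boxtimes> A) \<sigma>"
    and \<alpha>_mult: "\<And>x y. x \<in> carrier A \<Longrightarrow> y \<in> carrier A \<Longrightarrow> \<alpha> (x \<otimes>\<^bsub>A\<^esub> y) = \<alpha> x \<otimes>\<^bsub>R\<^esub> \<alpha> y"
    and \<beta>_mult: "\<And>x y. x \<in> carrier B \<Longrightarrow> y \<in> carrier B \<Longrightarrow> \<beta> (x \<otimes>\<^bsub>B\<^esub> y) = \<beta> x \<otimes>\<^bsub>R\<^esub> \<beta> y"
    and \<alpha>_one: "\<alpha> \<one>\<^bsub>A\<^esub> = \<one>\<^bsub>R\<^esub>" and \<beta>_one: "\<beta> \<one>\<^bsub>B\<^esub> = \<one>\<^bsub>R\<^esub>"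
    and \<delta>_mult: "\<And>a b. a \<in> carrier A \<Longrightarrow> b \<in> carrier B \<Longrightarrow> \<delta> (\<alpha> a \<otimes>\<^bsub>R\<^esub> \<beta> b) = pure_tensor K A B a b"
    and mult_\<delta>: "\<And>q. q \<in> carrier R \<Longrightarrow> sweedler K A B R (\<lambda>a b. \<alpha> a \<otimes>\<^bsub>R\<^esub> \<beta> b) (\<delta> q) = q"
    and \<sigma>_mult: "\<And>a b. a \<in> carrier A \<Longrightarrow> b \<in> carrier B \<Longrightarrow> \<sigma> (\<beta> b \<otimes>\<^bsub>R\<^esub> \<alpha> a) = pure_tensor K B A b a"
    and mult_\<sigma>: "\<And>q. q \<in> carrier R \<Longrightarrow> sweedler K B A R (\<lambda>b a. \<beta> b \<otimes>\<^bsub>R\<^esub> \<alpha> a) (\<sigma> q) = q"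
begin

lemmas [tensor_simps] = algebras linear[THEN linear_closed] linear[THEN linear_app]
  \<alpha>_mult \<beta>_mult \<alpha>_one \<beta>_one \<delta>_mult \<sigma>_mult mult_\<delta> mult_\<sigma>

text \<open>By \<open>mult_\<delta>\<close>, every element of \<open>R\<close> is a sum of products
  of an \<alpha> image with a \<beta> image.\<close>

lemma eqI_AB:
  assumes "module K U" "linear_map K R U f" "linear_map K R U g" "q \<in> carrier R"
    and "\<And>a b. a \<in> carrier A \<Longrightarrow> b \<in> carrier B \<Longrightarrow> f (\<alpha> a \<otimes>\<^bsub>R\<^esub> \<beta> b) = g (\<alpha> a \<otimes>\<^bsub>R\<^esub> \<beta> b)"
  shows "f q = g q"
proof -
  let ?q = "\<lambda>t. sweedler K A B R (\<lambda>a b. \<alpha> a \<otimes>\<^bsub>R\<^esub> \<beta> b) t"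
  have "f (?q (\<delta> q)) = g (?q (\<delta> q))"
    by (rule tensor_eqI[OF _ _ assms(1) linear_app[OF assms(2)] linear_app[OF assms(3)], where V = A and W = B])
      (use assms(4,5) in \<open>simp_all add: tensor_simps\<close>)
  then show ?thesis using assms(4) by (simp add: tensor_simps)
qed

lemma eqI_BA:
  assumes "module K U" "linear_map K R U f" "linear_map K R U g" "q \<in> carrier R"
    and "\<And>a b. a \<in> carrier A \<Longrightarrow> b \<in> carrier B \<Longrightarrow> f (\<beta> b \<otimes>\<^bsub>R\<^esub> \<alpha> a) = g (\<beta> b \<otimes>\<^bsub>R\<^esub> \<alpha> a)"
  shows "f q = g q"
proof -
  let ?q = "\<lambda>t. sweedler K B A R (\<lambda>b a. \<beta> b \<otimes>\<^bsub>R\<^esub> \<alpha> a) t"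
  have "f (?q (\<sigma> q)) = g (?q (\<sigma> q))"
    by (rule tensor_eqI[OF _ _ assms(1) linear_app[OF assms(2)] linear_app[OF assms(3)], where V = B and W = A])
      (use assms(4,5) in \<open>simp_all add: tensor_simps\<close>)
  then show ?thesis using assms(4) by (simp add: tensor_simps)
qed

text \<open>\<delta> inverts the multiplication from \<open>A \<boxtimes> B\<close> to
  \<open>R\<close>, which respects the left action of \<open>A\<close> and the right action of
  \<open>B\<close>; hence so does \<delta>. The mirrored statements for \<sigma> follow
  below.\<close>

lemma \<delta>_\<alpha>_mult [tensor_simps]:
  assumes "a \<in> carrier A" "q \<in> carrier R"
  shows "\<delta> (\<alpha> a \<otimes>\<^bsub>R\<^esub> q) =
    sweedler K A B (A \<boxtimes> B) (\<lambda>a' b. pure_tensor K A B (a \<otimes>\<^bsub>A\<^esub> a') b) (\<delta> q)"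
proof (rule eqI_AB[OF _ _ _ assms(2), where U = "A \<boxtimes> B"])
  fix a' b assume "a' \<in> carrier A" "b \<in> carrier B"
  then show "\<delta> (\<alpha> a \<otimes>\<^bsub>R\<^esub> (\<alpha> a' \<otimes>\<^bsub>R\<^esub> \<beta> b)) =
    sweedler K A B (A \<boxtimes> B) (\<lambda>a' b. pure_tensor K A B (a \<otimes>\<^bsub>A\<^esub> a') b) (\<delta> (\<alpha> a' \<otimes>\<^bsub>R\<^esub> \<beta> b))"
    using assms \<delta>_mult[of "a \<otimes>\<^bsub>A\<^esub> a'" b] by (simp add: tensor_simps)
qed (use assms in \<open>simp_all add: tensor_simps\<close>)

lemma \<delta>_mult_\<beta> [tensor_simps]:
  assumes "b \<in> carrier B" "q \<in> carrier R"
  shows "\<delta> (q \<otimes>\<^bsub>R\<^esub> \<beta> b) =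
    sweedler K A B (A \<boxtimes> B) (\<lambda>a b'. pure_tensor K A B a (b' \<otimes>\<^bsub>B\<^esub> b)) (\<delta> q)"
proof (rule eqI_AB[OF _ _ _ assms(2), where U = "A \<boxtimes> B"])
  fix a b' assume "a \<in> carrier A" "b' \<in> carrier B"
  then show "\<delta> (\<alpha> a \<otimes>\<^bsub>R\<^esub> \<beta> b' \<otimes>\<^bsub>R\<^esub> \<beta> b) =
    sweedler K A B (A \<boxtimes> B) (\<lambda>a b'. pure_tensor K A B a (b' \<otimes>\<^bsub>B\<^esub> b)) (\<delta> (\<alpha> a \<otimes>\<^bsub>R\<^esub> \<beta> b'))"
    using assms \<delta>_mult[of a "b' \<otimes>\<^bsub>B\<^esub> b"] by (simp add: tensor_simps del: \<delta>_\<alpha>_mult)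
qed (use assms in \<open>simp_all add: tensor_simps\<close>)

lemma \<sigma>_\<beta>_mult [tensor_simps]:
  assumes "b \<in> carrier B" "q \<in> carrier R"
  shows "\<sigma> (\<beta> b \<otimes>\<^bsub>R\<^esub> q) =
    sweedler K B A (B \<boxtimes> A) (\<lambda>b' a. pure_tensor K B A (b \<otimes>\<^bsub>B\<^esub> b') a) (\<sigma> q)"
proof (rule eqI_BA[OF _ _ _ assms(2), where U = "B \<boxtimes> A"])
  fix a b' assume "a \<in> carrier A" "b' \<in> carrier B"
  then show "\<sigma> (\<beta> b \<otimes>\<^bsub>R\<^esub> (\<beta> b' \<otimes>\<^bsub>R\<^esub> \<alpha> a)) =
    sweedler K B A (B \<boxtimes> A) (\<lambda>b' a. pure_tensor K B A (b \<otimes>\<^bsub>B\<^esub> b') a) (\<sigma> (\<beta> b' \<otimes>\<^bsub>R\<^esub> \<alpha> a))"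
    using assms \<sigma>_mult[of a "b \<otimes>\<^bsub>B\<^esub> b'"] by (simp add: tensor_simps)
qed (use assms in \<open>simp_all add: tensor_simps\<close>)

lemma \<sigma>_mult_\<alpha> [tensor_simps]:
  assumes "a \<in> carrier A" "q \<in> carrier R"
  shows "\<sigma> (q \<otimes>\<^bsub>R\<^esub> \<alpha> a) =
    sweedler K B A (B \<boxtimes> A) (\<lambda>b a'. pure_tensor K B A b (a' \<otimes>\<^bsub>A\<^esub> a)) (\<sigma> q)"
proof (rule eqI_BA[OF _ _ _ assms(2), where U = "B \<boxtimes> A"])
  fix a' b assume "a' \<in> carrier A" "b \<in> carrier B"
  then show "\<sigma> (\<beta> b \<otimes>\<^bsub>R\<^esub> \<alpha> a' \<otimes>\<^bsub>R\<^esub> \<alpha> a) =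
    sweedler K B A (B \<boxtimes> A) (\<lambda>b a'. pure_tensor K B A b (a' \<otimes>\<^bsub>A\<^esub> a)) (\<sigma> (\<beta> b \<otimes>\<^bsub>R\<^esub> \<alpha> a'))"
    using assms \<sigma>_mult[of "a' \<otimes>\<^bsub>A\<^esub> a" b] by (simp add: tensor_simps del: \<sigma>_\<beta>_mult)
qed (use assms in \<open>simp_all add: tensor_simps\<close>)

text \<open>The universal \<open>B\<close>-balanced map \<open>R \<times> R \<rightarrow> R \<otimes>\<^sub>B R \<cong> A \<otimes> R\<close>.\<close>

definition balB :: "'r \<Rightarrow> 'r \<Rightarrow> ('a \<times> 'r \<Rightarrow> 'k) set" where
  "balB p q = sweedler K A B (A \<boxtimes> R) (\<lambda>a b. pure_tensor K A R a (\<beta> b \<otimes>\<^bsub>R\<^esub> q)) (\<delta> p)"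

text \<open>The universal \<open>A\<close>-balanced map \<open>R \<times> R \<rightarrow> R \<otimes>\<^sub>A R \<cong> R \<otimes> B\<close>, with the first factor
  decomposed as \<open>A \<otimes> B\<close>.\<close>

definition balA :: "'r \<Rightarrow> 'r \<Rightarrow> ('a \<times> ('b \<times> 'b \<Rightarrow> 'k) set \<Rightarrow> 'k) set" where
  "balA p q = sweedler K A B (A \<boxtimes> (B \<boxtimes> B)) (\<lambda>a b.
     sweedler K A B (A \<boxtimes> (B \<boxtimes> B)) (\<lambda>a' b'. pure_tensor K A (B \<boxtimes> B) a' (pure_tensor K B B b' b))
       (\<delta> (p \<otimes>\<^bsub>R\<^esub> \<alpha> a))) (\<delta> q)"

lemma balB_linear [tensor_simps]:
  "linear_map K V R f \<Longrightarrow> q \<in> carrier R \<Longrightarrow> linear_map K V (A \<boxtimes> R) (\<lambda>v. balB (f v) q)"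
  "module K V \<Longrightarrow> linear_map K V R f \<Longrightarrow> q \<in> carrier R \<Longrightarrow> linear_map K V (A \<boxtimes> R) (\<lambda>v. balB q (f v))"
  by (simp_all add: balB_def tensor_simps linear_closed)

lemma balA_linear [tensor_simps]:
  "module K V \<Longrightarrow> linear_map K V R f \<Longrightarrow> q \<in> carrier R \<Longrightarrow> linear_map K V (A \<boxtimes> (B \<boxtimes> B)) (\<lambda>v. balA (f v) q)"
  "linear_map K V R f \<Longrightarrow> q \<in> carrier R \<Longrightarrow> linear_map K V (A \<boxtimes> (B \<boxtimes> B)) (\<lambda>v. balA q (f v))"
  by (simp_all add: balA_def tensor_simps linear_closed)

text \<open>\<delta> is right \<open>B\<close>-linear, so \<open>b\<close> joins the
  \<open>B\<close> component of \<open>p\<close>, which is multiplied onto \<open>q\<close> from the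
  left.\<close>

lemma balB_balanced:
  "p \<in> carrier R \<Longrightarrow> q \<in> carrier R \<Longrightarrow> b \<in> carrier B \<Longrightarrow> balB (p \<otimes>\<^bsub>R\<^esub> \<beta> b) q = balB p (\<beta> b \<otimes>\<^bsub>R\<^esub> q)"
  by (simp add: balB_def tensor_simps)

text \<open>\<delta> is left \<open>A\<close>-linear, so \<open>a\<close> joins the \<open>A\<close>
  component of \<open>q\<close>, which is multiplied onto \<open>p\<close> before \<open>p\<close>
  is decomposed in turn.\<close>

lemma balA_balanced:
  "p \<in> carrier R \<Longrightarrow> q \<in> carrier R \<Longrightarrow> a \<in> carrier A \<Longrightarrow> balA (p \<otimes>\<^bsub>R\<^esub> \<alpha> a) q = balA p (\<alpha> a \<otimes>\<^bsub>R\<^esub> q)"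
  by (simp add: balA_def tensor_simps)

text \<open>Expand \<open>p\<close> by \<delta>, move its \<open>B\<close> components back to the
  first argument by balance, and reassemble \<open>p\<close> by
  \<open>mult_\<delta>\<close>.\<close>

lemma balB_universal:
  assumes U: "module K U" and g: "bilinear_map K R R U g" and pq: "p \<in> carrier R" "q \<in> carrier R"
    and bal: "\<And>p q b. p \<in> carrier R \<Longrightarrow> q \<in> carrier R \<Longrightarrow> b \<in> carrier B \<Longrightarrow> g (p \<otimes>\<^bsub>R\<^esub> \<beta> b) q = g p (\<beta> b \<otimes>\<^bsub>R\<^esub> q)"
  shows "sweedler K A R U (\<lambda>a r. g (\<alpha> a) r) (balB p q) = g p q"
proof -
  \<comment> \<open>Bilinearity of \<open>g\<close> in composed form, as the rewriting of linearity
    goals requires.\<close>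
  have gl: "linear_map K V U (\<lambda>v. g (f v) r)" "linear_map K V U (\<lambda>v. g r (f v))"
    if "linear_map K V R f" "r \<in> carrier R" for V :: "('k,'v) module" and f r
    using g that by (auto simp: bilinear_map_def intro: linear_app[OF _ that(1)])
  have "sweedler K A R U (\<lambda>a r. g (\<alpha> a) r) (balB p q) =
      sweedler K A B U (\<lambda>a b. g (\<alpha> a) (\<beta> b \<otimes>\<^bsub>R\<^esub> q)) (\<delta> p)"
    using U pq by (simp add: balB_def tensor_simps gl)
  also have "\<dots> = sweedler K A B U (\<lambda>a b. g (\<alpha> a \<otimes>\<^bsub>R\<^esub> \<beta> b) q) (\<delta> p)"
    using pq by (simp add: bal tensor_simps)
  also have "\<dots> = g (sweedler K A B R (\<lambda>a b. \<alpha> a \<otimes>\<^bsub>R\<^esub> \<beta> b) (\<delta> p)) q"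
    by (rule sweedler_push[symmetric, where g = "\<lambda>r. g r q"]) (use U pq in \<open>simp_all add: tensor_simps gl\<close>)
  finally show ?thesis using pq by (simp add: tensor_simps)
qed

text \<open>Two decompositions are undone: \<open>*\<close> reassembles the left argument, balance
  returns the \<open>A\<close> component of \<open>q\<close> to the right, and then \<open>q\<close>
  is reassembled.\<close>

lemma balA_universal:
  assumes U: "module K U" and g: "bilinear_map K R R U g" and pq: "p \<in> carrier R" "q \<in> carrier R"
    and bal: "\<And>p q a. p \<in> carrier R \<Longrightarrow> q \<in> carrier R \<Longrightarrow> a \<in> carrier A \<Longrightarrow> g (p \<otimes>\<^bsub>R\<^esub> \<alpha> a) q = g p (\<alpha> a \<otimes>\<^bsub>R\<^esub> q)"
  shows "sweedler K A (B \<boxtimes> B) U (\<lambda>a. sweedler K B B U (\<lambda>b b'. g (\<alpha> a \<otimes>\<^bsub>R\<^esub> \<beta> b) (\<beta> b'))) (balA p q) = g p q"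
proof -
  have gl: "linear_map K V U (\<lambda>v. g (f v) r)" "linear_map K V U (\<lambda>v. g r (f v))"
    if "linear_map K V R f" "r \<in> carrier R" for V :: "('k,'v) module" and f r
    using g that by (auto simp: bilinear_map_def intro: linear_app[OF _ that(1)])
  have *: "sweedler K A B U (\<lambda>a b. g (\<alpha> a \<otimes>\<^bsub>R\<^esub> \<beta> b) r) (\<delta> p) = g p r"
    if "p \<in> carrier R" "r \<in> carrier R" for p r
  proof -
    have "sweedler K A B U (\<lambda>a b. g (\<alpha> a \<otimes>\<^bsub>R\<^esub> \<beta> b) r) (\<delta> p) =
        g (sweedler K A B R (\<lambda>a b. \<alpha> a \<otimes>\<^bsub>R\<^esub> \<beta> b) (\<delta> p)) r"
      by (rule sweedler_push[symmetric, where g = "\<lambda>s. g s r"]) (use U that in \<open>simp_all add: tensor_simps gl\<close>)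
    then show ?thesis using that by (simp add: tensor_simps)
  qed
  have "sweedler K A (B \<boxtimes> B) U (\<lambda>a. sweedler K B B U (\<lambda>b b'. g (\<alpha> a \<otimes>\<^bsub>R\<^esub> \<beta> b) (\<beta> b'))) (balA p q) =
      sweedler K A B U (\<lambda>a b. sweedler K A B U (\<lambda>a' b'. g (\<alpha> a' \<otimes>\<^bsub>R\<^esub> \<beta> b') (\<beta> b)) (\<delta> (p \<otimes>\<^bsub>R\<^esub> \<alpha> a))) (\<delta> q)"
    using U pq by (simp add: balA_def tensor_simps gl)
  also have "\<dots> = sweedler K A B U (\<lambda>a b. g p (\<alpha> a \<otimes>\<^bsub>R\<^esub> \<beta> b)) (\<delta> q)"
    using pq by (simp add: * bal tensor_simps del: \<delta>_mult_\<beta>)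
  also have "\<dots> = g p (sweedler K A B R (\<lambda>a b. \<alpha> a \<otimes>\<^bsub>R\<^esub> \<beta> b) (\<delta> q))"
    by (rule sweedler_push[symmetric, where g = "\<lambda>r. g p r"]) (use U pq in \<open>simp_all add: tensor_simps gl\<close>)
  finally show ?thesis using pq by (simp add: tensor_simps)
qed

end

section \<open>Factorizations into two separable algebras, and central idempotents\<close>

locale separable_factorization = algebra_factorization K A B R \<alpha> \<beta> \<delta> \<sigma>
  for K :: "('k, 'm) ring_scheme" (structure)
    and A :: "('k, 'a) module" and B :: "('k, 'b) module" and R :: "('k, 'r) module"
    and \<alpha> \<beta> \<delta> \<sigma> +
  fixes \<Gamma>A :: "'a \<Rightarrow> ('a \<times> 'a \<Rightarrow> 'k) set" and \<Gamma>B :: "'b \<Rightarrow> ('b \<times> 'b \<Rightarrow> 'k) set"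
  assumes bimodule: "bimodule_right_inverse K A \<Gamma>A" "bimodule_right_inverse K B \<Gamma>B"
begin

lemmas \<Gamma>_linear = bimodule_linear[OF algebras(1) bimodule(1)] bimodule_linear[OF algebras(2) bimodule(2)]
lemmas [tensor_simps] = \<Gamma>_linear[THEN linear_closed] \<Gamma>_linear[THEN linear_app]
  bimodule_mult[OF algebras(1) bimodule(1)] bimodule_mult[OF algebras(2) bimodule(2)]

abbreviation "sumA U h a \<equiv> sweedler K A A U h (\<Gamma>A a)"
abbreviation "sumB U h b \<equiv> sweedler K B B U h (\<Gamma>B b)"

text \<open>With \<open>e = \<Gamma>A 1\<close>, the bimodule property gives
  \<open>a e = \<Gamma>A a = e a\<close>. This is how elements of \<open>A\<close> cross
  \<open>e\<close>.\<close>

lemma sumA_one: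
  assumes "module K U" "bilinear_map K A A U h" "a \<in> carrier A"
  shows "sumA U (\<lambda>x y. h (a \<otimes>\<^bsub>A\<^esub> x) y) \<one>\<^bsub>A\<^esub> = sumA U h a"
    "sumA U (\<lambda>x y. h x (y \<otimes>\<^bsub>A\<^esub> a)) \<one>\<^bsub>A\<^esub> = sumA U h a"
  using sweedler_bimodule_left[OF algebras(1) bimodule(1) assms, of "\<one>\<^bsub>A\<^esub>"]
    sweedler_bimodule_right[OF algebras(1) bimodule(1) assms, of "\<one>\<^bsub>A\<^esub>"] assms
  by (simp_all add: algebras algebra_one_mult algebra_one_closed)

lemma sumB_one:
  assumes "module K U" "bilinear_map K B B U h" "b \<in> carrier B"
  shows "sumB U (\<lambda>u v. h (b \<otimes>\<^bsub>B\<^esub> u) v) \<one>\<^bsub>B\<^esub> = sumB U h b"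
    "sumB U (\<lambda>u v. h u (v \<otimes>\<^bsub>B\<^esub> b)) \<one>\<^bsub>B\<^esub> = sumB U h b"
  using sweedler_bimodule_left[OF algebras(2) bimodule(2) assms, of "\<one>\<^bsub>B\<^esub>"]
    sweedler_bimodule_right[OF algebras(2) bimodule(2) assms, of "\<one>\<^bsub>B\<^esub>"] assms
  by (simp_all add: algebras algebra_one_mult algebra_one_closed)

lemma sumA_mult: "a \<in> carrier A \<Longrightarrow> sumA R (\<lambda>x y. \<alpha> x \<otimes>\<^bsub>R\<^esub> \<alpha> y) a = \<alpha> a"
  using sweedler_push[OF _ _ _ _ linear(1), of A A "\<lambda>x y. x \<otimes>\<^bsub>A\<^esub> y" "\<Gamma>A a"]
  by (simp add: tensor_simps)

lemma sumB_mult: "b \<in> carrier B \<Longrightarrow> sumB R (\<lambda>u v. \<beta> u \<otimes>\<^bsub>R\<^esub> \<beta> v) b = \<beta> b"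
  using sweedler_push[OF _ _ _ _ linear(2), of B B "\<lambda>x y. x \<otimes>\<^bsub>B\<^esub> y" "\<Gamma>B b"]
  by (simp add: tensor_simps)

text \<open>
  With \<open>e = \<Gamma>A 1\<close> and \<open>f = \<Gamma>B 1\<close>: \<open>b e = e b\<close> in \<open>R \<otimes>\<^sub>B R\<close>, respectively \<open>f a = a f\<close> in \<open>R \<otimes>\<^sub>A R\<close>.
\<close>

definition centralA :: bool where
  "centralA \<longleftrightarrow> (\<forall>b\<in>carrier B. sumA (A \<boxtimes> R) (\<lambda>x y. balB (\<beta> b \<otimes>\<^bsub>R\<^esub> \<alpha> x) (\<alpha> y)) \<one>\<^bsub>A\<^esub> =
     sumA (A \<boxtimes> R) (\<lambda>x y. balB (\<alpha> x) (\<alpha> y \<otimes>\<^bsub>R\<^esub> \<beta> b)) \<one>\<^bsub>A\<^esub>)"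

definition centralB :: bool where
  "centralB \<longleftrightarrow> (\<forall>a\<in>carrier A. sumB (A \<boxtimes> (B \<boxtimes> B)) (\<lambda>u v. balA (\<beta> u) (\<beta> v \<otimes>\<^bsub>R\<^esub> \<alpha> a)) \<one>\<^bsub>B\<^esub> =
     sumB (A \<boxtimes> (B \<boxtimes> B)) (\<lambda>u v. balA (\<alpha> a \<otimes>\<^bsub>R\<^esub> \<beta> u) (\<beta> v)) \<one>\<^bsub>B\<^esub>)"

text \<open>Centrality is an equation in the target of the universal balanced map; the linear map
  induced by \<open>g\<close> carries it to \<open>U\<close>.\<close>

lemma centralA_universal:
  assumes U: "module K U" and g: "bilinear_map K R R U g" and b: "b \<in> carrier B"
    and bal: "\<And>p q b. p \<in> carrier R \<Longrightarrow> q \<in> carrier R \<Longrightarrow> b \<in> carrier B \<Longrightarrow> g (p \<otimes>\<^bsub>R\<^esub> \<beta> b) q = g p (\<beta> b \<otimes>\<^bsub>R\<^esub> q)"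
    and central: centralA
  shows "sumA U (\<lambda>x y. g (\<beta> b \<otimes>\<^bsub>R\<^esub> \<alpha> x) (\<alpha> y)) \<one>\<^bsub>A\<^esub> = sumA U (\<lambda>x y. g (\<alpha> x) (\<alpha> y \<otimes>\<^bsub>R\<^esub> \<beta> b)) \<one>\<^bsub>A\<^esub>"
proof -
  have gl: "linear_map K V U (\<lambda>v. g (f v) r)" "linear_map K V U (\<lambda>v. g r (f v))"
    if "linear_map K V R f" "r \<in> carrier R" for V :: "('k,'v) module" and f r
    using g that by (auto simp: bilinear_map_def intro: linear_app[OF _ that(1)])
  let ?G = "sweedler K A R U (\<lambda>a r. g (\<alpha> a) r)"
  have "?G (sumA (A \<boxtimes> R) (\<lambda>x y. balB (\<beta> b \<otimes>\<^bsub>R\<^esub> \<alpha> x) (\<alpha> y)) \<one>\<^bsub>A\<^esub>) =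
      ?G (sumA (A \<boxtimes> R) (\<lambda>x y. balB (\<alpha> x) (\<alpha> y \<otimes>\<^bsub>R\<^esub> \<beta> b)) \<one>\<^bsub>A\<^esub>)"
    using central b by (simp add: centralA_def)
  then show ?thesis
    using U b by (simp add: tensor_simps gl balB_universal[OF U g] bal)
qed

lemma centralB_universal:
  assumes U: "module K U" and g: "bilinear_map K R R U g" and a: "a \<in> carrier A"
    and bal: "\<And>p q a. p \<in> carrier R \<Longrightarrow> q \<in> carrier R \<Longrightarrow> a \<in> carrier A \<Longrightarrow> g (p \<otimes>\<^bsub>R\<^esub> \<alpha> a) q = g p (\<alpha> a \<otimes>\<^bsub>R\<^esub> q)"
    and central: centralB
  shows "sumB U (\<lambda>u v. g (\<beta> u) (\<beta> v \<otimes>\<^bsub>R\<^esub> \<alpha> a)) \<one>\<^bsub>B\<^esub> = sumB U (\<lambda>u v. g (\<alpha> a \<otimes>\<^bsub>R\<^esub> \<beta> u) (\<beta> v)) \<one>\<^bsub>B\<^esub>"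
proof -
  have gl: "linear_map K V U (\<lambda>v. g (f v) r)" "linear_map K V U (\<lambda>v. g r (f v))"
    if "linear_map K V R f" "r \<in> carrier R" for V :: "('k,'v) module" and f r
    using g that by (auto simp: bilinear_map_def intro: linear_app[OF _ that(1)])
  let ?G = "sweedler K A (B \<boxtimes> B) U (\<lambda>a. sweedler K B B U (\<lambda>b b'. g (\<alpha> a \<otimes>\<^bsub>R\<^esub> \<beta> b) (\<beta> b')))"
  have "?G (sumB (A \<boxtimes> (B \<boxtimes> B)) (\<lambda>u v. balA (\<beta> u) (\<beta> v \<otimes>\<^bsub>R\<^esub> \<alpha> a)) \<one>\<^bsub>B\<^esub>) =
      ?G (sumB (A \<boxtimes> (B \<boxtimes> B)) (\<lambda>u v. balA (\<alpha> a \<otimes>\<^bsub>R\<^esub> \<beta> u) (\<beta> v)) \<one>\<^bsub>B\<^esub>)"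
    using central a by (simp add: centralB_def)
  then show ?thesis
    using U a by (simp add: tensor_simps gl balA_universal[OF U g] bal)
qed

text \<open>The right side is the first identity transported to
  \<open>R \<otimes>\<^sub>B R\<close>; its case \<open>a = 1\<close> is centrality. Conversely,
  centrality computes \<open>p e\<close> for every \<open>p\<close> in \<open>R\<close>, and
  \<open>p = \<beta> b \<alpha> a\<close> gives the identity.\<close>

lemma centralA_iff:
  "centralA \<longleftrightarrow> (\<forall>a\<in>carrier A. \<forall>b\<in>carrier B.
     sweedler K A B (A \<boxtimes> R) (\<lambda>a' b'. sumA (A \<boxtimes> R) (\<lambda>x y. balB (\<alpha> x) (\<alpha> y \<otimes>\<^bsub>R\<^esub> \<beta> b')) a') (\<delta> (\<beta> b \<otimes>\<^bsub>R\<^esub> \<alpha> a)) =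
     sumA (A \<boxtimes> R) (\<lambda>x y. balB (\<beta> b \<otimes>\<^bsub>R\<^esub> \<alpha> x) (\<alpha> y)) a)"
    (is "_ \<longleftrightarrow> ?r")
proof
  assume c: centralA
  \<comment> \<open>\<open>?L\<close> applies \<open>\<Gamma>A\<close> to the \<open>A\<close>
    component of \<open>p\<close> and puts the \<open>B\<close> component on the right;
    \<open>?M p\<close> is \<open>p e\<close>.\<close>
  let ?L = "\<lambda>p. sweedler K A B (A \<boxtimes> R) (\<lambda>a' b'. sumA (A \<boxtimes> R) (\<lambda>x y. balB (\<alpha> x) (\<alpha> y \<otimes>\<^bsub>R\<^esub> \<beta> b')) a') (\<delta> p)"
  let ?M = "\<lambda>p. sumA (A \<boxtimes> R) (\<lambda>x y. balB (p \<otimes>\<^bsub>R\<^esub> \<alpha> x) (\<alpha> y)) \<one>\<^bsub>A\<^esub>"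
  have LM: "?L p = ?M p" if p: "p \<in> carrier R" for p
  proof (rule eqI_AB[OF _ _ _ p, where U = "A \<boxtimes> R"])
    fix a b assume [simp]: "a \<in> carrier A" "b \<in> carrier B"
    \<comment> \<open>Centrality turns \<open>\<alpha> a \<beta> b e\<close> into
      \<open>\<alpha> a e \<beta> b\<close>, and \<open>a e\<close> is
      \<open>\<Gamma>A a\<close>.\<close>
    have "?M (\<alpha> a \<otimes>\<^bsub>R\<^esub> \<beta> b) = sumA (A \<boxtimes> R) (\<lambda>x y. balB (\<alpha> a \<otimes>\<^bsub>R\<^esub> (\<beta> b \<otimes>\<^bsub>R\<^esub> \<alpha> x)) (\<alpha> y)) \<one>\<^bsub>A\<^esub>"
      by (simp add: tensor_simps)
    also have "\<dots> = sumA (A \<boxtimes> R) (\<lambda>x y. balB (\<alpha> a \<otimes>\<^bsub>R\<^esub> \<alpha> x) (\<alpha> y \<otimes>\<^bsub>R\<^esub> \<beta> b)) \<one>\<^bsub>A\<^esub>"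
      by (rule centralA_universal[where g = "\<lambda>p q. balB (\<alpha> a \<otimes>\<^bsub>R\<^esub> p) q"])
        (simp_all add: tensor_simps c balB_balanced[symmetric])
    also have "\<dots> = sumA (A \<boxtimes> R) (\<lambda>x y. balB (\<alpha> x) (\<alpha> y \<otimes>\<^bsub>R\<^esub> \<beta> b)) a"
      by (subst sumA_one(1)[symmetric]) (simp_all add: tensor_simps)
    finally show "?L (\<alpha> a \<otimes>\<^bsub>R\<^esub> \<beta> b) = ?M (\<alpha> a \<otimes>\<^bsub>R\<^esub> \<beta> b)"
      by (simp add: tensor_simps del: \<delta>_\<alpha>_mult \<delta>_mult_\<beta>)
  qed (simp_all add: tensor_simps)
  show ?r
  proof (intro ballI)
    fix a b assume [simp]: "a \<in> carrier A" "b \<in> carrier B"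
    \<comment> \<open>Here \<open>e\<close> absorbs \<open>a\<close>, which leaves \<beta> b acting
      on \<open>\<Gamma>A a\<close>.\<close>
    have "?M (\<beta> b \<otimes>\<^bsub>R\<^esub> \<alpha> a) = sumA (A \<boxtimes> R) (\<lambda>x y. balB (\<beta> b \<otimes>\<^bsub>R\<^esub> \<alpha> (a \<otimes>\<^bsub>A\<^esub> x)) (\<alpha> y)) \<one>\<^bsub>A\<^esub>"
      by (simp add: tensor_simps)
    also have "\<dots> = sumA (A \<boxtimes> R) (\<lambda>x y. balB (\<beta> b \<otimes>\<^bsub>R\<^esub> \<alpha> x) (\<alpha> y)) a"
      by (rule sumA_one(1)) (simp_all add: tensor_simps)
    finally show "?L (\<beta> b \<otimes>\<^bsub>R\<^esub> \<alpha> a) = sumA (A \<boxtimes> R) (\<lambda>x y. balB (\<beta> b \<otimes>\<^bsub>R\<^esub> \<alpha> x) (\<alpha> y)) a"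
      by (subst LM) (simp_all add: tensor_simps)
  qed
next
  assume r: ?r
  show centralA unfolding centralA_def
  proof
    fix b assume b: "b \<in> carrier B"
    \<comment> \<open>At \<open>a = 1\<close> the product is \<beta> b, whose decomposition is the
      single term \<open>1 \<otimes> b\<close>.\<close>
    then have "\<delta> (\<beta> b \<otimes>\<^bsub>R\<^esub> \<alpha> \<one>\<^bsub>A\<^esub>) = pure_tensor K A B \<one>\<^bsub>A\<^esub> b"
      using \<delta>_mult[of "\<one>\<^bsub>A\<^esub>" b] by (simp add: tensor_simps del: \<delta>_\<alpha>_mult \<delta>_mult_\<beta>)
    then show "sumA (A \<boxtimes> R) (\<lambda>x y. balB (\<beta> b \<otimes>\<^bsub>R\<^esub> \<alpha> x) (\<alpha> y)) \<one>\<^bsub>A\<^esub> =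
        sumA (A \<boxtimes> R) (\<lambda>x y. balB (\<alpha> x) (\<alpha> y \<otimes>\<^bsub>R\<^esub> \<beta> b)) \<one>\<^bsub>A\<^esub>"
      using r[rule_format, of "\<one>\<^bsub>A\<^esub>" b] b by (simp add: tensor_simps del: \<alpha>_one)
  qed
qed

text \<open>The mirror image, with \<open>f p\<close> in place of \<open>p e\<close>: centrality
  moves \<alpha> a to the left of \<open>f\<close>, and \<open>f\<close> absorbs \<beta> b from the
  right to become \<open>\<Gamma>B b\<close>.\<close>

lemma centralB_iff:
  "centralB \<longleftrightarrow> (\<forall>a\<in>carrier A. \<forall>b\<in>carrier B.
     sweedler K A B (A \<boxtimes> (B \<boxtimes> B)) (\<lambda>a' b'. sumB (A \<boxtimes> (B \<boxtimes> B)) (\<lambda>u v. balA (\<alpha> a' \<otimes>\<^bsub>R\<^esub> \<beta> u) (\<beta> v)) b') (\<delta> (\<beta> b \<otimes>\<^bsub>R\<^esub> \<alpha> a)) =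
     sumB (A \<boxtimes> (B \<boxtimes> B)) (\<lambda>u v. balA (\<beta> u) (\<beta> v \<otimes>\<^bsub>R\<^esub> \<alpha> a)) b)"
    (is "_ \<longleftrightarrow> ?r")
proof
  assume c: centralB
  let ?L = "\<lambda>p. sweedler K A B (A \<boxtimes> (B \<boxtimes> B)) (\<lambda>a' b'. sumB (A \<boxtimes> (B \<boxtimes> B)) (\<lambda>u v. balA (\<alpha> a' \<otimes>\<^bsub>R\<^esub> \<beta> u) (\<beta> v)) b') (\<delta> p)"
  let ?M = "\<lambda>p. sumB (A \<boxtimes> (B \<boxtimes> B)) (\<lambda>u v. balA (\<beta> u) (\<beta> v \<otimes>\<^bsub>R\<^esub> p)) \<one>\<^bsub>B\<^esub>"
  have LM: "?L p = ?M p" if p: "p \<in> carrier R" for p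
  proof (rule eqI_AB[OF _ _ _ p, where U = "A \<boxtimes> (B \<boxtimes> B)"])
    fix a b assume [simp]: "a \<in> carrier A" "b \<in> carrier B"
    have "?M (\<alpha> a \<otimes>\<^bsub>R\<^esub> \<beta> b) = sumB (A \<boxtimes> (B \<boxtimes> B)) (\<lambda>u v. balA (\<beta> u) (\<beta> v \<otimes>\<^bsub>R\<^esub> \<alpha> a \<otimes>\<^bsub>R\<^esub> \<beta> b)) \<one>\<^bsub>B\<^esub>"
      by (simp add: tensor_simps)
    also have "\<dots> = sumB (A \<boxtimes> (B \<boxtimes> B)) (\<lambda>u v. balA (\<alpha> a \<otimes>\<^bsub>R\<^esub> \<beta> u) (\<beta> v \<otimes>\<^bsub>R\<^esub> \<beta> b)) \<one>\<^bsub>B\<^esub>"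
      by (rule centralB_universal[where g = "\<lambda>p q. balA p (q \<otimes>\<^bsub>R\<^esub> \<beta> b)"])
        (simp_all add: tensor_simps c balA_balanced)
    also have "\<dots> = sumB (A \<boxtimes> (B \<boxtimes> B)) (\<lambda>u v. balA (\<alpha> a \<otimes>\<^bsub>R\<^esub> \<beta> u) (\<beta> v)) b"
      by (subst sumB_one(2)[symmetric]) (simp_all add: tensor_simps)
    finally show "?L (\<alpha> a \<otimes>\<^bsub>R\<^esub> \<beta> b) = ?M (\<alpha> a \<otimes>\<^bsub>R\<^esub> \<beta> b)"
      by (simp add: tensor_simps del: \<delta>_\<alpha>_mult \<delta>_mult_\<beta>)
  qed (simp_all add: tensor_simps)
  show ?r
  proof (intro ballI)
    fix a b assume [simp]: "a \<in> carrier A" "b \<in> carrier B"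
    have "?M (\<beta> b \<otimes>\<^bsub>R\<^esub> \<alpha> a) = sumB (A \<boxtimes> (B \<boxtimes> B)) (\<lambda>u v. balA (\<beta> u) (\<beta> (v \<otimes>\<^bsub>B\<^esub> b) \<otimes>\<^bsub>R\<^esub> \<alpha> a)) \<one>\<^bsub>B\<^esub>"
      by (simp add: tensor_simps)
    also have "\<dots> = sumB (A \<boxtimes> (B \<boxtimes> B)) (\<lambda>u v. balA (\<beta> u) (\<beta> v \<otimes>\<^bsub>R\<^esub> \<alpha> a)) b"
      by (rule sumB_one(2)) (simp_all add: tensor_simps)
    finally show "?L (\<beta> b \<otimes>\<^bsub>R\<^esub> \<alpha> a) = sumB (A \<boxtimes> (B \<boxtimes> B)) (\<lambda>u v. balA (\<beta> u) (\<beta> v \<otimes>\<^bsub>R\<^esub> \<alpha> a)) b"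
      by (subst LM) (simp_all add: tensor_simps)
  qed
next
  assume r: ?r
  show centralB unfolding centralB_def
  proof
    fix a assume a: "a \<in> carrier A"
    then have "\<delta> (\<beta> \<one>\<^bsub>B\<^esub> \<otimes>\<^bsub>R\<^esub> \<alpha> a) = pure_tensor K A B a \<one>\<^bsub>B\<^esub>"
      using \<delta>_mult[of a "\<one>\<^bsub>B\<^esub>"] by (simp add: tensor_simps del: \<delta>_\<alpha>_mult \<delta>_mult_\<beta>)
    then show "sumB (A \<boxtimes> (B \<boxtimes> B)) (\<lambda>u v. balA (\<beta> u) (\<beta> v \<otimes>\<^bsub>R\<^esub> \<alpha> a)) \<one>\<^bsub>B\<^esub> =
        sumB (A \<boxtimes> (B \<boxtimes> B)) (\<lambda>u v. balA (\<alpha> a \<otimes>\<^bsub>R\<^esub> \<beta> u) (\<beta> v)) \<one>\<^bsub>B\<^esub>"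
      using r[rule_format, of a "\<one>\<^bsub>B\<^esub>"] a by (simp add: tensor_simps del: \<beta>_one)
  qed
qed

end

section \<open>The candidate separability idempotent\<close>

context separable_factorization
begin

text \<open>The image of \<open>p \<otimes> q \<otimes> s\<close> under \<open>R \<otimes>\<^sub>B R \<otimes>\<^sub>A R \<cong> R \<otimes> R\<close>.\<close>

definition \<Psi> :: "'r \<Rightarrow> 'r \<Rightarrow> 'r \<Rightarrow> ('r \<times> 'r \<Rightarrow> 'k) set" where
  "\<Psi> p q s = sweedler K B A (R \<boxtimes> R)
     (\<lambda>u a. pure_tensor K R R (p \<otimes>\<^bsub>R\<^esub> \<beta> u) (\<alpha> a \<otimes>\<^bsub>R\<^esub> s)) (\<sigma> q)"

lemma \<Psi>_linear [tensor_simps]: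
  "module K V \<Longrightarrow> linear_map K V R f \<Longrightarrow> q \<in> carrier R \<Longrightarrow> s \<in> carrier R \<Longrightarrow>
    linear_map K V (R \<boxtimes> R) (\<lambda>v. \<Psi> (f v) q s)"
  "linear_map K V R f \<Longrightarrow> p \<in> carrier R \<Longrightarrow> s \<in> carrier R \<Longrightarrow>
    linear_map K V (R \<boxtimes> R) (\<lambda>v. \<Psi> p (f v) s)"
  "module K V \<Longrightarrow> linear_map K V R f \<Longrightarrow> p \<in> carrier R \<Longrightarrow> q \<in> carrier R \<Longrightarrow>
    linear_map K V (R \<boxtimes> R) (\<lambda>v. \<Psi> p q (f v))"
  by (simp_all add: \<Psi>_def tensor_simps linear_closed)

text \<open>\<sigma> is left \<open>B\<close>-linear and right \<open>A\<close>-linear, so a factor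
  entering the middle from either side is passed on to the neighbouring outer factor.\<close>

lemma \<Psi>_balanced:
  "p \<in> carrier R \<Longrightarrow> q \<in> carrier R \<Longrightarrow> s \<in> carrier R \<Longrightarrow> b \<in> carrier B \<Longrightarrow>
    \<Psi> (p \<otimes>\<^bsub>R\<^esub> \<beta> b) q s = \<Psi> p (\<beta> b \<otimes>\<^bsub>R\<^esub> q) s"
  "p \<in> carrier R \<Longrightarrow> q \<in> carrier R \<Longrightarrow> s \<in> carrier R \<Longrightarrow> a \<in> carrier A \<Longrightarrow>
    \<Psi> p (q \<otimes>\<^bsub>R\<^esub> \<alpha> a) s = \<Psi> p q (\<alpha> a \<otimes>\<^bsub>R\<^esub> s)"
  by (simp_all add: \<Psi>_def tensor_simps)

lemma sweedler_\<Psi>: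
  assumes U: "module K U" and h: "bilinear_map K R R U h"
    and pqs: "p \<in> carrier R" "q \<in> carrier R" "s \<in> carrier R"
  shows "sweedler K R R U h (\<Psi> p q s) =
    sweedler K B A U (\<lambda>u a. h (p \<otimes>\<^bsub>R\<^esub> \<beta> u) (\<alpha> a \<otimes>\<^bsub>R\<^esub> s)) (\<sigma> q)"
proof -
  have "linear_map K R U (h r)" "linear_map K R U (\<lambda>q. h q r)" if "r \<in> carrier R" for r
    using h that by (simp_all add: bilinear_map_def)
  then show ?thesis using U pqs by (simp add: \<Psi>_def tensor_simps)
qed

text \<open>
  \<open>Z p s\<close> is \<open>p z s\<close> for the idempotent candidate \<open>z = \<Sum> e' \<otimes> e'' f' \<otimes> f''\<close>.
\<close>

definition Z :: "'r \<Rightarrow> 'r \<Rightarrow> ('r \<times> 'r \<Rightarrow> 'k) set" where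
  "Z p s = sumA (R \<boxtimes> R) (\<lambda>x y. sumB (R \<boxtimes> R)
     (\<lambda>u v. \<Psi> (p \<otimes>\<^bsub>R\<^esub> \<alpha> x) (\<alpha> y \<otimes>\<^bsub>R\<^esub> \<beta> u) (\<beta> v \<otimes>\<^bsub>R\<^esub> s)) \<one>\<^bsub>B\<^esub>) \<one>\<^bsub>A\<^esub>"

lemma Z_linear [tensor_simps]:
  "module K V \<Longrightarrow> linear_map K V R f \<Longrightarrow> s \<in> carrier R \<Longrightarrow> linear_map K V (R \<boxtimes> R) (\<lambda>v. Z (f v) s)"
  "module K V \<Longrightarrow> linear_map K V R f \<Longrightarrow> p \<in> carrier R \<Longrightarrow> linear_map K V (R \<boxtimes> R) (\<lambda>v. Z p (f v))"
  by (simp_all add: Z_def tensor_simps linear_closed)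

text \<open>The outer action reaches only the first and last arguments of \<Psi>, which hold
  \<open>p\<close> and \<open>s\<close>.\<close>

lemma Z_act:
  assumes "p \<in> carrier R" "s \<in> carrier R" "x \<in> carrier R" "z \<in> carrier R"
  shows "sweedler K R R (R \<boxtimes> R) (\<lambda>q r. pure_tensor K R R (x \<otimes>\<^bsub>R\<^esub> q) (r \<otimes>\<^bsub>R\<^esub> z)) (Z p s) =
    Z (x \<otimes>\<^bsub>R\<^esub> p) (s \<otimes>\<^bsub>R\<^esub> z)"
proof -
  have "sweedler K R R (R \<boxtimes> R) (\<lambda>q r. pure_tensor K R R (x \<otimes>\<^bsub>R\<^esub> q) (r \<otimes>\<^bsub>R\<^esub> z)) (\<Psi> p' q' s') =
      \<Psi> (x \<otimes>\<^bsub>R\<^esub> p') q' (s' \<otimes>\<^bsub>R\<^esub> z)" if "p' \<in> carrier R" "q' \<in> carrier R" "s' \<in> carrier R" for p' q' s'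
    using that assms by (simp add: \<Psi>_def tensor_simps)
  then show ?thesis using assms by (simp add: Z_def tensor_simps)
qed

text \<open>\<open>a e\<close> is \<open>\<Gamma>A a\<close> and \<open>f b\<close> is
  \<open>\<Gamma>B b\<close>. The right side is the value that the candidate splitting takes at
  \<open>\<alpha> a \<beta> b\<close>.\<close>

lemma Z_mult:
  assumes "a \<in> carrier A" "b \<in> carrier B"
  shows "Z (\<alpha> a) (\<beta> b) =
    sumA (R \<boxtimes> R) (\<lambda>x y. sumB (R \<boxtimes> R) (\<lambda>u v. \<Psi> (\<alpha> x) (\<alpha> y \<otimes>\<^bsub>R\<^esub> \<beta> u) (\<beta> v)) b) a"
proof -
  note [simp] = assms
  have 1: "sumB (R \<boxtimes> R) (\<lambda>u v. \<Psi> x (\<alpha> y \<otimes>\<^bsub>R\<^esub> \<beta> u) (\<beta> v)) b =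
    sumB (R \<boxtimes> R) (\<lambda>u v. \<Psi> x (\<alpha> y \<otimes>\<^bsub>R\<^esub> \<beta> u) (\<beta> v \<otimes>\<^bsub>R\<^esub> \<beta> b)) \<one>\<^bsub>B\<^esub>"
    if "x \<in> carrier R" "y \<in> carrier A" for x y
    by (subst sumB_one(2)[symmetric]) (use that in \<open>simp_all add: tensor_simps\<close>)
  have "sumA (R \<boxtimes> R) (\<lambda>x y. sumB (R \<boxtimes> R) (\<lambda>u v. \<Psi> (\<alpha> x) (\<alpha> y \<otimes>\<^bsub>R\<^esub> \<beta> u) (\<beta> v)) b) a =
      sumA (R \<boxtimes> R) (\<lambda>x y. sumB (R \<boxtimes> R) (\<lambda>u v. \<Psi> (\<alpha> (a \<otimes>\<^bsub>A\<^esub> x)) (\<alpha> y \<otimes>\<^bsub>R\<^esub> \<beta> u) (\<beta> v)) b) \<one>\<^bsub>A\<^esub>"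
    by (rule sumA_one(1)[symmetric]) (simp_all add: tensor_simps)
  also have "\<dots> = Z (\<alpha> a) (\<beta> b)"
    using 1 by (simp add: Z_def tensor_simps)
  finally show ?thesis ..
qed

text \<open>\<beta> b first crosses \<open>e\<close> by centrality and lands in the middle factor;
  it then crosses \<open>f\<close> because \<open>\<Gamma>B\<close> is a bimodule map.\<close>

lemma Z_moveB:
  assumes centralA "p \<in> carrier R" "s \<in> carrier R" "b \<in> carrier B"
  shows "Z (p \<otimes>\<^bsub>R\<^esub> \<beta> b) s = Z p (\<beta> b \<otimes>\<^bsub>R\<^esub> s)"
proof -
  note [simp] = assms(2-4)
  let ?g = "\<lambda>q r. sumB (R \<boxtimes> R) (\<lambda>u v. \<Psi> (p \<otimes>\<^bsub>R\<^esub> q) (r \<otimes>\<^bsub>R\<^esub> \<beta> u) (\<beta> v \<otimes>\<^bsub>R\<^esub> s)) \<one>\<^bsub>B\<^esub>"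
  \<comment> \<open>The second crossing, by \<open>b f = f b\<close> in
    \<open>B \<otimes> B\<close>.\<close>
  have *: "?g (\<alpha> x) (\<alpha> y \<otimes>\<^bsub>R\<^esub> \<beta> b) =
    sumB (R \<boxtimes> R) (\<lambda>u v. \<Psi> (p \<otimes>\<^bsub>R\<^esub> \<alpha> x) (\<alpha> y \<otimes>\<^bsub>R\<^esub> \<beta> u) (\<beta> v \<otimes>\<^bsub>R\<^esub> (\<beta> b \<otimes>\<^bsub>R\<^esub> s))) \<one>\<^bsub>B\<^esub>"
    if [simp]: "x \<in> carrier A" "y \<in> carrier A" for x y
  proof -
    let ?h = "\<lambda>u v. \<Psi> (p \<otimes>\<^bsub>R\<^esub> \<alpha> x) (\<alpha> y \<otimes>\<^bsub>R\<^esub> \<beta> u) (\<beta> v \<otimes>\<^bsub>R\<^esub> s)"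
    have "sumB (R \<boxtimes> R) (\<lambda>u v. ?h (b \<otimes>\<^bsub>B\<^esub> u) v) \<one>\<^bsub>B\<^esub> = sumB (R \<boxtimes> R) (\<lambda>u v. ?h u (v \<otimes>\<^bsub>B\<^esub> b)) \<one>\<^bsub>B\<^esub>"
      by (rule trans[OF sumB_one(1) sumB_one(2)[symmetric]]) (simp_all add: tensor_simps)
    then show ?thesis by (simp add: tensor_simps)
  qed
  have "Z (p \<otimes>\<^bsub>R\<^esub> \<beta> b) s = sumA (R \<boxtimes> R) (\<lambda>x y. ?g (\<beta> b \<otimes>\<^bsub>R\<^esub> \<alpha> x) (\<alpha> y)) \<one>\<^bsub>A\<^esub>"
    by (simp add: Z_def tensor_simps)
  \<comment> \<open>The first crossing; the summand is balanced over \<open>B\<close> because \<Psi>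
    is.\<close>
  also have "\<dots> = sumA (R \<boxtimes> R) (\<lambda>x y. ?g (\<alpha> x) (\<alpha> y \<otimes>\<^bsub>R\<^esub> \<beta> b)) \<one>\<^bsub>A\<^esub>"
  proof (rule centralA_universal[OF _ _ _ _ assms(1)])
    fix q r b assume "q \<in> carrier R" "r \<in> carrier R" "b \<in> carrier B"
    then show "?g (q \<otimes>\<^bsub>R\<^esub> \<beta> b) r = ?g q (\<beta> b \<otimes>\<^bsub>R\<^esub> r)"
      using \<Psi>_balanced(1)[of "p \<otimes>\<^bsub>R\<^esub> q" _ _ b] by (simp add: tensor_simps)
  qed (simp_all add: tensor_simps)
  also have "\<dots> = Z p (\<beta> b \<otimes>\<^bsub>R\<^esub> s)" unfolding Z_def by (rule sweedler_cong[OF * refl refl])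
  finally show ?thesis .
qed

text \<open>Here \<alpha> a crosses \<open>e\<close> because \<open>\<Gamma>A\<close> is a bimodule
  map, and then crosses \<open>f\<close> by centrality.\<close>

lemma Z_moveA:
  assumes centralB "p \<in> carrier R" "s \<in> carrier R" "a \<in> carrier A"
  shows "Z (p \<otimes>\<^bsub>R\<^esub> \<alpha> a) s = Z p (\<alpha> a \<otimes>\<^bsub>R\<^esub> s)"
proof -
  note [simp] = assms(2-4)
  let ?h = "\<lambda>x y. sumB (R \<boxtimes> R) (\<lambda>u v. \<Psi> (p \<otimes>\<^bsub>R\<^esub> \<alpha> x) (\<alpha> y \<otimes>\<^bsub>R\<^esub> \<beta> u) (\<beta> v \<otimes>\<^bsub>R\<^esub> s)) \<one>\<^bsub>B\<^esub>"
  have *: "?h x (y \<otimes>\<^bsub>A\<^esub> a) =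
    sumB (R \<boxtimes> R) (\<lambda>u v. \<Psi> (p \<otimes>\<^bsub>R\<^esub> \<alpha> x) (\<alpha> y \<otimes>\<^bsub>R\<^esub> \<beta> u) (\<beta> v \<otimes>\<^bsub>R\<^esub> (\<alpha> a \<otimes>\<^bsub>R\<^esub> s))) \<one>\<^bsub>B\<^esub>"
    if [simp]: "x \<in> carrier A" "y \<in> carrier A" for x y
  proof -
    let ?g = "\<lambda>q r. \<Psi> (p \<otimes>\<^bsub>R\<^esub> \<alpha> x) (\<alpha> y \<otimes>\<^bsub>R\<^esub> q) (r \<otimes>\<^bsub>R\<^esub> s)"
    have "sumB (R \<boxtimes> R) (\<lambda>u v. ?g (\<beta> u) (\<beta> v \<otimes>\<^bsub>R\<^esub> \<alpha> a)) \<one>\<^bsub>B\<^esub> =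
        sumB (R \<boxtimes> R) (\<lambda>u v. ?g (\<alpha> a \<otimes>\<^bsub>R\<^esub> \<beta> u) (\<beta> v)) \<one>\<^bsub>B\<^esub>"
    proof (rule centralB_universal[OF _ _ _ _ assms(1)])
      fix q r a assume "q \<in> carrier R" "r \<in> carrier R" "a \<in> carrier A"
      then show "?g (q \<otimes>\<^bsub>R\<^esub> \<alpha> a) r = ?g q (\<alpha> a \<otimes>\<^bsub>R\<^esub> r)"
        using \<Psi>_balanced(2)[of "p \<otimes>\<^bsub>R\<^esub> \<alpha> x" "\<alpha> y \<otimes>\<^bsub>R\<^esub> q" "r \<otimes>\<^bsub>R\<^esub> s" a] by (simp add: tensor_simps)
    qed (simp_all add: tensor_simps)
    then show ?thesis by (simp add: tensor_simps)
  qed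
  have "Z (p \<otimes>\<^bsub>R\<^esub> \<alpha> a) s = sumA (R \<boxtimes> R) (\<lambda>x y. ?h (a \<otimes>\<^bsub>A\<^esub> x) y) \<one>\<^bsub>A\<^esub>"
    by (simp add: Z_def tensor_simps)
  also have "\<dots> = sumA (R \<boxtimes> R) (\<lambda>x y. ?h x (y \<otimes>\<^bsub>A\<^esub> a)) \<one>\<^bsub>A\<^esub>"
    by (rule trans[OF sumA_one(1) sumA_one(2)[symmetric]]) (simp_all add: tensor_simps)
  also have "\<dots> = Z p (\<alpha> a \<otimes>\<^bsub>R\<^esub> s)" unfolding Z_def by (rule sweedler_cong[OF * refl refl])
  finally show ?thesis .
qed

text \<open>On products \<open>\<alpha> a \<beta> b\<close> the two factors move one after the
  other, \<beta> b first, and these products span \<open>R\<close>.\<close>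

lemma Z_balanced:
  assumes centralA centralB "p \<in> carrier R" "q \<in> carrier R" "s \<in> carrier R"
  shows "Z (p \<otimes>\<^bsub>R\<^esub> q) s = Z p (q \<otimes>\<^bsub>R\<^esub> s)"
proof (rule eqI_AB[OF _ _ _ assms(4), where U = "R \<boxtimes> R"])
  fix a b assume ab: "a \<in> carrier A" "b \<in> carrier B"
  then have "Z (p \<otimes>\<^bsub>R\<^esub> \<alpha> a \<otimes>\<^bsub>R\<^esub> \<beta> b) s = Z (p \<otimes>\<^bsub>R\<^esub> \<alpha> a) (\<beta> b \<otimes>\<^bsub>R\<^esub> s)"
    using assms by (intro Z_moveB) (simp_all add: tensor_simps)
  also have "\<dots> = Z p (\<alpha> a \<otimes>\<^bsub>R\<^esub> (\<beta> b \<otimes>\<^bsub>R\<^esub> s))"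
    using assms ab by (intro Z_moveA) (simp_all add: tensor_simps)
  finally show "Z (p \<otimes>\<^bsub>R\<^esub> (\<alpha> a \<otimes>\<^bsub>R\<^esub> \<beta> b)) s = Z p (\<alpha> a \<otimes>\<^bsub>R\<^esub> \<beta> b \<otimes>\<^bsub>R\<^esub> s)"
    using assms ab by (simp add: tensor_simps)
qed (use assms in \<open>simp_all add: tensor_simps\<close>)

text \<open>Multiplying the last two factors of \<open>R \<otimes>\<^sub>B R \<otimes>\<^sub>A R\<close> turns \<open>p z s\<close> into \<open>p e s\<close>, as \<open>\<Sum> f' f'' = 1\<close>.\<close>

lemma balB_Z:
  assumes "p \<in> carrier R" "s \<in> carrier R"
  shows "sweedler K R R (A \<boxtimes> R) (\<lambda>q r. balB q r) (Z p s) =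
    sumA (A \<boxtimes> R) (\<lambda>x y. balB (p \<otimes>\<^bsub>R\<^esub> \<alpha> x) (\<alpha> y \<otimes>\<^bsub>R\<^esub> s)) \<one>\<^bsub>A\<^esub>"
proof -
  note [simp] = assms
  \<comment> \<open>On the image of \<open>p' \<otimes> q' \<otimes> s'\<close>, balance brings the
    \<open>B\<close> component of \<open>q'\<close> next to its \<open>A\<close> component, and
    \<open>mult_\<sigma>\<close> reassembles \<open>q'\<close>.\<close>
  have 1: "sweedler K R R (A \<boxtimes> R) (\<lambda>q r. balB q r) (\<Psi> p' q' s') = balB p' (q' \<otimes>\<^bsub>R\<^esub> s')"
    if "p' \<in> carrier R" "q' \<in> carrier R" "s' \<in> carrier R" for p' q' s'
  proof -
    have "sweedler K R R (A \<boxtimes> R) (\<lambda>q r. balB q r) (\<Psi> p' q' s') =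
        sweedler K B A (A \<boxtimes> R) (\<lambda>u a. balB p' (\<beta> u \<otimes>\<^bsub>R\<^esub> \<alpha> a \<otimes>\<^bsub>R\<^esub> s')) (\<sigma> q')"
      using that by (simp add: sweedler_\<Psi> balB_balanced tensor_simps)
    also have "\<dots> = balB p' (sweedler K B A R (\<lambda>u a. \<beta> u \<otimes>\<^bsub>R\<^esub> \<alpha> a) (\<sigma> q') \<otimes>\<^bsub>R\<^esub> s')"
      by (rule sweedler_push[symmetric, where g = "\<lambda>r. balB p' (r \<otimes>\<^bsub>R\<^esub> s')"])
        (use that in \<open>simp_all add: tensor_simps\<close>)
    finally show ?thesis using that by (simp only: mult_\<sigma>)
  qed
  have 2: "sumB (A \<boxtimes> R) (\<lambda>u v. balB (p \<otimes>\<^bsub>R\<^esub> \<alpha> x) (\<alpha> y \<otimes>\<^bsub>R\<^esub> (\<beta> u \<otimes>\<^bsub>R\<^esub> (\<beta> v \<otimes>\<^bsub>R\<^esub> s)))) \<one>\<^bsub>B\<^esub> =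
      balB (p \<otimes>\<^bsub>R\<^esub> \<alpha> x) (\<alpha> y \<otimes>\<^bsub>R\<^esub> s)" if [simp]: "x \<in> carrier A" "y \<in> carrier A" for x y
  proof -
    have "balB (p \<otimes>\<^bsub>R\<^esub> \<alpha> x) (\<alpha> y \<otimes>\<^bsub>R\<^esub> (sumB R (\<lambda>u v. \<beta> u \<otimes>\<^bsub>R\<^esub> \<beta> v) \<one>\<^bsub>B\<^esub> \<otimes>\<^bsub>R\<^esub> s)) =
        sumB (A \<boxtimes> R) (\<lambda>u v. balB (p \<otimes>\<^bsub>R\<^esub> \<alpha> x) (\<alpha> y \<otimes>\<^bsub>R\<^esub> (\<beta> u \<otimes>\<^bsub>R\<^esub> \<beta> v \<otimes>\<^bsub>R\<^esub> s))) \<one>\<^bsub>B\<^esub>"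
      by (rule sweedler_push[where g = "\<lambda>r. balB (p \<otimes>\<^bsub>R\<^esub> \<alpha> x) (\<alpha> y \<otimes>\<^bsub>R\<^esub> (r \<otimes>\<^bsub>R\<^esub> s))"])
        (simp_all add: tensor_simps)
    then show ?thesis by (simp add: sumB_mult tensor_simps)
  qed
  show ?thesis by (simp add: Z_def tensor_simps 1 2)
qed

text \<open>Dually, the first two factors are multiplied, and \<open>\<Sum> e' e'' = 1\<close>
  removes \<open>e\<close>, which leaves \<open>p f s\<close>.\<close>

lemma balA_Z:
  assumes "p \<in> carrier R" "s \<in> carrier R"
  shows "sweedler K R R (A \<boxtimes> (B \<boxtimes> B)) (\<lambda>q r. balA q r) (Z p s) =
    sumB (A \<boxtimes> (B \<boxtimes> B)) (\<lambda>u v. balA (p \<otimes>\<^bsub>R\<^esub> \<beta> u) (\<beta> v \<otimes>\<^bsub>R\<^esub> s)) \<one>\<^bsub>B\<^esub>"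
proof -
  note [simp] = assms
  let ?U = "A \<boxtimes> (B \<boxtimes> B)"
  have 1: "sweedler K R R ?U (\<lambda>q r. balA q r) (\<Psi> p' q' s') = balA (p' \<otimes>\<^bsub>R\<^esub> q') s'"
    if "p' \<in> carrier R" "q' \<in> carrier R" "s' \<in> carrier R" for p' q' s'
  proof -
    have "sweedler K R R ?U (\<lambda>q r. balA q r) (\<Psi> p' q' s') =
        sweedler K B A ?U (\<lambda>u a. balA (p' \<otimes>\<^bsub>R\<^esub> (\<beta> u \<otimes>\<^bsub>R\<^esub> \<alpha> a)) s') (\<sigma> q')"
      using that by (simp add: sweedler_\<Psi> balA_balanced[symmetric] tensor_simps)
    also have "\<dots> = balA (p' \<otimes>\<^bsub>R\<^esub> sweedler K B A R (\<lambda>u a. \<beta> u \<otimes>\<^bsub>R\<^esub> \<alpha> a) (\<sigma> q')) s'"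
      by (rule sweedler_push[symmetric, where g = "\<lambda>r. balA (p' \<otimes>\<^bsub>R\<^esub> r) s'"])
        (use that in \<open>simp_all add: tensor_simps\<close>)
    finally show ?thesis using that by (simp only: mult_\<sigma>)
  qed
  \<comment> \<open>The sum over \<open>e\<close> now sees only the product of its two factors, so
    it can be moved into the argument of \<open>?h\<close>.\<close>
  let ?h = "\<lambda>q. sumB ?U (\<lambda>u v. balA (p \<otimes>\<^bsub>R\<^esub> q \<otimes>\<^bsub>R\<^esub> \<beta> u) (\<beta> v \<otimes>\<^bsub>R\<^esub> s)) \<one>\<^bsub>B\<^esub>"
  have "sweedler K R R ?U (\<lambda>q r. balA q r) (Z p s) = sumA ?U (\<lambda>x y. ?h (\<alpha> x \<otimes>\<^bsub>R\<^esub> \<alpha> y)) \<one>\<^bsub>A\<^esub>"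
    by (simp add: Z_def tensor_simps 1)
  also have "\<dots> = ?h (sumA R (\<lambda>x y. \<alpha> x \<otimes>\<^bsub>R\<^esub> \<alpha> y) \<one>\<^bsub>A\<^esub>)"
    by (rule sweedler_push[symmetric, where g = ?h]) (simp_all add: tensor_simps)
  finally show ?thesis by (simp add: sumA_mult tensor_simps)
qed

text \<open>By \<open>G_eq\<close>, \<open>G\<close> sends \<open>\<alpha> a \<beta> b\<close> to
  \<open>\<alpha> a z \<beta> b\<close>. A bimodule map forces \<open>p z = z p\<close>, whose two
  contractions are the two centralities; conversely these make \<open>z\<close> commute with all of
  \<open>R\<close>.\<close>

lemma bimodule_right_inverse_factorization_iff:
  assumes G: "linear_map K R (R \<boxtimes> R) G"
    and G_eq: "\<And>a b. a \<in> carrier A \<Longrightarrow> b \<in> carrier B \<Longrightarrow> G (\<alpha> a \<otimes>\<^bsub>R\<^esub> \<beta> b) =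
      sumA (R \<boxtimes> R) (\<lambda>x y. sumB (R \<boxtimes> R) (\<lambda>u v. \<Psi> (\<alpha> x) (\<alpha> y \<otimes>\<^bsub>R\<^esub> \<beta> u) (\<beta> v)) b) a"
  shows "bimodule_right_inverse K R G \<longleftrightarrow> centralA \<and> centralB"
proof
  assume "bimodule_right_inverse K R G"
  then have bim: "G (x \<otimes>\<^bsub>R\<^esub> (y \<otimes>\<^bsub>R\<^esub> z)) =
      sweedler K R R (R \<boxtimes> R) (\<lambda>p q. pure_tensor K R R (x \<otimes>\<^bsub>R\<^esub> p) (q \<otimes>\<^bsub>R\<^esub> z)) (G y)"
    if "x \<in> carrier R" "y \<in> carrier R" "z \<in> carrier R" for x y z
    using that bimodule_right_inverse_iff[OF algebras(3)] by blast
  have G1: "G \<one>\<^bsub>R\<^esub> = Z \<one>\<^bsub>R\<^esub> \<one>\<^bsub>R\<^esub>"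
    using G_eq[of "\<one>\<^bsub>A\<^esub>" "\<one>\<^bsub>B\<^esub>"] Z_mult[of "\<one>\<^bsub>A\<^esub>" "\<one>\<^bsub>B\<^esub>"] by (simp add: tensor_simps)
  \<comment> \<open>The bimodule identity with the unit in the middle, where \<open>G\<close> takes
    the value of the idempotent.\<close>
  have GZ: "G (x \<otimes>\<^bsub>R\<^esub> z) = Z x z" if "x \<in> carrier R" "z \<in> carrier R" for x z
    using bim[of x "\<one>\<^bsub>R\<^esub>" z] that by (simp add: G1 Z_act tensor_simps)
  \<comment> \<open>Reading \<open>p\<close> both as \<open>p 1\<close> and as \<open>1 p\<close>
    makes the idempotent commute with \<open>p\<close>.\<close>
  have Z1: "Z p \<one>\<^bsub>R\<^esub> = Z \<one>\<^bsub>R\<^esub> p" if "p \<in> carrier R" for p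
    using GZ[of p "\<one>\<^bsub>R\<^esub>"] GZ[of "\<one>\<^bsub>R\<^esub>" p] that by (simp add: tensor_simps)
  show "centralA \<and> centralB"
  proof
    \<comment> \<open>Contracting this commutation by \<open>balB\<close> removes \<open>f\<close>,
      and what remains is centrality of \<open>e\<close>.\<close>
    have "sumA (A \<boxtimes> R) (\<lambda>x y. balB (\<beta> b \<otimes>\<^bsub>R\<^esub> \<alpha> x) (\<alpha> y)) \<one>\<^bsub>A\<^esub> =
        sumA (A \<boxtimes> R) (\<lambda>x y. balB (\<alpha> x) (\<alpha> y \<otimes>\<^bsub>R\<^esub> \<beta> b)) \<one>\<^bsub>A\<^esub>" if "b \<in> carrier B" for b
      using balB_Z[of "\<beta> b" "\<one>\<^bsub>R\<^esub>"] balB_Z[of "\<one>\<^bsub>R\<^esub>" "\<beta> b"] Z1[of "\<beta> b"] that by (simp add: tensor_simps)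
    then show centralA by (simp add: centralA_def)
  next
    have "sumB (A \<boxtimes> (B \<boxtimes> B)) (\<lambda>u v. balA (\<beta> u) (\<beta> v \<otimes>\<^bsub>R\<^esub> \<alpha> a)) \<one>\<^bsub>B\<^esub> =
        sumB (A \<boxtimes> (B \<boxtimes> B)) (\<lambda>u v. balA (\<alpha> a \<otimes>\<^bsub>R\<^esub> \<beta> u) (\<beta> v)) \<one>\<^bsub>B\<^esub>" if "a \<in> carrier A" for a
      using balA_Z[of "\<alpha> a" "\<one>\<^bsub>R\<^esub>"] balA_Z[of "\<one>\<^bsub>R\<^esub>" "\<alpha> a"] Z1[of "\<alpha> a"] that by (simp add: tensor_simps)
    then show centralB by (simp add: centralB_def)
  qed
next
  assume c: "centralA \<and> centralB"
  \<comment> \<open>Balance turns the prescribed value \<open>\<alpha> a z \<beta> b\<close> into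
    \<open>\<alpha> a \<beta> b z\<close>.\<close>
  have GZ: "G q = Z q \<one>\<^bsub>R\<^esub>" if q: "q \<in> carrier R" for q
  proof (rule eqI_AB[OF _ _ _ q, where U = "R \<boxtimes> R"])
    fix a b assume ab: "a \<in> carrier A" "b \<in> carrier B"
    then show "G (\<alpha> a \<otimes>\<^bsub>R\<^esub> \<beta> b) = Z (\<alpha> a \<otimes>\<^bsub>R\<^esub> \<beta> b) \<one>\<^bsub>R\<^esub>"
      using Z_balanced[of "\<alpha> a" "\<beta> b" "\<one>\<^bsub>R\<^esub>"] c by (simp add: G_eq Z_mult[symmetric] tensor_simps)
  qed (use G in \<open>simp_all add: tensor_simps\<close>)
  have split: "sweedler K R R R (\<lambda>p q. p \<otimes>\<^bsub>R\<^esub> q) (G q) = q" if q: "q \<in> carrier R" for q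
  proof (rule eqI_AB[OF _ _ _ q, where U = R])
    fix a b assume [simp]: "a \<in> carrier A" "b \<in> carrier B"
    \<comment> \<open>Multiplication collapses \<Psi> to the product of its three arguments, by
      reassembling the middle one from \<sigma>.\<close>
    have "sweedler K R R R (\<lambda>p q. p \<otimes>\<^bsub>R\<^esub> q) (\<Psi> p q s) = p \<otimes>\<^bsub>R\<^esub> (q \<otimes>\<^bsub>R\<^esub> s)"
      if "p \<in> carrier R" "q \<in> carrier R" "s \<in> carrier R" for p q s
    proof -
      have "p \<otimes>\<^bsub>R\<^esub> (sweedler K B A R (\<lambda>b a. \<beta> b \<otimes>\<^bsub>R\<^esub> \<alpha> a) (\<sigma> q) \<otimes>\<^bsub>R\<^esub> s) =
          sweedler K B A R (\<lambda>b a. p \<otimes>\<^bsub>R\<^esub> (\<beta> b \<otimes>\<^bsub>R\<^esub> \<alpha> a \<otimes>\<^bsub>R\<^esub> s)) (\<sigma> q)"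
        using that by (simp add: tensor_simps del: mult_\<sigma>)
      then show ?thesis using that by (simp add: sweedler_\<Psi> mult_\<sigma>) (simp add: sweedler_\<Psi> tensor_simps)
    qed
    then have "sweedler K R R R (\<lambda>p q. p \<otimes>\<^bsub>R\<^esub> q) (G (\<alpha> a \<otimes>\<^bsub>R\<^esub> \<beta> b)) =
        sumA R (\<lambda>x y. sumB R (\<lambda>u v. \<alpha> x \<otimes>\<^bsub>R\<^esub> (\<alpha> y \<otimes>\<^bsub>R\<^esub> (\<beta> u \<otimes>\<^bsub>R\<^esub> \<beta> v))) b) a"
      by (simp add: G_eq tensor_simps)
    \<comment> \<open>Expanding the product of two sums nests them in the opposite order, hence the
      swap.\<close>
    also have "\<dots> = sumA R (\<lambda>x y. \<alpha> x \<otimes>\<^bsub>R\<^esub> \<alpha> y) a \<otimes>\<^bsub>R\<^esub> sumB R (\<lambda>u v. \<beta> u \<otimes>\<^bsub>R\<^esub> \<beta> v) b"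
      by (simp add: tensor_simps) (rule sweedler_swap; simp add: tensor_simps)
    finally show "sweedler K R R R (\<lambda>p q. p \<otimes>\<^bsub>R\<^esub> q) (G (\<alpha> a \<otimes>\<^bsub>R\<^esub> \<beta> b)) = \<alpha> a \<otimes>\<^bsub>R\<^esub> \<beta> b"
      by (simp add: sumA_mult sumB_mult)
  qed (use G in \<open>simp_all add: tensor_simps\<close>)
  show "bimodule_right_inverse K R G"
    unfolding bimodule_right_inverse_iff[OF algebras(3)]
  proof (intro conjI ballI G split)
    fix x y z assume xyz: "x \<in> carrier R" "y \<in> carrier R" "z \<in> carrier R"
    then show "G (x \<otimes>\<^bsub>R\<^esub> (y \<otimes>\<^bsub>R\<^esub> z)) =
      sweedler K R R (R \<boxtimes> R) (\<lambda>p q. pure_tensor K R R (x \<otimes>\<^bsub>R\<^esub> p) (q \<otimes>\<^bsub>R\<^esub> z)) (G y)"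
      using Z_balanced[of "x \<otimes>\<^bsub>R\<^esub> y" z "\<one>\<^bsub>R\<^esub>"] c by (simp add: GZ Z_act tensor_simps)
  qed
qed

end

section \<open>Twisted tensor products\<close>

lemma twisted_tensor_sel:
  "carrier (twisted_tensor K A B \<tau>) = carrier (A \<boxtimes>\<^bsub>K\<^esub> B)"
  "add (twisted_tensor K A B \<tau>) = add (A \<boxtimes>\<^bsub>K\<^esub> B)"
  "zero (twisted_tensor K A B \<tau>) = zero (A \<boxtimes>\<^bsub>K\<^esub> B)"
  "smult (twisted_tensor K A B \<tau>) = smult (A \<boxtimes>\<^bsub>K\<^esub> B)"
  "one (twisted_tensor K A B \<tau>) = pure_tensor K A B \<one>\<^bsub>A\<^esub> \<one>\<^bsub>B\<^esub>"
  by (simp_all add: twisted_tensor_def)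

text \<open>Tensor products consult only the vector space structure of their factors, and
  \<open>twisted_tensor\<close> keeps that of \<open>A \<boxtimes> B\<close>.\<close>

lemma tensor_kernel_twisted:
  "tensor_kernel K (twisted_tensor K A B \<tau>) W = tensor_kernel K (A \<boxtimes>\<^bsub>K\<^esub> B) W"
  "tensor_kernel K V (twisted_tensor K A B \<tau>) = tensor_kernel K V (A \<boxtimes>\<^bsub>K\<^esub> B)"
  by (simp_all only: tensor_kernel_def tensor_relators_def twisted_tensor_sel)

lemma tensor_twisted:
  "twisted_tensor K A B \<tau> \<boxtimes>\<^bsub>K\<^esub> W = (A \<boxtimes>\<^bsub>K\<^esub> B) \<boxtimes>\<^bsub>K\<^esub> W"
  "V \<boxtimes>\<^bsub>K\<^esub> twisted_tensor K A B \<tau> = V \<boxtimes>\<^bsub>K\<^esub> (A \<boxtimes>\<^bsub>K\<^esub> B)"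
  by (simp_all only: tensor_def tensor_kernel_twisted twisted_tensor_sel)

lemma pure_tensor_twisted:
  "pure_tensor K (twisted_tensor K A B \<tau>) W = pure_tensor K (A \<boxtimes>\<^bsub>K\<^esub> B) W"
  "pure_tensor K V (twisted_tensor K A B \<tau>) = pure_tensor K V (A \<boxtimes>\<^bsub>K\<^esub> B)"
  by (simp_all only: pure_tensor_def tensor_kernel_twisted twisted_tensor_sel fun_eq_iff simp_thms)

lemma linear_map_twisted:
  "linear_map K (twisted_tensor K A B \<tau>) W = linear_map K (A \<boxtimes>\<^bsub>K\<^esub> B) W"
  "linear_map K V (twisted_tensor K A B \<tau>) = linear_map K V (A \<boxtimes>\<^bsub>K\<^esub> B)"
  by (simp_all only: linear_map_def twisted_tensor_sel fun_eq_iff simp_thms)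

text \<open>Besides scalar multiplication, a lift uses only the finite sum, which reads the carrier,
  addition and zero of its target.\<close>

lemma tensor_lift_twisted:
  "tensor_lift K (twisted_tensor K A B \<tau>) = tensor_lift K (A \<boxtimes>\<^bsub>K\<^esub> B)"
  by (simp only: tensor_lift_def twisted_tensor_sel finsum_def finprod_def fun_eq_iff monoid.simps Let_def simp_thms)

lemma sweedler_twisted:
  "sweedler K V W (twisted_tensor K A B \<tau>) = sweedler K V W (A \<boxtimes>\<^bsub>K\<^esub> B)"
  by (simp only: sweedler_def tensor_lift_twisted twisted_tensor_sel fun_eq_iff simp_thms)

lemmas twisted_simps = twisted_tensor_sel tensor_twisted pure_tensor_twisted linear_map_twisted
  sweedler_twisted

lemma (in base_field) linear_inv_into:
  assumes "module K V" "linear_map K V W f" "bij_betw f (carrier V) (carrier W)"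
  shows "linear_map K W V (inv_into (carrier V) f)"
proof -
  interpret V: module K V by fact
  let ?g = "inv_into (carrier V) f"
  have g: "?g y \<in> carrier V" "f (?g y) = y" if "y \<in> carrier W" for y
    using assms(3) that by (auto simp: bij_betw_def inv_into_into f_inv_into_f)
  have gf: "?g (f x) = x" if "x \<in> carrier V" for x
    using assms(3) that by (simp add: bij_betw_def inv_into_f_f)
  have "?g (y \<oplus>\<^bsub>W\<^esub> z) = ?g y \<oplus>\<^bsub>V\<^esub> ?g z" if "y \<in> carrier W" "z \<in> carrier W" for y z
    using gf[of "?g y \<oplus>\<^bsub>V\<^esub> ?g z"] g that assms(2) by (simp add: linear_map_def)
  moreover have "?g (c \<odot>\<^bsub>W\<^esub> y) = c \<odot>\<^bsub>V\<^esub> ?g y" if "c \<in> carrier K" "y \<in> carrier W" for c y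
    using gf[of "c \<odot>\<^bsub>V\<^esub> ?g y"] g that assms(2) by (simp add: linear_map_def)
  ultimately show ?thesis using g by (auto simp: linear_map_def)
qed

section \<open>Twisting maps evaluated on elements\<close>

locale twisted_algebras = base_field K for K :: "('k, 'm) ring_scheme" (structure) +
  fixes A :: "('k, 'a) module" and B :: "('k, 'b) module"
    and \<tau> :: "('b \<times> 'a \<Rightarrow> 'k) set \<Rightarrow> ('a \<times> 'b \<Rightarrow> 'k) set"
  assumes algebras: "assoc_algebra K A" "assoc_algebra K B"
    and twisting: "twisting_map K A B \<tau>"
begin

lemma \<tau>_linear: "linear_map K (B \<boxtimes> A) (A \<boxtimes> B) \<tau>"
  using twisting by (simp add: twisting_map_def)

lemma \<tau>_bij: "bij_betw \<tau> (carrier (B \<boxtimes> A)) (carrier (A \<boxtimes> B))"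
  using twisting by (simp add: twisting_map_def)

lemma \<tau>_one:
  "b \<in> carrier B \<Longrightarrow> \<tau> (pure_tensor K B A b \<one>\<^bsub>A\<^esub>) = pure_tensor K A B \<one>\<^bsub>A\<^esub> b"
  "a \<in> carrier A \<Longrightarrow> \<tau> (pure_tensor K B A \<one>\<^bsub>B\<^esub> a) = pure_tensor K A B a \<one>\<^bsub>B\<^esub>"
  using twisting by (simp_all add: twisting_map_def)

lemmas [tensor_simps] = algebras \<tau>_linear[THEN linear_closed] \<tau>_linear[THEN linear_app] \<tau>_one

lemma mult_map_pure [tensor_simps]:
  "assoc_algebra K C \<Longrightarrow> x \<in> carrier C \<Longrightarrow> y \<in> carrier C \<Longrightarrow> mult_map K C (pure_tensor K C C x y) = x \<otimes>\<^bsub>C\<^esub> y"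
  by (simp add: mult_map_eval tensor_simps)

lemma linear_mult_map: "assoc_algebra K C \<Longrightarrow> linear_map K (C \<boxtimes> C) C (mult_map K C)"
  using mult_map_linear[OF _ linear_ident] .

lemma mult_middle:
  assumes [simp]: "p \<in> carrier (A \<boxtimes> B)" "q \<in> carrier (A \<boxtimes> B)"
  shows "tensor_map K A B (mult_map K A) (mult_map K B)
      (tensor_middle K A B A B A B \<tau> (pure_tensor K (A \<boxtimes> B) (A \<boxtimes> B) p q)) =
    sweedler K A B (A \<boxtimes> B) (\<lambda>a b. sweedler K A B (A \<boxtimes> B) (\<lambda>a' b'.
      sweedler K A B (A \<boxtimes> B) (\<lambda>x y. pure_tensor K A B (a \<otimes>\<^bsub>A\<^esub> x) (y \<otimes>\<^bsub>B\<^esub> b'))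
        (\<tau> (pure_tensor K B A b a'))) q) p"
  by (simp add: tensor_middle_pure tensor_simps \<tau>_linear tensor_map_sweedler linear_mult_map
      tensor_map_pure[OF K_field, of "A \<boxtimes> A" "B \<boxtimes> B"])

lemma twisted_mult:
  assumes "p \<in> carrier (A \<boxtimes> B)" "q \<in> carrier (A \<boxtimes> B)"
  shows "p \<otimes>\<^bsub>twisted_tensor K A B \<tau>\<^esub> q =
    sweedler K A B (A \<boxtimes> B) (\<lambda>a b. sweedler K A B (A \<boxtimes> B) (\<lambda>a' b'.
      sweedler K A B (A \<boxtimes> B) (\<lambda>x y. pure_tensor K A B (a \<otimes>\<^bsub>A\<^esub> x) (y \<otimes>\<^bsub>B\<^esub> b'))
        (\<tau> (pure_tensor K B A b a'))) q) p"
  using mult_middle[OF assms] by (simp add: twisted_tensor_def)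

text \<open>The multiplication stays unevaluated: the two specializations below insert a unit, which
  makes its second factor pure, the case of \<open>mult_middle_pure\<close>.\<close>

lemma \<tau>_mult:
  assumes [simp]: "a \<in> carrier A" "a' \<in> carrier A" "b \<in> carrier B" "b' \<in> carrier B"
  shows "\<tau> (pure_tensor K B A (b \<otimes>\<^bsub>B\<^esub> b') (a \<otimes>\<^bsub>A\<^esub> a')) =
    tensor_map K A B (mult_map K A) (mult_map K B) (tensor_middle K A B A B A B \<tau>
      (sweedler K A B ((A \<boxtimes> B) \<boxtimes> (A \<boxtimes> B))
        (\<lambda>x y. pure_tensor K (A \<boxtimes> B) (A \<boxtimes> B) (\<tau> (pure_tensor K B A b x)) (\<tau> (pure_tensor K B A y a')))
        (\<tau> (pure_tensor K B A b' a))))"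
proof -
  let ?x = "pure_tensor K (B \<boxtimes> B) (A \<boxtimes> A) (pure_tensor K B B b b') (pure_tensor K A A a a')"
  have "\<tau> (tensor_map K B A (mult_map K B) (mult_map K A) ?x) =
        (tensor_map K A B (mult_map K A) (mult_map K B) \<circ>
         tensor_middle K A B A B A B \<tau> \<circ>
         tensor_map K (A \<boxtimes> B) (A \<boxtimes> B) \<tau> \<tau> \<circ>
         tensor_middle K B B A A A B \<tau>) ?x"
    using twisting unfolding twisting_map_def by (simp del: o_apply add: tensor_simps)
  then show ?thesis
    by (simp add: tensor_middle_pure4 tensor_map_pure[OF K_field, of "B \<boxtimes> B" "A \<boxtimes> A"]
        tensor_map_sweedler tensor_map_pure[OF K_field, of "B \<boxtimes> A" "B \<boxtimes> A"]
        linear_mult_map \<tau>_linear tensor_simps)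
qed

lemma mult_middle_pure:
  assumes [simp]: "p \<in> carrier (A \<boxtimes> B)" "a' \<in> carrier A" "b' \<in> carrier B"
  shows "tensor_map K A B (mult_map K A) (mult_map K B)
      (tensor_middle K A B A B A B \<tau> (pure_tensor K (A \<boxtimes> B) (A \<boxtimes> B) p (pure_tensor K A B a' b'))) =
    sweedler K A B (A \<boxtimes> B) (\<lambda>a b.
      sweedler K A B (A \<boxtimes> B) (\<lambda>x y. pure_tensor K A B (a \<otimes>\<^bsub>A\<^esub> x) (y \<otimes>\<^bsub>B\<^esub> b'))
        (\<tau> (pure_tensor K B A b a'))) p"
  by (subst mult_middle) (simp_all add: tensor_simps)

text \<open>Multiplicativity with \<open>a' = 1\<close>, where
  \<open>\<tau> (y \<otimes> 1) = 1 \<otimes> y\<close>.\<close>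

lemma \<tau>_mult_left:
  assumes [simp]: "a \<in> carrier A" "b \<in> carrier B" "b' \<in> carrier B"
  shows "\<tau> (pure_tensor K B A (b \<otimes>\<^bsub>B\<^esub> b') a) =
    sweedler K A B (A \<boxtimes> B) (\<lambda>x y. sweedler K A B (A \<boxtimes> B)
        (\<lambda>x' y'. pure_tensor K A B x' (y' \<otimes>\<^bsub>B\<^esub> y)) (\<tau> (pure_tensor K B A b x)))
      (\<tau> (pure_tensor K B A b' a))"
proof -
  let ?m = "\<lambda>t. tensor_map K A B (mult_map K A) (mult_map K B) (tensor_middle K A B A B A B \<tau> t)"
  let ?h = "\<lambda>x y. pure_tensor K (A \<boxtimes> B) (A \<boxtimes> B) (\<tau> (pure_tensor K B A b x)) (pure_tensor K A B \<one>\<^bsub>A\<^esub> y)"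
  have "\<tau> (pure_tensor K B A (b \<otimes>\<^bsub>B\<^esub> b') a) =
      ?m (sweedler K A B ((A \<boxtimes> B) \<boxtimes> (A \<boxtimes> B)) ?h (\<tau> (pure_tensor K B A b' a)))"
    using \<tau>_mult[of a "\<one>\<^bsub>A\<^esub>" b b'] by (simp only: tensor_simps assms cong: sweedler_cong)
  also have "\<dots> = sweedler K A B (A \<boxtimes> B) (\<lambda>x y. ?m (?h x y)) (\<tau> (pure_tensor K B A b' a))"
    by (rule sweedler_push[where g = ?m])
      (simp_all add: tensor_simps tensor_map_linear[of "A \<boxtimes> A" "B \<boxtimes> B"] tensor_middle_linear linear_mult_map \<tau>_linear)
  also have "\<dots> = sweedler K A B (A \<boxtimes> B) (\<lambda>x y. sweedler K A B (A \<boxtimes> B)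
        (\<lambda>x' y'. pure_tensor K A B x' (y' \<otimes>\<^bsub>B\<^esub> y)) (\<tau> (pure_tensor K B A b x)))
      (\<tau> (pure_tensor K B A b' a))"
    by (rule sweedler_cong) (simp_all add: mult_middle_pure tensor_simps)
  finally show ?thesis .
qed

text \<open>Multiplicativity with \<open>b' = 1\<close>, where
  \<open>\<tau> (1 \<otimes> a) = a \<otimes> 1\<close> collapses the inner sum.\<close>

lemma \<tau>_mult_right:
  assumes [simp]: "a \<in> carrier A" "a' \<in> carrier A" "b \<in> carrier B"
  shows "\<tau> (pure_tensor K B A b (a \<otimes>\<^bsub>A\<^esub> a')) =
    sweedler K A B (A \<boxtimes> B) (\<lambda>x y. sweedler K A B (A \<boxtimes> B)
        (\<lambda>x' y'. pure_tensor K A B (x \<otimes>\<^bsub>A\<^esub> x') y') (\<tau> (pure_tensor K B A y a')))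
      (\<tau> (pure_tensor K B A b a))"
proof -
  have "\<tau> (pure_tensor K B A b (a \<otimes>\<^bsub>A\<^esub> a')) =
    tensor_map K A B (mult_map K A) (mult_map K B) (tensor_middle K A B A B A B \<tau>
      (pure_tensor K (A \<boxtimes> B) (A \<boxtimes> B) (\<tau> (pure_tensor K B A b a)) (pure_tensor K A B a' \<one>\<^bsub>B\<^esub>)))"
    using \<tau>_mult[of a a' b "\<one>\<^bsub>B\<^esub>"] by (simp add: tensor_simps)
  also have "\<dots> = sweedler K A B (A \<boxtimes> B) (\<lambda>x y. sweedler K A B (A \<boxtimes> B)
        (\<lambda>x' y'. pure_tensor K A B (x \<otimes>\<^bsub>A\<^esub> x') y') (\<tau> (pure_tensor K B A y a')))
      (\<tau> (pure_tensor K B A b a))"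
    by (subst mult_middle_pure) (simp_all add: tensor_simps)
  finally show ?thesis .
qed

end

section \<open>The twisted tensor product as an algebra with a factorization\<close>

context twisted_algebras
begin

abbreviation "R \<equiv> twisted_tensor K A B \<tau>"

lemma twisted_mult_pure:
  assumes [simp]: "p \<in> carrier (A \<boxtimes> B)" "a' \<in> carrier A" "b' \<in> carrier B"
  shows "p \<otimes>\<^bsub>R\<^esub> pure_tensor K A B a' b' =
    sweedler K A B (A \<boxtimes> B) (\<lambda>a b.
      sweedler K A B (A \<boxtimes> B) (\<lambda>x y. pure_tensor K A B (a \<otimes>\<^bsub>A\<^esub> x) (y \<otimes>\<^bsub>B\<^esub> b'))
        (\<tau> (pure_tensor K B A b a'))) p"
  by (subst twisted_mult) (simp_all add: tensor_simps)

lemma twisted_mult_pure_pure: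
  assumes [simp]: "a \<in> carrier A" "b \<in> carrier B" "a' \<in> carrier A" "b' \<in> carrier B"
  shows "pure_tensor K A B a b \<otimes>\<^bsub>R\<^esub> pure_tensor K A B a' b' =
      sweedler K A B (A \<boxtimes> B) (\<lambda>x y. pure_tensor K A B (a \<otimes>\<^bsub>A\<^esub> x) (y \<otimes>\<^bsub>B\<^esub> b'))
        (\<tau> (pure_tensor K B A b a'))"
  by (subst twisted_mult_pure) (simp_all add: tensor_simps)

lemma twisted_mult_linear:
  assumes "linear_map K V (A \<boxtimes> B) f" "q \<in> carrier (A \<boxtimes> B)" "module K V"
  shows "linear_map K V (A \<boxtimes> B) (\<lambda>v. f v \<otimes>\<^bsub>R\<^esub> q)" "linear_map K V (A \<boxtimes> B) (\<lambda>v. q \<otimes>\<^bsub>R\<^esub> f v)"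
proof -
  have "linear_map K (A \<boxtimes> B) (A \<boxtimes> B) (\<lambda>p. p \<otimes>\<^bsub>R\<^esub> q)"
    by (subst linear_cong[OF twisted_mult[OF _ assms(2)]]) (use assms in \<open>simp_all add: tensor_simps\<close>)
  from linear_app[OF this assms(1)] show "linear_map K V (A \<boxtimes> B) (\<lambda>v. f v \<otimes>\<^bsub>R\<^esub> q)" .
  have "linear_map K (A \<boxtimes> B) (A \<boxtimes> B) (\<lambda>p. q \<otimes>\<^bsub>R\<^esub> p)"
    by (subst linear_cong[OF twisted_mult[OF assms(2)]]) (use assms in \<open>simp_all add: tensor_simps\<close>)
  from linear_app[OF this assms(1)] show "linear_map K V (A \<boxtimes> B) (\<lambda>v. q \<otimes>\<^bsub>R\<^esub> f v)" .
qed

lemma twisted_mult_closed: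
  "p \<in> carrier (A \<boxtimes> B) \<Longrightarrow> q \<in> carrier (A \<boxtimes> B) \<Longrightarrow> p \<otimes>\<^bsub>R\<^esub> q \<in> carrier (A \<boxtimes> B)"
  by (subst twisted_mult) (simp_all add: tensor_simps)

lemma twisted_mult_sweedler:
  assumes "module K V" "module K W" "bilinear_map K V W (A \<boxtimes> B) \<beta>"
    "t \<in> carrier (V \<boxtimes> W)" "q \<in> carrier (A \<boxtimes> B)"
  shows "sweedler K V W (A \<boxtimes> B) \<beta> t \<otimes>\<^bsub>R\<^esub> q = sweedler K V W (A \<boxtimes> B) (\<lambda>v w. \<beta> v w \<otimes>\<^bsub>R\<^esub> q) t"
    "q \<otimes>\<^bsub>R\<^esub> sweedler K V W (A \<boxtimes> B) \<beta> t = sweedler K V W (A \<boxtimes> B) (\<lambda>v w. q \<otimes>\<^bsub>R\<^esub> \<beta> v w) t"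
  using sweedler_push[OF assms(1,2) _ _ twisted_mult_linear(1)[OF linear_ident assms(5)] assms(3,4)]
    sweedler_push[OF assms(1,2) _ _ twisted_mult_linear(2)[OF linear_ident assms(5)] assms(3,4)]
  by (simp_all add: tensor_simps del: bilinear_iff)

text \<open>Both bracketings expand to one triple sum over \<open>\<tau> (b \<otimes> a')\<close>,
  \<open>\<tau> (b' \<otimes> a'')\<close> and \<open>\<tau> (y \<otimes> x')\<close>, the left one
  by \<open>\<tau>_mult_left\<close> and the right one by \<open>\<tau>_mult_right\<close>. They
  differ in the order of the two outer sums.\<close>

lemma twisted_assoc_pure:
  assumes [simp]: "a \<in> carrier A" "a' \<in> carrier A" "a'' \<in> carrier A"
    "b \<in> carrier B" "b' \<in> carrier B" "b'' \<in> carrier B"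
  shows "pure_tensor K A B a b \<otimes>\<^bsub>R\<^esub> pure_tensor K A B a' b' \<otimes>\<^bsub>R\<^esub> pure_tensor K A B a'' b'' =
    pure_tensor K A B a b \<otimes>\<^bsub>R\<^esub> (pure_tensor K A B a' b' \<otimes>\<^bsub>R\<^esub> pure_tensor K A B a'' b'')"
proof -
  let ?S = "sweedler K A B (A \<boxtimes> B)" and ?t = "\<lambda>b a. \<tau> (pure_tensor K B A b a)"
  have "pure_tensor K A B a b \<otimes>\<^bsub>R\<^esub> pure_tensor K A B a' b' \<otimes>\<^bsub>R\<^esub> pure_tensor K A B a'' b'' =
    ?S (\<lambda>x y. ?S (\<lambda>x' y'. ?S (\<lambda>x'' y''.
      pure_tensor K A B (a \<otimes>\<^bsub>A\<^esub> (x \<otimes>\<^bsub>A\<^esub> x'')) (y'' \<otimes>\<^bsub>B\<^esub> (y' \<otimes>\<^bsub>B\<^esub> b''))) (?t y x')) (?t b' a'')) (?t b a')"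
    by (simp add: twisted_mult_pure_pure twisted_mult_sweedler \<tau>_mult_left tensor_simps)
  also have "\<dots> = ?S (\<lambda>x' y'. ?S (\<lambda>x y. ?S (\<lambda>x'' y''.
      pure_tensor K A B (a \<otimes>\<^bsub>A\<^esub> (x \<otimes>\<^bsub>A\<^esub> x'')) (y'' \<otimes>\<^bsub>B\<^esub> (y' \<otimes>\<^bsub>B\<^esub> b''))) (?t y x')) (?t b a')) (?t b' a'')"
    by (rule sweedler_swap) (simp_all add: tensor_simps)
  also have "\<dots> = pure_tensor K A B a b \<otimes>\<^bsub>R\<^esub> (pure_tensor K A B a' b' \<otimes>\<^bsub>R\<^esub> pure_tensor K A B a'' b'')"
    by (simp add: twisted_mult_pure_pure twisted_mult_sweedler \<tau>_mult_right tensor_simps)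
  finally show ?thesis .
qed

text \<open>Three extensions by linearity from pure tensors, in \<open>r\<close>, then
  \<open>q\<close>, then \<open>p\<close>.\<close>

lemma twisted_assoc:
  assumes p: "p \<in> carrier (A \<boxtimes> B)" and q: "q \<in> carrier (A \<boxtimes> B)" and r: "r \<in> carrier (A \<boxtimes> B)"
  shows "p \<otimes>\<^bsub>R\<^esub> q \<otimes>\<^bsub>R\<^esub> r = p \<otimes>\<^bsub>R\<^esub> (q \<otimes>\<^bsub>R\<^esub> r)"
proof -
  let ?T = "A \<boxtimes> B" and ?p = "pure_tensor K A B"
  note s = tensor_simps twisted_mult_linear twisted_mult_closed
  have 1: "?p a b \<otimes>\<^bsub>R\<^esub> ?p a' b' \<otimes>\<^bsub>R\<^esub> r = ?p a b \<otimes>\<^bsub>R\<^esub> (?p a' b' \<otimes>\<^bsub>R\<^esub> r)"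
    if [simp]: "a \<in> carrier A" "a' \<in> carrier A" "b \<in> carrier B" "b' \<in> carrier B" for a a' b b'
    by (rule tensor_eqI[OF _ _ _ _ _ r, where U = ?T]) (simp_all add: s twisted_assoc_pure)
  have 2: "?p a b \<otimes>\<^bsub>R\<^esub> q \<otimes>\<^bsub>R\<^esub> r = ?p a b \<otimes>\<^bsub>R\<^esub> (q \<otimes>\<^bsub>R\<^esub> r)"
    if [simp]: "a \<in> carrier A" "b \<in> carrier B" for a b
    by (rule tensor_eqI[OF _ _ _ _ _ q, where U = ?T]) (simp_all add: s r 1)
  show ?thesis
    by (rule tensor_eqI[OF _ _ _ _ _ p, where U = ?T]) (simp_all add: s q r 2)
qed

lemma twisted_one:
  assumes p: "p \<in> carrier (A \<boxtimes> B)"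
  shows "pure_tensor K A B \<one>\<^bsub>A\<^esub> \<one>\<^bsub>B\<^esub> \<otimes>\<^bsub>R\<^esub> p = p" "p \<otimes>\<^bsub>R\<^esub> pure_tensor K A B \<one>\<^bsub>A\<^esub> \<one>\<^bsub>B\<^esub> = p"
  by (rule tensor_eqI[OF _ _ _ _ _ p, where U = "A \<boxtimes> B"];
      simp add: tensor_simps twisted_mult_linear twisted_mult_pure_pure)+

lemma twisted_algebra: "assoc_algebra K R"
proof -
  have "module K A" "module K B" by (simp_all add: tensor_simps)
  then interpret T: module K "A \<boxtimes> B" by (simp add: tensor_product_module)
  note l1 = twisted_mult_linear(1)[OF linear_ident _ T.module_axioms] and l2 = twisted_mult_linear(2)[OF linear_ident _ T.module_axioms]
  have one: "pure_tensor K A B \<one>\<^bsub>A\<^esub> \<one>\<^bsub>B\<^esub> \<in> carrier (A \<boxtimes> B)" by (simp add: tensor_simps)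
  have ab: "abelian_group R"
    by (rule abelian_groupI) (auto simp: twisted_simps T.M.a_ac intro: T.M.l_neg T.M.a_inv_closed)
  moreover have "Group.monoid R"
    by (rule monoidI) (auto simp: twisted_simps twisted_mult_closed twisted_one twisted_assoc one)
  ultimately have "ring R"
    by (rule ringI) (use l1 l2 in \<open>simp_all add: twisted_simps linear_map_def\<close>)
  moreover have "module K R"
    by (rule moduleI[OF K.is_cring ab])
      (auto simp: twisted_simps T.smult_l_distr T.smult_r_distr T.smult_assoc1)
  ultimately show ?thesis
    by (intro assoc_algebra.intro assoc_algebra_axioms.intro K_field)
      (use l1 l2 in \<open>simp_all add: twisted_simps linear_map_def\<close>)
qed

abbreviation (input) "\<sigma> \<equiv> inv_into (carrier (B \<boxtimes> A)) \<tau>"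

lemma \<sigma>_linear: "linear_map K (A \<boxtimes> B) (B \<boxtimes> A) \<sigma>"
  by (rule linear_inv_into[OF _ \<tau>_linear \<tau>_bij]) (simp add: tensor_simps)

text \<open>Since \<open>\<alpha> a \<beta> b = a \<otimes> b\<close> and
  \<open>\<beta> b \<alpha> a = \<tau> (b \<otimes> a)\<close>, the two decompositions of
  \<open>R\<close> are the identity and the inverse of \<tau>.\<close>

lemma twisted_factorization:
  "algebra_factorization K A B R (\<lambda>a. pure_tensor K A B a \<one>\<^bsub>B\<^esub>) (\<lambda>b. pure_tensor K A B \<one>\<^bsub>A\<^esub> b) (\<lambda>q. q) \<sigma>"
proof (intro algebra_factorization.intro algebra_factorization_axioms.intro)
  fix q assume q: "q \<in> carrier R"
  then have [simp]: "\<sigma> q \<in> carrier (B \<boxtimes> A)" "\<tau> (\<sigma> q) = q" 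
    using linear_closed[OF \<sigma>_linear] \<tau>_bij by (auto simp: twisted_simps bij_betw_def f_inv_into_f)
  \<comment> \<open>Linearity takes \<tau> out of the sum, and what remains inside is the preimage
    of \<open>q\<close>.\<close>
  have "sweedler K B A (A \<boxtimes> B) (\<lambda>b a. \<tau> (pure_tensor K B A b a)) (\<sigma> q) =
      \<tau> (sweedler K B A (B \<boxtimes> A) (\<lambda>b a. pure_tensor K B A b a) (\<sigma> q))"
    by (rule sweedler_push[symmetric]) (simp_all add: tensor_simps \<tau>_linear)
  then show "sweedler K B A R (\<lambda>b a. pure_tensor K A B \<one>\<^bsub>A\<^esub> b \<otimes>\<^bsub>R\<^esub> pure_tensor K A B a \<one>\<^bsub>B\<^esub>) (\<sigma> q) = q"
    by (simp add: twisted_simps twisted_mult_pure_pure tensor_simps)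
qed (auto simp: twisted_simps tensor_simps twisted_algebra \<sigma>_linear K_field base_field_def
      twisted_mult_pure_pure inv_into_f_f[OF bij_betw_imp_inj_on[OF \<tau>_bij]])

end

text \<open>The quantifier over \<open>W\<close> comes first, to match the order in the
  characterizations of centrality.\<close>

lemma (in base_field) linear_eq_iff:
  assumes "module K V" "module K W" "module K U" "linear_map K (V \<boxtimes> W) U f" "linear_map K (V \<boxtimes> W) U g"
  shows "(\<forall>t\<in>carrier (V \<boxtimes> W). f t = g t) \<longleftrightarrow>
    (\<forall>w\<in>carrier W. \<forall>v\<in>carrier V. f (pure_tensor K V W v w) = g (pure_tensor K V W v w))"
  using tensor_eqI[OF assms] pure_closed[OF assms(1,2)] by blast

section \<open>The two identities and the splitting as conditions on the twisted algebra\<close>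

locale twisted_separable = twisted_algebras K A B \<tau>
  for K :: "('k, 'm) ring_scheme" (structure)
    and A :: "('k, 'a) module" and B :: "('k, 'b) module" and \<tau> +
  fixes \<Gamma>A :: "'a \<Rightarrow> ('a \<times> 'a \<Rightarrow> 'k) set" and \<Gamma>B :: "'b \<Rightarrow> ('b \<times> 'b \<Rightarrow> 'k) set"
  assumes bimodule: "bimodule_right_inverse K A \<Gamma>A" "bimodule_right_inverse K B \<Gamma>B"
begin

sublocale F: separable_factorization K A B R "\<lambda>a. pure_tensor K A B a \<one>\<^bsub>B\<^esub>" "\<lambda>b. pure_tensor K A B \<one>\<^bsub>A\<^esub> b" "\<lambda>q. q" \<sigma> \<Gamma>A \<Gamma>B
  by (rule separable_factorization.intro[OF twisted_factorization separable_factorization_axioms.intro[OF bimodule]])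

lemma \<Gamma>_linear: "linear_map K A (A \<boxtimes> A) \<Gamma>A" "linear_map K B (B \<boxtimes> B) \<Gamma>B"
  by (rule bimodule_linear[OF algebras(1) bimodule(1)] bimodule_linear[OF algebras(2) bimodule(2)])+

lemmas [tensor_simps] = \<Gamma>_linear[THEN linear_closed] \<Gamma>_linear[THEN linear_app]

text \<open>The target \<open>A \<otimes> (A \<otimes> B)\<close> is the model
  \<open>A \<otimes> R\<close> of \<open>R \<otimes>\<^sub>B R\<close>. On
  \<open>b \<otimes> a\<close> the two composites become the two sums in
  \<open>centralA_iff\<close>, because \<tau> computes the products
  \<open>\<beta> b \<alpha> a\<close>.\<close>

lemma identityA_iff:
  "(\<forall>x\<in>carrier (B \<boxtimes> A).
     (tensor_assoc K A A B \<circ> tensor_map K (A \<boxtimes> A) B \<Gamma>A id \<circ> \<tau>) x =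
     (tensor_map K A (A \<boxtimes> B) id \<tau> \<circ> tensor_assoc K A B A \<circ> tensor_map K (A \<boxtimes> B) A \<tau> id \<circ>
      tensor_unassoc K B A A \<circ> tensor_map K B (A \<boxtimes> A) id \<Gamma>A) x) \<longleftrightarrow> F.centralA"
proof -
  note [simp] = \<tau>_linear \<Gamma>_linear linear_map_id
  have l: "linear_map K (B \<boxtimes> A) (A \<boxtimes> (A \<boxtimes> B))
      (\<lambda>x. (tensor_assoc K A A B \<circ> tensor_map K (A \<boxtimes> A) B \<Gamma>A id \<circ> \<tau>) x)"
    by (simp add: tensor_simps tensor_map_linear[of A B])
  have r: "linear_map K (B \<boxtimes> A) (A \<boxtimes> (A \<boxtimes> B))
      (\<lambda>x. (tensor_map K A (A \<boxtimes> B) id \<tau> \<circ> tensor_assoc K A B A \<circ> tensor_map K (A \<boxtimes> B) A \<tau> id \<circ>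
      tensor_unassoc K B A A \<circ> tensor_map K B (A \<boxtimes> A) id \<Gamma>A) x)"
    by (simp add: tensor_simps tensor_map_linear[of A "B \<boxtimes> A"] tensor_map_linear[of "B \<boxtimes> A" A]
        tensor_map_linear[of B A])
  have L: "(tensor_assoc K A A B \<circ> tensor_map K (A \<boxtimes> A) B \<Gamma>A id \<circ> \<tau>) (pure_tensor K B A b a) =
    sweedler K A B (A \<boxtimes> (A \<boxtimes> B)) (\<lambda>a' b'. sweedler K A A (A \<boxtimes> (A \<boxtimes> B))
      (\<lambda>x y. pure_tensor K A (A \<boxtimes> B) x (pure_tensor K A B y b')) (\<Gamma>A a')) (\<tau> (pure_tensor K B A b a))"
    if "a \<in> carrier A" "b \<in> carrier B" for a b
    using that by (simp add: tensor_map_id_right_eval[of A B] tensor_assoc_eval tensor_simps)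
  have R: "(tensor_map K A (A \<boxtimes> B) id \<tau> \<circ> tensor_assoc K A B A \<circ> tensor_map K (A \<boxtimes> B) A \<tau> id \<circ>
      tensor_unassoc K B A A \<circ> tensor_map K B (A \<boxtimes> A) id \<Gamma>A) (pure_tensor K B A b a) =
    sweedler K A A (A \<boxtimes> (A \<boxtimes> B)) (\<lambda>x y. sweedler K A B (A \<boxtimes> (A \<boxtimes> B))
      (\<lambda>x' b'. pure_tensor K A (A \<boxtimes> B) x' (\<tau> (pure_tensor K B A b' y))) (\<tau> (pure_tensor K B A b x))) (\<Gamma>A a)"
    if "a \<in> carrier A" "b \<in> carrier B" for a b
    using that by (simp add: tensor_map_pure[OF K_field, of B A] tensor_unassoc_eval tensor_map_sweedler
        tensor_map_pure[OF K_field, of "B \<boxtimes> A" A] tensor_map_pure[OF K_field, of A "B \<boxtimes> A"]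
        tensor_assoc_eval tensor_simps)
  have balB: "F.balB p q = sweedler K A B (A \<boxtimes> (A \<boxtimes> B))
      (\<lambda>a b. pure_tensor K A (A \<boxtimes> B) a (pure_tensor K A B \<one>\<^bsub>A\<^esub> b \<otimes>\<^bsub>R\<^esub> q)) p" for p q
    by (simp add: F.balB_def twisted_simps)
  show ?thesis
    unfolding F.centralA_iff
    by (subst linear_eq_iff[OF _ _ _ l r])
      (simp_all add: L R tensor_simps twisted_simps balB twisted_mult_pure_pure del: o_apply)
qed

text \<open>The target \<open>A \<otimes> (B \<otimes> B)\<close> is the model of
  \<open>R \<otimes>\<^sub>A R\<close> used by \<open>balA\<close>; on \<open>b \<otimes> a\<close>
  the composites become the two sums in \<open>centralB_iff\<close>.\<close>

lemma identityB_iff: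
  "(\<forall>x\<in>carrier (B \<boxtimes> A).
     (tensor_map K A (B \<boxtimes> B) id \<Gamma>B \<circ> \<tau>) x =
     (tensor_assoc K A B B \<circ> tensor_map K (A \<boxtimes> B) B \<tau> id \<circ> tensor_unassoc K B A B \<circ>
      tensor_map K B (A \<boxtimes> B) id \<tau> \<circ> tensor_assoc K B B A \<circ> tensor_map K (B \<boxtimes> B) A \<Gamma>B id) x) \<longleftrightarrow> F.centralB"
proof -
  note [simp] = \<tau>_linear \<Gamma>_linear linear_map_id
  have l: "linear_map K (B \<boxtimes> A) (A \<boxtimes> (B \<boxtimes> B)) (\<lambda>x. (tensor_map K A (B \<boxtimes> B) id \<Gamma>B \<circ> \<tau>) x)"
    by (simp add: tensor_simps tensor_map_linear[of A B])
  have r: "linear_map K (B \<boxtimes> A) (A \<boxtimes> (B \<boxtimes> B))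
     (\<lambda>x. (tensor_assoc K A B B \<circ> tensor_map K (A \<boxtimes> B) B \<tau> id \<circ> tensor_unassoc K B A B \<circ>
      tensor_map K B (A \<boxtimes> B) id \<tau> \<circ> tensor_assoc K B B A \<circ> tensor_map K (B \<boxtimes> B) A \<Gamma>B id) x)"
    by (simp add: tensor_simps tensor_map_linear[of B "B \<boxtimes> A"] tensor_map_linear[of "B \<boxtimes> A" B]
        tensor_map_linear[of B A])
  \<comment> \<open>Used to spread \<open>\<Gamma>B b'\<close> into a Sweedler sum, the shape of the
    summands in \<open>centralB_iff\<close>.\<close>
  have s: "sweedler K B B (A \<boxtimes> (B \<boxtimes> B)) (\<lambda>u v. pure_tensor K A (B \<boxtimes> B) a (pure_tensor K B B u v)) t =
      pure_tensor K A (B \<boxtimes> B) a t" if "a \<in> carrier A" "t \<in> carrier (B \<boxtimes> B)" for a t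
    using that by (subst sweedler_pure_right[symmetric]) (simp_all add: tensor_simps)
  have L: "(tensor_map K A (B \<boxtimes> B) id \<Gamma>B \<circ> \<tau>) (pure_tensor K B A b a) =
    sweedler K A B (A \<boxtimes> (B \<boxtimes> B)) (\<lambda>a' b'. sweedler K B B (A \<boxtimes> (B \<boxtimes> B))
      (\<lambda>u v. pure_tensor K A (B \<boxtimes> B) a' (pure_tensor K B B u v)) (\<Gamma>B b')) (\<tau> (pure_tensor K B A b a))"
    if "a \<in> carrier A" "b \<in> carrier B" for a b
    using that by (simp add: s tensor_map_id_left_eval[of A B] tensor_simps)
  have R: "(tensor_assoc K A B B \<circ> tensor_map K (A \<boxtimes> B) B \<tau> id \<circ> tensor_unassoc K B A B \<circ>
      tensor_map K B (A \<boxtimes> B) id \<tau> \<circ> tensor_assoc K B B A \<circ> tensor_map K (B \<boxtimes> B) A \<Gamma>B id) (pure_tensor K B A b a) =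
    sweedler K B B (A \<boxtimes> (B \<boxtimes> B)) (\<lambda>u v. sweedler K A B (A \<boxtimes> (B \<boxtimes> B)) (\<lambda>a' v'.
      sweedler K A B (A \<boxtimes> (B \<boxtimes> B)) (\<lambda>a'' u'. pure_tensor K A (B \<boxtimes> B) a'' (pure_tensor K B B u' v'))
        (\<tau> (pure_tensor K B A u a'))) (\<tau> (pure_tensor K B A v a))) (\<Gamma>B b)"
    if "a \<in> carrier A" "b \<in> carrier B" for a b
    using that by (simp add: tensor_map_pure[OF K_field, of B A] tensor_unassoc_eval tensor_map_sweedler
        tensor_map_pure[OF K_field, of "B \<boxtimes> A" B] tensor_map_pure[OF K_field, of B "B \<boxtimes> A"]
        tensor_assoc_eval tensor_simps)
  have balA: "F.balA p q = sweedler K A B (A \<boxtimes> (B \<boxtimes> B)) (\<lambda>a b.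
     sweedler K A B (A \<boxtimes> (B \<boxtimes> B)) (\<lambda>a' b'. pure_tensor K A (B \<boxtimes> B) a' (pure_tensor K B B b' b))
       (p \<otimes>\<^bsub>R\<^esub> pure_tensor K A B a \<one>\<^bsub>B\<^esub>)) q" for p q
    by (simp add: F.balA_def twisted_simps)
  show ?thesis
    unfolding F.centralB_iff
    by (subst linear_eq_iff[OF _ _ _ l r])
      (simp_all add: L R tensor_simps twisted_simps balA twisted_mult_pure_pure del: o_apply)
qed

text \<open>\<Psi> applies the inverse of \<tau> to its middle argument
  \<open>y \<otimes> u\<close>, so summing over \<open>\<Gamma>A a\<close> and
  \<open>\<Gamma>B b\<close> reproduces \<open>(1 \<otimes> \<tau>\<^sup>-\<^sup>1 \<otimes> 1)
  (\<Gamma>A \<otimes> \<Gamma>B)\<close>.\<close>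

lemma twisted_splitting_iff:
  "bimodule_right_inverse K R (twisted_splitting K A B \<tau> \<Gamma>A \<Gamma>B) \<longleftrightarrow> F.centralA \<and> F.centralB"
proof (rule F.bimodule_right_inverse_factorization_iff)
  note [simp] = \<Gamma>_linear \<sigma>_linear
  show "linear_map K R (R \<boxtimes> R) (twisted_splitting K A B \<tau> \<Gamma>A \<Gamma>B)"
    using tensor_middle_linear[of A A B B B A \<sigma>, OF _ _ _ _ _ _ _ tensor_map_linear[OF _ _ _ _ _ _ linear_ident], of A B \<Gamma>A \<Gamma>B]
    by (simp add: twisted_splitting_def o_def twisted_simps tensor_simps)
  fix a b assume ab [simp]: "a \<in> carrier A" "b \<in> carrier B"
  show "twisted_splitting K A B \<tau> \<Gamma>A \<Gamma>B (pure_tensor K A B a \<one>\<^bsub>B\<^esub> \<otimes>\<^bsub>R\<^esub> pure_tensor K A B \<one>\<^bsub>A\<^esub> b) =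
    F.sumA (R \<boxtimes> R) (\<lambda>x y. F.sumB (R \<boxtimes> R) (\<lambda>u v. F.\<Psi> (pure_tensor K A B x \<one>\<^bsub>B\<^esub>)
      (pure_tensor K A B y \<one>\<^bsub>B\<^esub> \<otimes>\<^bsub>R\<^esub> pure_tensor K A B \<one>\<^bsub>A\<^esub> u) (pure_tensor K A B \<one>\<^bsub>A\<^esub> v)) b) a"
    by (simp add: twisted_splitting_def F.\<Psi>_def twisted_simps twisted_mult_pure_pure tensor_simps
        tensor_map_pure[OF K_field, of A B] tensor_middle_pure)
qed

end

theorem theorem3p16:
  fixes K :: "('k, 'm) ring_scheme"
    and A :: "('k, 'a) module"
    and B :: "('k, 'b) module"
    and \<Gamma>A :: "'a \<Rightarrow> ('a \<times> 'a \<Rightarrow> 'k) set"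
    and \<Gamma>B :: "'b \<Rightarrow> ('b \<times> 'b \<Rightarrow> 'k) set"
    and \<tau> :: "('b \<times> 'a \<Rightarrow> 'k) set \<Rightarrow> ('a \<times> 'b \<Rightarrow> 'k) set"
  assumes "field K"
    and "separable_algebra K A"
    and "separable_algebra K B"
    and "bimodule_right_inverse K A \<Gamma>A"
    and "bimodule_right_inverse K B \<Gamma>B"
    and "twisting_map K A B \<tau>"
  shows
    "((\<forall>x\<in>carrier (B \<boxtimes>\<^bsub>K\<^esub> A).
         (tensor_assoc K A A B \<circ> tensor_map K (A \<boxtimes>\<^bsub>K\<^esub> A) B \<Gamma>A id \<circ> \<tau>) x =
         (tensor_map K A (A \<boxtimes>\<^bsub>K\<^esub> B) id \<tau> \<circ>
          tensor_assoc K A B A \<circ>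
          tensor_map K (A \<boxtimes>\<^bsub>K\<^esub> B) A \<tau> id \<circ>
          tensor_unassoc K B A A \<circ>
          tensor_map K B (A \<boxtimes>\<^bsub>K\<^esub> A) id \<Gamma>A) x) \<and>
      (\<forall>x\<in>carrier (B \<boxtimes>\<^bsub>K\<^esub> A).
         (tensor_map K A (B \<boxtimes>\<^bsub>K\<^esub> B) id \<Gamma>B \<circ> \<tau>) x =
         (tensor_assoc K A B B \<circ>
          tensor_map K (A \<boxtimes>\<^bsub>K\<^esub> B) B \<tau> id \<circ>
          tensor_unassoc K B A B \<circ>
          tensor_map K B (A \<boxtimes>\<^bsub>K\<^esub> B) id \<tau> \<circ>
          tensor_assoc K B B A \<circ>
          tensor_map K (B \<boxtimes>\<^bsub>K\<^esub> B) A \<Gamma>B id) x)) \<longleftrightarrow>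
     (separable_algebra K (twisted_tensor K A B \<tau>) \<and>
      bimodule_right_inverse K (twisted_tensor K A B \<tau>) (twisted_splitting K A B \<tau> \<Gamma>A \<Gamma>B))"
proof -
  interpret twisted_separable K A B \<tau> \<Gamma>A \<Gamma>B
    using assms
    by (intro twisted_separable.intro twisted_algebras.intro base_field.intro twisted_algebras_axioms.intro
        twisted_separable_axioms.intro) (simp_all add: separable_algebra_def)
  \<comment> \<open>The twisting axioms already give an associative algebra, so separability asks
    only for some splitting, and the explicit one is a witness.\<close>
  have "separable_algebra K R \<longleftrightarrow> (\<exists>\<Gamma>. bimodule_right_inverse K R \<Gamma>)"
    using twisted_algebra by (simp add: separable_algebra_def)
  then show ?thesis
    unfolding identityA_iff identityB_iff twisted_splitting_iff[symmetric] by blast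
qed

end
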